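(* Let $(M,g)$ be an $m$-dimensional singular manifold with singularity datum $(\rho,\mathfrak K)$, $W$ a fully uniformly regular vector bundle over $M$, $V=T^\sigma_\tau(M,W)$, $r\in\mathbb N\setminus\{0\}$, and $\vec\omega=(\lambda,\mu)\in\mathbb R^2$. Suppose either $s\in r\mathbb N$ and $\mathcal B\in\{BC,bc\}$, or $s>0$ and $\mathcal B\in\{B_\infty,b_\infty\}$. Then $r^+$ is a retraction from $\mathcal B^{s/\vec r,\vec\omega}(\mathbb R,V)$ onto $\mathcal B^{s/\vec r,\vec\omega}(\mathbb R^+,V)$, and $e^+$ is a coretraction; that is, $r^+\in\mathcal L\big(\mathcal B^{s/\vec r,\vec\omega}(\mathbb R,V),\mathcal B^{s/\vec r,\vec\omega}(\mathbb R^+,V)\big)$, $e^+\in\mathcal L\big(\mathcal B^{s/\vec r,\vec\omega}(\mathbb R^+,V),\mathcal B^{s/\vec r,\vec\omega}(\mathbb R,V)\big)$, and $r^+e^+=\mathrm{id}$.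
   Context: Conventions: $\mathbb N=\{0,1,2,\dots\}$; $\mathbb K\in\{\mathbb R,\mathbb C\}$; $\mathbb R^+=[0,\infty)$; $\mathbb H^m=\mathbb R^+\times\mathbb R^{m-1}$; $c,c(k)$ are constants independent of the free variables; $f\sim g$ means $g/c\le f\le cg$. Manifolds are smooth, separable, metrizable, possibly with boundary. Singular manifold: let $Q=(-1,1)$. An atlas $\mathfrak K$ of an $m$-dimensional manifold $M$ is uniformly regular if (a) each $\kappa\in\mathfrak K$, with domain $U_\kappa$, satisfies $\kappa(U_\kappa)=Q_\kappa^m$, where $Q_\kappa^m=Q^m$ if $U_\kappa\subset\mathring M$ and $Q_\kappa^m=Q^m\cap\mathbb H^m$ if $U_\kappa\cap\partial M\ne\emptyset$; (b) for some $\varepsilon\in(0,1)$ the sets $\kappa^{-1}(\varepsilon Q_\kappa^m)$ cover $M$; (c) for some $N\in\mathbb N$ any intersection of more than $N$ of the $U_\kappa$ is empty; (d) all derivatives of order $\le k$ of $\tilde\kappa\circ\kappa^{-1}$ are bounded by $c(k)$, for all $\kappa,\tilde\kappa\in\mathfrak K$, $k\in\mathbb N$. A Riemannian manifold $(M,\bar g)$ is uniformly regular with respect to $\mathfrak K$ if in addition $\kappa_*\bar g\sim g_m$ (Euclidean metric) and $\|\kappa_*\bar g\|_{k,\infty}\le c(k)$ for $\kappa\in\mathfrak K$, $k\in\mathbb N$ ($\|\cdot\|_{k,\infty}$ = sup norm of derivatives of order $\le k$). A Riemannian manifold $(M,g)$ is singular with singularity datum $(\rho,\mathfrak K)$ if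 $\rho\in C^\infty(M,(0,\infty))$, $\mathfrak K$ is a uniformly regular atlas (orientation preserving if $M$ is oriented), $(M,g/\rho^2)$ is uniformly regular with respect to $\mathfrak K$, and, with $\rho_\kappa:=\rho(\kappa^{-1}(0))$, $\|\kappa_*\rho\|_{k,\infty}\le c(k)\rho_\kappa$ and $\rho_\kappa/c\le\rho\le c\rho_\kappa$ on $U_\kappa$. Bundles: a vector bundle $W=(W,h_W,D)$ over $M$ with bundle metric $h_W$, metric connection $D$ and model fiber a finite-dimensional Hilbert space $F$ is fully uniformly regular if it has bundle charts $\kappa\ltimes\varphi:W|_{U_\kappa}\to Q_\kappa^m\times F$, one over each $\kappa\in\mathfrak K$, such that $(\kappa\ltimes\varphi)_*h_W\sim(\cdot|\cdot)_F$ and the transition functions, the local representation of $h_W$ and the Christoffel symbols of $D$ have all derivatives of order $\le k$ bounded by $c(k)$, uniformly over the charts. For $\sigma,\tau\in\mathbb N$, $V=T_\tau^\sigma(M,W)=T_\tau^\sigma M\otimes W$ is the bundle of $W$-valued tensors contravariant of order $\sigma$ and covariant of order $\tau$ (tangent bundles complexified if $\mathbb K=\mathbb C$), with bundle metric $h$ induced by $g$ and $h_W$ and connection $\nabla$ induced by the Levi-Civita connection and $D$. $C(V)$: continuous sections. Spaces ($J\in\{\mathbb R,\mathbb R^+\}$, $\vec\omega=(\lambda,\mu)$, $s/\vec r=(s,s/r)$, $\partial$ time derivative): $BC^{kr/\vec r,\vec\omega}(J,V)$, $k\in\mathbb N$, consists of all $u\in C(J,C(V))$ with $\nabla^i\partial^ju$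 continuous for $i+jr\le kr$ and finite norm $\max_{i+jr\le kr}\sup_{M\times J}\rho^{\lambda+i+j\mu+\tau-\sigma}|\nabla^i\partial^ju|_h$; $BC^{\infty/\vec r,\vec\omega}=\bigcap_kBC^{kr/\vec r,\vec\omega}$; $bc^{kr/\vec r,\vec\omega}$ is its closure in $BC^{kr/\vec r,\vec\omega}$. $B_\infty^{s/\vec r,\vec\omega}(J,V)$ is the real interpolation space $(bc^{kr/\vec r,\vec\omega},bc^{(k+1)r/\vec r,\vec\omega})_{(s-kr)/r,\infty}$ if $kr<s<(k+1)r$, and $(bc^{kr/\vec r,\vec\omega},bc^{(k+2)r/\vec r,\vec\omega})_{1/2,\infty}$ if $s=(k+1)r$; $b_\infty^{s/\vec r,\vec\omega}$ is the closure of $BC^{\infty/\vec r,\vec\omega}$ in it. Extension: fix $h\in C^\infty((0,\infty),\mathbb R)$ with $\int_0^\infty t^s|h(t)|\,dt<\infty$ for all $s\in\mathbb R$, $(-1)^k\int_0^\infty t^kh(t)\,dt=1$ for all $k\in\mathbb Z$, and $h(1/t)=-th(t)$ for $t>0$ (such $h$ exists). $r^+u:=u|_{\mathbb R^+}$ is restriction in time, and $e^+v(t):=v(t)$ for $t\ge0$, $e^+v(t):=\int_0^\infty h(s)v(-st)\,ds$ for $t<0$. *)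

theory Defs
  imports "HOL-Analysis.Analysis" "HOL-Library.Function_Algebras"
begin

subsection \<open>The scalar field\<close>

text \<open>
  The scalar field is a type \<open>'k::{real_normed_field,euclidean_space}\<close>.  By Gelfand--Mazur such a
  type is isometrically isomorphic to the reals or to the complex numbers, so that a variable of
  this sort ranges exactly over the two admissible scalar fields.  The following formulas for
  the real part and the conjugate make sense for both.
\<close>

definition re_part :: "'k::{real_normed_field,euclidean_space} \<Rightarrow> real" where
  "re_part z = z \<bullet> 1"

definition kconj :: "'k::{real_normed_field,euclidean_space} \<Rightarrow> 'k" where
  "kconj z = of_real (2 * re_part z) - z"

lemma re_part_real: "re_part (x::real) = x"
  by (simp add: re_part_def)

lemma re_part_complex: "re_part (z::complex) = Re z"
  by (simp add: re_part_def inner_complex_def)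

lemma kconj_real: "kconj (x::real) = x"
  by (simp add: kconj_def re_part_real)

lemma kconj_complex: "kconj (z::complex) = cnj z"
  by (simp add: kconj_def re_part_complex complex_eq_iff)


subsection \<open>Smooth functions on open subsets of Euclidean space or of a half-space\<close>

text \<open>
  Partial derivatives relative to \<open>S\<close>: one-sided at points of \<open>S\<close> lying on the boundary of the
  half-space.
\<close>

definition line_dom :: "(real^'m) set \<Rightarrow> 'm::finite \<Rightarrow> real^'m \<Rightarrow> real set" where
  "line_dom S l x = {s. x + s *\<^sub>R axis l 1 \<in> S}"

definition pdiff :: "(real^'m) set \<Rightarrow> 'm::finite \<Rightarrow> (real^'m \<Rightarrow> 'b::real_normed_vector) \<Rightarrow> real^'m \<Rightarrow> bool" where
  "pdiff S l f x \<longleftrightarrow> (\<lambda>s. f (x + s *\<^sub>R axis l 1)) differentiable (at 0 within line_dom S l x)"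

definition pd :: "(real^'m) set \<Rightarrow> 'm::finite \<Rightarrow> (real^'m \<Rightarrow> 'b::real_normed_vector) \<Rightarrow> real^'m \<Rightarrow> 'b" where
  "pd S l f x = vector_derivative (\<lambda>s. f (x + s *\<^sub>R axis l 1)) (at 0 within line_dom S l x)"

primrec pds :: "(real^'m) set \<Rightarrow> 'm list \<Rightarrow> (real^'m \<Rightarrow> 'b::real_normed_vector) \<Rightarrow> real^'m \<Rightarrow> 'b" where
  "pds S [] f = f"
| "pds S (l # ls) f = pd S l (pds S ls f)"

definition smooth_on :: "(real^'m) set \<Rightarrow> (real^'m \<Rightarrow> 'b::real_normed_vector) \<Rightarrow> bool" where
  "smooth_on S f \<longleftrightarrow>
     (\<forall>ls. continuous_on S (pds S ls f) \<and> (\<forall>l. \<forall>x\<in>S. pdiff S l (pds S ls f) x))"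

text \<open>\<open>derivs_le k c S f\<close> says that the norm of \<open>f\<close> with indices \<open>k, \<infinity>\<close> on \<open>S\<close> is at most \<open>c\<close>.\<close>

definition derivs_le :: "nat \<Rightarrow> real \<Rightarrow> (real^'m) set \<Rightarrow> (real^'m \<Rightarrow> 'b::real_normed_vector) \<Rightarrow> bool" where
  "derivs_le k c S f \<longleftrightarrow> (\<forall>ls. length ls \<le> k \<longrightarrow> (\<forall>x\<in>S. norm (pds S ls f x) \<le> c))"


subsection \<open>Uniformly regular atlases\<close>

text \<open>
  The manifold is the whole type \<open>'a\<close>, a separable metrizable space (only its topology is used).
  A chart is a partial map whose domain is the coordinate patch.  The smooth structure of
  the manifold is the one generated by the atlas.  The dimension is \<open>CARD('m)\<close>, and the order on the index type
  only serves to single out the first coordinate.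
\<close>

type_synonym ('a,'m) chart = "'a \<Rightarrow> (real^'m) option"

definition ch :: "('a,'m::finite) chart \<Rightarrow> 'a \<Rightarrow> real^'m" where
  "ch \<kappa> p = the (\<kappa> p)"

definition chinv :: "('a,'m::finite) chart \<Rightarrow> real^'m \<Rightarrow> 'a" where
  "chinv \<kappa> x = (THE p. \<kappa> p = Some x)"

definition loc :: "('a,'m::finite) chart \<Rightarrow> ('a \<Rightarrow> 'b) \<Rightarrow> real^'m \<Rightarrow> 'b" where
  "loc \<kappa> f = (\<lambda>x. f (chinv \<kappa> x))"

definition overlap :: "('a,'m::finite) chart \<Rightarrow> ('a,'m::finite) chart \<Rightarrow> (real^'m) set" where
  "overlap \<kappa> \<kappa>' = ch \<kappa> ` (dom \<kappa> \<inter> dom \<kappa>')"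

definition first_coord :: "'m::{finite,linorder}" where
  "first_coord = Min UNIV"

definition half_space :: "(real^'m::{finite,linorder}) set" where
  "half_space = {x. 0 \<le> x $ first_coord}"

definition cube :: "(real^'m) set" where
  "cube = {x. \<forall>i. \<bar>x $ i\<bar> < 1}"

text \<open>
  Boundary points are those which a chart with values in the half-space maps to the boundary of
  the half-space.
\<close>

definition mf_boundary :: "('a,'m::{finite,linorder}) chart set \<Rightarrow> 'a set" where
  "mf_boundary K = {p. \<exists>\<kappa>\<in>K. ran \<kappa> \<subseteq> half_space \<and> p \<in> dom \<kappa> \<and> ch \<kappa> p $ first_coord = 0}"

definition cube_of ::
  "('a,'m::{finite,linorder}) chart set \<Rightarrow> ('a,'m) chart \<Rightarrow> (real^'m::{finite,linorder}) set" where
  "cube_of K \<kappa> = (if dom \<kappa> \<inter> mf_boundary K = {} then cube else cube \<inter> half_space)"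

definition uniformly_regular_atlas ::
  "('a::topological_space,'m::{finite,linorder}) chart set \<Rightarrow> bool" where
  "uniformly_regular_atlas K \<longleftrightarrow>
     (\<forall>\<kappa>\<in>K. open (dom \<kappa>) \<and> homeomorphism (dom \<kappa>) (ran \<kappa>) (ch \<kappa>) (chinv \<kappa>)
            \<and> ran \<kappa> = cube_of K \<kappa>) \<and>
     (\<exists>\<epsilon>. 0 < \<epsilon> \<and> \<epsilon> < 1 \<and>
        (\<forall>p. \<exists>\<kappa>\<in>K. p \<in> dom \<kappa> \<and> ch \<kappa> p \<in> (\<lambda>x. \<epsilon> *\<^sub>R x) ` cube_of K \<kappa>)) \<and>
     (\<exists>N::nat. \<forall>L. L \<subseteq> K \<and> finite L \<and> N < card L \<longrightarrow> (\<Inter>\<kappa>\<in>L. dom \<kappa>) = {}) \<and>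
     (\<forall>\<kappa>\<in>K. \<forall>\<kappa>'\<in>K. smooth_on (overlap \<kappa> \<kappa>') (loc \<kappa> (ch \<kappa>'))) \<and>
     (\<forall>k. \<exists>c. \<forall>\<kappa>\<in>K. \<forall>\<kappa>'\<in>K. derivs_le k c (overlap \<kappa> \<kappa>') (loc \<kappa> (ch \<kappa>')))"

text \<open>\<open>jac \<kappa> \<kappa>' p i j\<close> is the derivative of the \<open>i\<close>th \<open>\<kappa>'\<close>-coordinate by the \<open>j\<close>th \<open>\<kappa>\<close>-coordinate.\<close>

definition jac :: "('a,'m::finite) chart \<Rightarrow> ('a,'m::finite) chart \<Rightarrow> 'a \<Rightarrow> 'm::finite \<Rightarrow> 'm::finite \<Rightarrow> real" where
  "jac \<kappa> \<kappa>' p i j = pd (overlap \<kappa> \<kappa>') j (\<lambda>x. loc \<kappa> (ch \<kappa>') x $ i) (ch \<kappa> p)"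


subsection \<open>Singular manifolds\<close>

text \<open>A Riemannian metric is given by its matrices with respect to the charts of the atlas.\<close>

type_synonym ('a,'m) metric = "('a,'m) chart \<Rightarrow> 'a \<Rightarrow> real^'m^'m"

definition riemannian_metric ::
  "('a,'m::finite) chart set \<Rightarrow> ('a,'m::finite) metric \<Rightarrow> bool" where
  "riemannian_metric K g \<longleftrightarrow>
     (\<forall>\<kappa>\<in>K. smooth_on (ran \<kappa>) (loc \<kappa> (g \<kappa>)) \<and>
        (\<forall>p\<in>dom \<kappa>. transpose (g \<kappa> p) = g \<kappa> p \<and> (\<forall>\<xi>. \<xi> \<noteq> 0 \<longrightarrow> 0 < \<xi> \<bullet> (g \<kappa> p *v \<xi>)))) \<and>
     (\<forall>\<kappa>\<in>K. \<forall>\<kappa>'\<in>K. \<forall>p \<in> dom \<kappa> \<inter> dom \<kappa>'. \<forall>i j.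
        g \<kappa> p $ i $ j = (\<Sum>a\<in>UNIV. \<Sum>b\<in>UNIV. jac \<kappa> \<kappa>' p a i * jac \<kappa> \<kappa>' p b j * g \<kappa>' p $ a $ b))"

definition uniformly_regular_riemannian ::
  "('a::topological_space,'m::{finite,linorder}) chart set \<Rightarrow> ('a,'m) metric \<Rightarrow> bool" where
  "uniformly_regular_riemannian K g \<longleftrightarrow>
     uniformly_regular_atlas K \<and> riemannian_metric K g \<and>
     (\<exists>c\<ge>1. \<forall>\<kappa>\<in>K. \<forall>p\<in>dom \<kappa>. \<forall>\<xi>.
        (norm \<xi>)\<^sup>2 / c \<le> \<xi> \<bullet> (g \<kappa> p *v \<xi>) \<and> \<xi> \<bullet> (g \<kappa> p *v \<xi>) \<le> c * (norm \<xi>)\<^sup>2) \<and>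
     (\<forall>k. \<exists>c. \<forall>\<kappa>\<in>K. derivs_le k c (ran \<kappa>) (loc \<kappa> (g \<kappa>)))"

record ('a,'m::finite) sing_mf =
  Atlas :: "('a,'m) chart set"
  Metric :: "('a,'m) metric"
  Weight :: "'a \<Rightarrow> real"

text \<open>
  \<open>(M, Metric M)\<close> is a singular manifold with singularity datum \<open>(Weight M, Atlas M)\<close>.
\<close>

definition singular_manifold ::
  "('a::topological_space,'m::{finite,linorder}) sing_mf \<Rightarrow> bool" where
  "singular_manifold M \<longleftrightarrow>
     uniformly_regular_atlas (Atlas M) \<and>
     riemannian_metric (Atlas M) (Metric M) \<and>
     (\<forall>p. 0 < Weight M p) \<and>
     (\<forall>\<kappa>\<in>Atlas M. smooth_on (ran \<kappa>) (loc \<kappa> (Weight M))) \<and>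
     uniformly_regular_riemannian (Atlas M) (\<lambda>\<kappa> p. (1 / (Weight M p)\<^sup>2) *\<^sub>R Metric M \<kappa> p) \<and>
     (\<forall>k. \<exists>c. \<forall>\<kappa>\<in>Atlas M.
        derivs_le k (c * Weight M (chinv \<kappa> 0)) (ran \<kappa>) (loc \<kappa> (Weight M))) \<and>
     (\<exists>c\<ge>1. \<forall>\<kappa>\<in>Atlas M. \<forall>p\<in>dom \<kappa>.
        Weight M (chinv \<kappa> 0) / c \<le> Weight M p \<and> Weight M p \<le> c * Weight M (chinv \<kappa> 0))"


subsection \<open>Vector bundles\<close>

text \<open>
  \<open>'w\<close> is the total space.  The model fiber is a linear subspace \<open>MFiber\<close> of the standard Hilbert
  space \<open>'k^'n\<close>; up to isometry these are all finite-dimensional Hilbert spaces, including the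
  zero space.  There is one bundle chart over each \<open>\<kappa>\<close> of the atlas, sending \<open>w\<close> to
  \<open>(\<kappa> (Proj w), Triv \<kappa> w)\<close>; the linear structure of the fibers is the one transported by these
  charts.  \<open>FMetric\<close> is only used for two vectors of the same fiber.  The connection is
  represented by its Christoffel symbols: \<open>Chr \<kappa> p l a\<close> is the covariant derivative, in the
  direction of the \<open>l\<close>th coordinate and at the point \<open>p\<close>, of the local section with constant
  representation \<open>a\<close>.
\<close>

record ('w,'a,'m::finite,'k,'n::finite) vbundle =
  Proj :: "'w \<Rightarrow> 'a"
  MFiber :: "('k^'n) set"
  Triv :: "('a,'m) chart \<Rightarrow> 'w \<Rightarrow> 'k^'n"
  FMetric :: "'w \<Rightarrow> 'w \<Rightarrow> 'k"
  Chr :: "('a,'m) chart \<Rightarrow> 'a \<Rightarrow> 'm \<Rightarrow> 'k^'n \<Rightarrow> 'k^'n"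

definition wpt :: "('w,'a,'m::finite,'k,'n::finite) vbundle \<Rightarrow> ('a,'m::finite) chart \<Rightarrow> 'a \<Rightarrow> 'k^'n \<Rightarrow> 'w" where
  "wpt W \<kappa> p a = (THE w. Proj W w = p \<and> Triv W \<kappa> w = a)"

definition btrans ::
  "('w,'a,'m::finite,'k,'n::finite) vbundle \<Rightarrow> ('a,'m::finite) chart \<Rightarrow> ('a,'m::finite) chart \<Rightarrow> 'a \<Rightarrow> 'k^'n \<Rightarrow> 'k^'n" where
  "btrans W \<kappa> \<kappa>' p a = Triv W \<kappa>' (wpt W \<kappa> p a)"

definition hloc ::
  "('w,'a,'m::finite,'k,'n::finite) vbundle \<Rightarrow> ('a,'m::finite) chart \<Rightarrow> 'a \<Rightarrow> 'k^'n \<Rightarrow> 'k^'n \<Rightarrow> 'k" where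
  "hloc W \<kappa> p a b = FMetric W (wpt W \<kappa> p a) (wpt W \<kappa> p b)"

definition linear_on :: "('k::field^'n) set \<Rightarrow> ('k^'n \<Rightarrow> 'k^'n) \<Rightarrow> bool" where
  "linear_on F A \<longleftrightarrow>
     (\<forall>a\<in>F. A a \<in> F \<and> (\<forall>b\<in>F. A (a + b) = A a + A b) \<and> (\<forall>z. A (z *s a) = z *s A a))"

definition inner_product_on ::
  "('k::{real_normed_field,euclidean_space}^'n) set \<Rightarrow> ('k^'n \<Rightarrow> 'k^'n \<Rightarrow> 'k) \<Rightarrow> bool" where
  "inner_product_on F h \<longleftrightarrow>
     (\<forall>a\<in>F. \<forall>b\<in>F. (\<forall>d\<in>F. h (a + b) d = h a d + h b d) \<and> (\<forall>z. h (z *s a) b = z * h a b)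
        \<and> h b a = kconj (h a b)) \<and>
     (\<forall>a\<in>F. a \<noteq> 0 \<longrightarrow> 0 < re_part (h a a))"

text \<open>The bundle with its charts and its bundle metric, without the connection.\<close>

definition metric_bundle ::
  "('a::topological_space,'m::{finite,linorder}) chart set \<Rightarrow>
   ('w,'a,'m,'k::{real_normed_field,euclidean_space},'n::finite) vbundle \<Rightarrow> bool" where
  "metric_bundle K W \<longleftrightarrow>
     vec.subspace (MFiber W) \<and>
     (\<forall>\<kappa>\<in>K. \<forall>p\<in>dom \<kappa>. bij_betw (Triv W \<kappa>) {w. Proj W w = p} (MFiber W)
        \<and> inner_product_on (MFiber W) (hloc W \<kappa> p)) \<and>
     (\<forall>\<kappa>\<in>K. \<forall>\<kappa>'\<in>K. \<forall>p \<in> dom \<kappa> \<inter> dom \<kappa>'. linear_on (MFiber W) (btrans W \<kappa> \<kappa>' p)) \<and>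
     (\<forall>\<kappa>\<in>K. \<forall>\<kappa>'\<in>K. \<forall>a\<in>MFiber W.
        smooth_on (overlap \<kappa> \<kappa>') (loc \<kappa> (\<lambda>p. btrans W \<kappa> \<kappa>' p a))) \<and>
     (\<forall>\<kappa>\<in>K. \<forall>a\<in>MFiber W. \<forall>b\<in>MFiber W. smooth_on (ran \<kappa>) (loc \<kappa> (\<lambda>p. hloc W \<kappa> p a b)))"


subsection \<open>Bundle-valued tensors and covariant derivatives\<close>

text \<open>
  An element of the fiber over \<open>p\<close> of the bundle of \<open>W\<close>-valued tensors is the family \<open>v\<close> of its
  component arrays: \<open>v \<kappa> I L\<close>, an element of the model fiber of \<open>W\<close>, is the component with
  respect to \<open>\<kappa>\<close> with contravariant indices \<open>I\<close> and covariant indices \<open>L\<close>; arrays with respect to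
  different charts are related by the tensorial transformation law.  For index lists of the wrong
  length, and for charts not defined at \<open>p\<close>, the entries are set to zero.  (Since the
  coefficients lie in a vector space over the scalar field, this is the complexified tensor bundle
  in the complex case.)
\<close>

type_synonym ('a,'m,'k,'n) tensor = "('a,'m) chart \<Rightarrow> 'm list \<Rightarrow> 'm list \<Rightarrow> 'k^'n"
type_synonym ('a,'m,'k,'n) tsec = "'a \<Rightarrow> ('a,'m,'k,'n) tensor"

definition idx :: "nat \<Rightarrow> 'm::finite list set" where
  "idx n = {I. length I = n}"

definition tensor_fiber ::
  "('a,'m::finite) chart set \<Rightarrow> ('w,'a,'m::finite,'k::{real_normed_field,euclidean_space},'n::finite) vbundle \<Rightarrow> nat \<Rightarrow> nat \<Rightarrow> 'a
   \<Rightarrow> ('a,'m::finite,'k,'n::finite) tensor set" where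
  "tensor_fiber K W \<sigma> \<tau> p = {v.
     (\<forall>\<kappa> I L. if \<kappa> \<in> K \<and> p \<in> dom \<kappa> \<and> I \<in> idx \<sigma> \<and> L \<in> idx \<tau> then v \<kappa> I L \<in> MFiber W else v \<kappa> I L = 0) \<and>
     (\<forall>\<kappa>\<in>K. \<forall>\<kappa>'\<in>K. p \<in> dom \<kappa> \<inter> dom \<kappa>' \<longrightarrow>
       (\<forall>I\<in>idx \<sigma>. \<forall>L\<in>idx \<tau>.
          v \<kappa>' I L = (\<Sum>I'\<in>idx \<sigma>. \<Sum>L'\<in>idx \<tau>.
            ((\<Prod>a<\<sigma>. jac \<kappa> \<kappa>' p (I ! a) (I' ! a)) * (\<Prod>b<\<tau>. jac \<kappa>' \<kappa> p (L' ! b) (L ! b)))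
              *\<^sub>R btrans W \<kappa> \<kappa>' p (v \<kappa> I' L'))))}"

text \<open>
  The norm of \<open>v\<close> in the fiber over \<open>p\<close> for the metric induced by \<open>g\<close> and \<open>FMetric W\<close>, computed in
  the chart \<open>\<kappa>\<close>; for tensors the value does not depend on the choice of \<open>\<kappa>\<close>.
\<close>

definition tnorm ::
  "('a,'m::finite) metric \<Rightarrow> ('w,'a,'m::finite,'k::{real_normed_field,euclidean_space},'n::finite) vbundle \<Rightarrow> nat \<Rightarrow> nat
   \<Rightarrow> ('a,'m::finite) chart \<Rightarrow> 'a \<Rightarrow> ('a,'m::finite,'k,'n::finite) tensor \<Rightarrow> real" where
  "tnorm g W \<sigma> \<tau> \<kappa> p v = sqrt (re_part
     (\<Sum>I\<in>idx \<sigma>. \<Sum>I'\<in>idx \<sigma>. \<Sum>L\<in>idx \<tau>. \<Sum>L'\<in>idx \<tau>.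
        ((\<Prod>a<\<sigma>. g \<kappa> p $ (I ! a) $ (I' ! a)) * (\<Prod>b<\<tau>. matrix_inv (g \<kappa> p) $ (L ! b) $ (L' ! b)))
          *\<^sub>R hloc W \<kappa> p (v \<kappa> I L) (v \<kappa> I' L')))"

text \<open>Christoffel symbols of the Levi-Civita connection: \<open>k\<close> is the upper index.\<close>

definition christoffel :: "('a,'m::finite) metric \<Rightarrow> ('a,'m::finite) chart \<Rightarrow> 'a \<Rightarrow> 'm::finite \<Rightarrow> 'm::finite \<Rightarrow> 'm::finite \<Rightarrow> real" where
  "christoffel g \<kappa> p k i j = (1/2) * (\<Sum>l\<in>UNIV. matrix_inv (g \<kappa> p) $ k $ l *
     (let d = (\<lambda>a b e. pd (ran \<kappa>) a (\<lambda>x. loc \<kappa> (g \<kappa>) x $ b $ e) (ch \<kappa> p))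
      in d i j l + d j i l - d l i j))"

text \<open>
  The connection induced by the Levi-Civita connection of \<open>g\<close> and by the connection of \<open>W\<close>; the
  new covariant index \<open>l\<close> is put in front.
\<close>

fun covd ::
  "('a,'m::finite) chart set \<Rightarrow> ('a,'m::finite) metric \<Rightarrow> ('w,'a,'m::finite,'k::{real_normed_field,euclidean_space},'n::finite) vbundle
   \<Rightarrow> ('a,'m::finite,'k,'n::finite) tsec \<Rightarrow> ('a,'m::finite,'k,'n::finite) tsec" where
  "covd K g W u p \<kappa> I [] = 0"
| "covd K g W u p \<kappa> I (l # L) =
     (if \<kappa> \<in> K \<and> p \<in> dom \<kappa> then
        pd (ran \<kappa>) l (loc \<kappa> (\<lambda>q. u q \<kappa> I L)) (ch \<kappa> p)
        + Chr W \<kappa> p l (u p \<kappa> I L)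
        + (\<Sum>a<length I. \<Sum>k\<in>UNIV. christoffel g \<kappa> p (I ! a) l k *\<^sub>R u p \<kappa> (I[a := k]) L)
        - (\<Sum>b<length L. \<Sum>k\<in>UNIV. christoffel g \<kappa> p k l (L ! b) *\<^sub>R u p \<kappa> I (L[b := k]))
      else 0)"

definition smooth_section ::
  "('a,'m::finite) chart set \<Rightarrow> ('w,'a,'m::finite,'k::{real_normed_field,euclidean_space},'n::finite) vbundle \<Rightarrow> nat \<Rightarrow> nat
   \<Rightarrow> ('a,'m::finite,'k,'n::finite) tsec \<Rightarrow> bool" where
  "smooth_section K W \<sigma> \<tau> u \<longleftrightarrow>
     (\<forall>p. u p \<in> tensor_fiber K W \<sigma> \<tau> p) \<and>
     (\<forall>\<kappa>\<in>K. \<forall>I L. smooth_on (ran \<kappa>) (loc \<kappa> (\<lambda>p. u p \<kappa> I L)))"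

text \<open>
  \<open>Chr W\<close> is the family of Christoffel symbols of a connection on \<open>W\<close>, i.e. the local covariant
  derivatives of every smooth section of \<open>W\<close> (a tensor section with \<open>\<sigma> = \<tau> = 0\<close>; in this case \<open>covd\<close>
  does not involve \<open>g\<close>) fit together to a \<open>W\<close>-valued one-form.
\<close>

definition connection ::
  "('a,'m::finite) chart set \<Rightarrow> ('a,'m::finite) metric \<Rightarrow> ('w,'a,'m::finite,'k::{real_normed_field,euclidean_space},'n::finite) vbundle \<Rightarrow> bool" where
  "connection K g W \<longleftrightarrow>
     (\<forall>\<kappa>\<in>K. \<forall>l. (\<forall>p\<in>dom \<kappa>. linear_on (MFiber W) (Chr W \<kappa> p l)) \<and>
        (\<forall>a\<in>MFiber W. smooth_on (ran \<kappa>) (loc \<kappa> (\<lambda>p. Chr W \<kappa> p l a)))) \<and>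
     (\<forall>u. smooth_section K W 0 0 u \<longrightarrow> (\<forall>p. covd K g W u p \<in> tensor_fiber K W 0 1 p))"

definition metric_connection ::
  "('a,'m::finite) chart set \<Rightarrow> ('a,'m::finite) metric \<Rightarrow> ('w,'a,'m::finite,'k::{real_normed_field,euclidean_space},'n::finite) vbundle \<Rightarrow> bool" where
  "metric_connection K g W \<longleftrightarrow>
     connection K g W \<and>
     (\<forall>\<kappa>\<in>K. \<forall>u v. smooth_on (ran \<kappa>) u \<and> smooth_on (ran \<kappa>) v \<and> range u \<subseteq> MFiber W \<and> range v \<subseteq> MFiber W \<longrightarrow>
        (\<forall>p\<in>dom \<kappa>. \<forall>l. let x = ch \<kappa> p; D = (\<lambda>f. pd (ran \<kappa>) l f x + Chr W \<kappa> p l (f x)) in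
           pd (ran \<kappa>) l (\<lambda>y. hloc W \<kappa> (chinv \<kappa> y) (u y) (v y)) x
           = hloc W \<kappa> p (D u) (v x) + hloc W \<kappa> p (u x) (D v)))"

text \<open>
  Bounds for operator-valued and form-valued functions are expressed by evaluating at vectors of
  the model fiber.
\<close>

definition fully_uniformly_regular ::
  "('a::topological_space,'m::{finite,linorder}) sing_mf
   \<Rightarrow> ('w,'a,'m,'k::{real_normed_field,euclidean_space},'n::finite) vbundle \<Rightarrow> bool" where
  "fully_uniformly_regular M W \<longleftrightarrow>
     metric_bundle (Atlas M) W \<and>
     metric_connection (Atlas M) (Metric M) W \<and>
     (\<exists>c\<ge>1. \<forall>\<kappa>\<in>Atlas M. \<forall>p\<in>dom \<kappa>. \<forall>a\<in>MFiber W.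
        (norm a)\<^sup>2 / c \<le> re_part (hloc W \<kappa> p a a) \<and> re_part (hloc W \<kappa> p a a) \<le> c * (norm a)\<^sup>2) \<and>
     (\<forall>k. \<exists>c. \<forall>\<kappa>\<in>Atlas M. \<forall>\<kappa>'\<in>Atlas M. \<forall>a\<in>MFiber W.
        derivs_le k (c * norm a) (overlap \<kappa> \<kappa>') (loc \<kappa> (\<lambda>p. btrans W \<kappa> \<kappa>' p a))) \<and>
     (\<forall>k. \<exists>c. \<forall>\<kappa>\<in>Atlas M. \<forall>a\<in>MFiber W. \<forall>b\<in>MFiber W.
        derivs_le k (c * norm a * norm b) (ran \<kappa>) (loc \<kappa> (\<lambda>p. hloc W \<kappa> p a b))) \<and>
     (\<forall>k. \<exists>c. \<forall>\<kappa>\<in>Atlas M. \<forall>l. \<forall>a\<in>MFiber W.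
        derivs_le k (c * norm a) (ran \<kappa>) (loc \<kappa> (\<lambda>p. Chr W \<kappa> p l a)))"


subsection \<open>Normed spaces of functions, closures and real interpolation\<close>

text \<open>A normed space inside an ambient group is a carrier together with a norm, finite on the carrier.\<close>

type_synonym 'v nspace = "'v set \<times> ('v \<Rightarrow> ennreal)"

definition closure_in :: "'v::ab_group_add set \<Rightarrow> 'v nspace \<Rightarrow> 'v nspace" where
  "closure_in Y X = ({u \<in> fst X. \<forall>\<epsilon>>0. \<exists>v \<in> Y \<inter> fst X. snd X (u - v) < \<epsilon>}, snd X)"

definition K_functional :: "'v::ab_group_add nspace \<Rightarrow> 'v nspace \<Rightarrow> real \<Rightarrow> 'v \<Rightarrow> ennreal" where
  "K_functional X0 X1 t u =
     (INF (a, b) \<in> {(a, b). a \<in> fst X0 \<and> b \<in> fst X1 \<and> u = a + b}. snd X0 a + ennreal t * snd X1 b)"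

definition interpolation_norm :: "'v::ab_group_add nspace \<Rightarrow> 'v nspace \<Rightarrow> real \<Rightarrow> 'v \<Rightarrow> ennreal" where
  "interpolation_norm X0 X1 \<theta> u =
     (SUP t\<in>{0<..}. ennreal (t powr (- \<theta>)) * K_functional X0 X1 t u)"

text \<open>The real interpolation space with parameters \<open>\<theta>, \<infinity>\<close> (the infimum over the empty set is infinite).\<close>

definition real_interpolation_infty :: "'v::ab_group_add nspace \<Rightarrow> 'v nspace \<Rightarrow> real \<Rightarrow> 'v nspace" where
  "real_interpolation_infty X0 X1 \<theta> =
     ({u. interpolation_norm X0 X1 \<theta> u < \<infinity>}, interpolation_norm X0 X1 \<theta>)"


subsection \<open>Weighted anisotropic spaces\<close>

text \<open>
  Time-dependent sections on \<open>J\<close> are functions on the whole line which vanish outside \<open>J\<close>.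
\<close>

type_synonym ('a,'m,'k,'n) evol = "real \<Rightarrow> ('a,'m,'k,'n) tsec"

definition tder ::
  "real set \<Rightarrow> ('a,'m::finite,'k::{real_normed_field,euclidean_space},'n::finite) evol \<Rightarrow> ('a,'m::finite,'k,'n::finite) evol" where
  "tder J u t p \<kappa> I L =
     (if t \<in> J then vector_derivative (\<lambda>s. u s p \<kappa> I L) (at t within J) else 0)"

definition nabla_dt ::
  "('a,'m::finite) sing_mf \<Rightarrow> ('w,'a,'m::finite,'k::{real_normed_field,euclidean_space},'n::finite) vbundle \<Rightarrow> real set
   \<Rightarrow> nat \<Rightarrow> nat \<Rightarrow> ('a,'m::finite,'k,'n::finite) evol \<Rightarrow> ('a,'m::finite,'k,'n::finite) evol" where
  "nabla_dt M W J i j u t = (covd (Atlas M) (Metric M) W ^^ i) ((tder J ^^ j) u t)"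

text \<open>
  Joint continuity on \<open>J\<close> times the manifold is the same as continuity in time with values in the
  continuous sections with the topology of locally uniform convergence.
\<close>

definition continuous_evol ::
  "('a::topological_space,'m::finite) chart set \<Rightarrow> real set
   \<Rightarrow> ('a,'m::finite,'k::{real_normed_field,euclidean_space},'n::finite) evol \<Rightarrow> bool" where
  "continuous_evol K J w \<longleftrightarrow>
     (\<forall>\<kappa>\<in>K. \<forall>I L. continuous_on (J \<times> dom \<kappa>) (\<lambda>(t, p). w t p \<kappa> I L))"

definition time_differentiable ::
  "real set \<Rightarrow> ('a,'m::finite,'k::{real_normed_field,euclidean_space},'n::finite) evol \<Rightarrow> bool" where
  "time_differentiable J w \<longleftrightarrow>
     (\<forall>t\<in>J. \<forall>p \<kappa> I L. (\<lambda>s. w s p \<kappa> I L) differentiable (at t within J))"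

definition space_differentiable ::
  "('a,'m::finite) chart set \<Rightarrow> real set \<Rightarrow> ('a,'m::finite,'k::{real_normed_field,euclidean_space},'n::finite) evol \<Rightarrow> bool" where
  "space_differentiable K J w \<longleftrightarrow>
     (\<forall>t\<in>J. \<forall>\<kappa>\<in>K. \<forall>x\<in>ran \<kappa>. \<forall>l I L. pdiff (ran \<kappa>) l (loc \<kappa> (\<lambda>p. w t p \<kappa> I L)) x)"

definition BC_norm ::
  "('a,'m::finite) sing_mf \<Rightarrow> ('w,'a,'m::finite,'k::{real_normed_field,euclidean_space},'n::finite) vbundle \<Rightarrow> nat \<Rightarrow> nat \<Rightarrow> nat
   \<Rightarrow> real \<Rightarrow> real \<Rightarrow> nat \<Rightarrow> real set \<Rightarrow> ('a,'m::finite,'k,'n::finite) evol \<Rightarrow> ennreal" where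
  "BC_norm M W \<sigma> \<tau> r lam mu k J u =
     (SUP (i, j) \<in> {(i, j). i + j * r \<le> k * r}. SUP t\<in>J. SUP p. SUP \<kappa>\<in>{\<kappa>\<in>Atlas M. p \<in> dom \<kappa>}.
        ennreal (Weight M p powr (lam + real i + real j * mu + real \<tau> - real \<sigma>)
          * tnorm (Metric M) W \<sigma> (\<tau> + i) \<kappa> p (nabla_dt M W J i j u t p)))"

definition BC_space ::
  "('a::topological_space,'m::finite) sing_mf \<Rightarrow> ('w,'a,'m::finite,'k::{real_normed_field,euclidean_space},'n::finite) vbundle
   \<Rightarrow> nat \<Rightarrow> nat \<Rightarrow> nat \<Rightarrow> real \<Rightarrow> real \<Rightarrow> nat \<Rightarrow> real set \<Rightarrow> ('a,'m::finite,'k,'n::finite) evol nspace" where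
  "BC_space M W \<sigma> \<tau> r lam mu k J =
     ({u. (\<forall>t. t \<notin> J \<longrightarrow> u t = 0) \<and>
          (\<forall>t\<in>J. \<forall>p. u t p \<in> tensor_fiber (Atlas M) W \<sigma> \<tau> p) \<and>
          (\<forall>i j. i + j * r \<le> k * r \<longrightarrow> continuous_evol (Atlas M) J (nabla_dt M W J i j u)) \<and>
          (\<forall>j. (j + 1) * r \<le> k * r \<longrightarrow> time_differentiable J (nabla_dt M W J 0 j u)) \<and>
          (\<forall>i j. (i + 1) + j * r \<le> k * r \<longrightarrow> space_differentiable (Atlas M) J (nabla_dt M W J i j u)) \<and>
          BC_norm M W \<sigma> \<tau> r lam mu k J u < \<infinity>},
      BC_norm M W \<sigma> \<tau> r lam mu k J)"

definition BC_infty ::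
  "('a::topological_space,'m::finite) sing_mf \<Rightarrow> ('w,'a,'m::finite,'k::{real_normed_field,euclidean_space},'n::finite) vbundle
   \<Rightarrow> nat \<Rightarrow> nat \<Rightarrow> nat \<Rightarrow> real \<Rightarrow> real \<Rightarrow> real set \<Rightarrow> ('a,'m::finite,'k,'n::finite) evol set" where
  "BC_infty M W \<sigma> \<tau> r lam mu J = (\<Inter>k. fst (BC_space M W \<sigma> \<tau> r lam mu k J))"

definition bc_space ::
  "('a::topological_space,'m::finite) sing_mf \<Rightarrow> ('w,'a,'m::finite,'k::{real_normed_field,euclidean_space},'n::finite) vbundle
   \<Rightarrow> nat \<Rightarrow> nat \<Rightarrow> nat \<Rightarrow> real \<Rightarrow> real \<Rightarrow> nat \<Rightarrow> real set \<Rightarrow> ('a,'m::finite,'k,'n::finite) evol nspace" where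
  "bc_space M W \<sigma> \<tau> r lam mu k J =
     closure_in (BC_infty M W \<sigma> \<tau> r lam mu J) (BC_space M W \<sigma> \<tau> r lam mu k J)"

text \<open>For \<open>s > 0\<close> the number \<open>k\<close> below is the one with \<open>k * r < s \<le> (k + 1) * r\<close>.\<close>

definition B_infty_space ::
  "('a::topological_space,'m::finite) sing_mf \<Rightarrow> ('w,'a,'m::finite,'k::{real_normed_field,euclidean_space},'n::finite) vbundle
   \<Rightarrow> nat \<Rightarrow> nat \<Rightarrow> nat \<Rightarrow> real \<Rightarrow> real \<Rightarrow> real \<Rightarrow> real set \<Rightarrow> ('a,'m::finite,'k,'n::finite) evol nspace" where
  "B_infty_space M W \<sigma> \<tau> r lam mu s J =
     (let k = nat \<lceil>s / real r\<rceil> - 1; X = (\<lambda>l. bc_space M W \<sigma> \<tau> r lam mu l J) in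
      if s < real (k + 1) * real r
      then real_interpolation_infty (X k) (X (k + 1)) ((s - real k * real r) / real r)
      else real_interpolation_infty (X k) (X (k + 2)) (1 / 2))"

datatype space_kind = BC_kind | bc_kind | B_infty_kind | b_infty_kind

text \<open>For the kinds \<open>BC_kind\<close> and \<open>bc_kind\<close> the parameter \<open>s\<close> has to be an integer multiple of \<open>r\<close>.\<close>

fun aniso_space ::
  "space_kind \<Rightarrow> ('a::topological_space,'m::finite) sing_mf
   \<Rightarrow> ('w,'a,'m::finite,'k::{real_normed_field,euclidean_space},'n::finite) vbundle
   \<Rightarrow> nat \<Rightarrow> nat \<Rightarrow> nat \<Rightarrow> real \<Rightarrow> real \<Rightarrow> real \<Rightarrow> real set \<Rightarrow> ('a,'m::finite,'k,'n::finite) evol nspace" where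
  "aniso_space BC_kind M W \<sigma> \<tau> r lam mu s J = BC_space M W \<sigma> \<tau> r lam mu (nat \<lfloor>s / real r\<rfloor>) J"
| "aniso_space bc_kind M W \<sigma> \<tau> r lam mu s J = bc_space M W \<sigma> \<tau> r lam mu (nat \<lfloor>s / real r\<rfloor>) J"
| "aniso_space B_infty_kind M W \<sigma> \<tau> r lam mu s J = B_infty_space M W \<sigma> \<tau> r lam mu s J"
| "aniso_space b_infty_kind M W \<sigma> \<tau> r lam mu s J =
     closure_in (BC_infty M W \<sigma> \<tau> r lam mu J) (B_infty_space M W \<sigma> \<tau> r lam mu s J)"

definition evol_scale ::
  "'k::{real_normed_field,euclidean_space} \<Rightarrow> ('a,'m::finite,'k,'n::finite) evol \<Rightarrow> ('a,'m::finite,'k,'n::finite) evol" where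
  "evol_scale z u = (\<lambda>t p \<kappa> I L. z *s u t p \<kappa> I L)"

text \<open>The bounded linear operators between two spaces of time-dependent sections.\<close>

definition bounded_operators ::
  "('a,'m::finite,'k::{real_normed_field,euclidean_space},'n::finite) evol nspace \<Rightarrow> ('a,'m::finite,'k,'n::finite) evol nspace
   \<Rightarrow> (('a,'m::finite,'k,'n::finite) evol \<Rightarrow> ('a,'m::finite,'k,'n::finite) evol) set" where
  "bounded_operators X Y = {T.
     (\<forall>u\<in>fst X. T u \<in> fst Y) \<and>
     (\<forall>u\<in>fst X. \<forall>v\<in>fst X. T (u + v) = T u + T v) \<and>
     (\<forall>z. \<forall>u\<in>fst X. T (evol_scale z u) = evol_scale z (T u)) \<and>
     (\<exists>c::real. \<forall>u\<in>fst X. snd Y (T u) \<le> ennreal c * snd X u)}"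


subsection \<open>Restriction and extension in time\<close>

definition extension_kernel :: "(real \<Rightarrow> real) \<Rightarrow> bool" where
  "extension_kernel h \<longleftrightarrow>
     (\<forall>k. \<forall>t>0. ((deriv ^^ k) h) differentiable (at t)) \<and>
     (\<forall>s::real. set_integrable lborel {0<..} (\<lambda>t. t powr s * \<bar>h t\<bar>)) \<and>
     (\<forall>k::int. (-1) powi k * (LINT t:{0<..}|lborel. t powi k * h t) = 1) \<and>
     (\<forall>t>0. h (1 / t) = - t * h t)"

definition r_plus :: "('a,'m::finite,'k::{real_normed_field,euclidean_space},'n::finite) evol \<Rightarrow> ('a,'m::finite,'k,'n::finite) evol" where
  "r_plus u = (\<lambda>t. if 0 \<le> t then u t else 0)"

definition e_plus ::
  "(real \<Rightarrow> real) \<Rightarrow> ('a,'m::finite,'k::{real_normed_field,euclidean_space},'n::finite) evol \<Rightarrow> ('a,'m::finite,'k,'n::finite) evol" where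
  "e_plus h v = (\<lambda>t. if 0 \<le> t then v t
     else (\<lambda>p \<kappa> I L. LINT s:{0<..}|lborel. h s *\<^sub>R v (- s * t) p \<kappa> I L))"

end

theory Submission
  imports Defs
begin

text \<open>
  Since \<open>t \<mapsto> v (- s * t)\<close> has derivative \<open>- s * v' (- s * t)\<close>, the extension with kernel \<open>h\<close> is
  carried by \<open>j\<close> time derivatives into the extension with kernel \<open>(- s)^j * h s\<close> of the \<open>j\<close>th time
  derivative, and covariant derivatives simply pass under the integral.  All these kernels have
  integral 1, so that the two pieces fit together at \<open>t = 0\<close>, and they are absolutely integrable, so
  that the extension is bounded in the spaces of integer order, the fiber norms being Hilbert
  norms.  The remaining spaces arise by closure and by real interpolation, both of which preserve
  bounded linear operators.

  Differentiation under the integral in space needs a bound for the partial derivatives that is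
  uniform in time and locally uniform in space.  It comes from the bound for the covariant
  derivative: the two differ by terms of order zero, and on a coordinate patch the fiber norm
  dominates the components.
\<close>

subsection \<open>Integrals depending on a parameter\<close>

text \<open>Two conventions shape the argument. The integral of a non-integrable function is 0, so
  \<open>e_plus\<close> is not additive on arbitrary functions; additivity has to be secured on a
  common domain of functions with integrable reflections, since elements of interpolation spaces are
  known only as sums. And sections carry default zeros: for charts not defined at a point, for index
  lists of wrong length, and for times outside the time interval. The last kind makes
  \<open>r_plus (e_plus h v) = v\<close> an equality on the whole line.

  Only a section itself has to obey the tensorial transformation law. For its derivatives it is
  enough that the entries lie in the model fiber and that the default entries are 0, which
  differentiation in a single chart preserves.

  The bounds on a coordinate patch may depend on the chart, because they only justify interchanging
  limits and integrals. On the spaces of integer order the operator norm is controlled by the fiber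
  norms alone, pointwise in space: the constant is the sum over \<open>j \<le> k\<close> of the
  integrals of \<open>\<bar>(- s) ^ j * h s\<bar>\<close>.\<close>

lemma integrable_scaleR_bounded:
  fixes f :: "'x \<Rightarrow> 'b::{banach,second_countable_topology}" and k :: "'x \<Rightarrow> real"
  assumes "integrable M k" "f \<in> borel_measurable M" "\<And>s. s \<in> space M \<Longrightarrow> norm (f s) \<le> B"
  shows "integrable M (\<lambda>s. k s *\<^sub>R f s)"
proof (rule Bochner_Integration.integrable_bound)
  show "integrable M (\<lambda>s. \<bar>k s\<bar> * B)"
    using assms(1) by auto
  show "(\<lambda>s. k s *\<^sub>R f s) \<in> borel_measurable M"
    using assms by (auto intro: borel_measurable_scaleR)
  show "AE s in M. norm (k s *\<^sub>R f s) \<le> norm (\<bar>k s\<bar> * B)"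
    by (rule AE_I2) (auto intro!: mult_left_mono order_trans[OF assms(3)] simp: abs_mult)
qed

text \<open>The parameters range over a metric space, so sequential continuity suffices, and
  dominated convergence applies with the majorant \<open>\<bar>k s\<bar> * B\<close>.\<close>

lemma continuous_on_integral_scaleR:
  fixes f :: "'y::metric_space \<Rightarrow> 'x \<Rightarrow> 'b::{banach,second_countable_topology}"
    and k :: "'x \<Rightarrow> real"
  assumes k: "integrable M k"
    and meas: "\<And>y. y \<in> Y \<Longrightarrow> f y \<in> borel_measurable M"
    and bound: "\<And>y s. y \<in> Y \<Longrightarrow> s \<in> space M \<Longrightarrow> norm (f y s) \<le> B"
    and cont: "\<And>s. s \<in> space M \<Longrightarrow> continuous_on Y (\<lambda>y. f y s)"
  shows "continuous_on Y (\<lambda>y. \<integral>s. k s *\<^sub>R f y s \<partial>M)"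
proof (rule continuous_on_sequentiallyI)
  fix u a assume u: "\<forall>n. u n \<in> Y" "a \<in> Y" "u \<longlonglongrightarrow> a"
  show "(\<lambda>n. \<integral>s. k s *\<^sub>R f (u n) s \<partial>M) \<longlonglongrightarrow> (\<integral>s. k s *\<^sub>R f a s \<partial>M)"
  proof (rule integral_dominated_convergence)
    show "integrable M (\<lambda>s. \<bar>k s\<bar> * B)"
      using k by auto
    show "(\<lambda>s. k s *\<^sub>R f a s) \<in> borel_measurable M"
      using k meas u by (auto intro: borel_measurable_scaleR)
    show "(\<lambda>s. k s *\<^sub>R f (u n) s) \<in> borel_measurable M" for n
      using k meas u by (auto intro: borel_measurable_scaleR)
    show "AE s in M. norm (k s *\<^sub>R f (u n) s) \<le> \<bar>k s\<bar> * B" for n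
      by (rule AE_I2) (use bound u in \<open>auto intro!: mult_left_mono\<close>)
    show "AE s in M. (\<lambda>n. k s *\<^sub>R f (u n) s) \<longlonglongrightarrow> k s *\<^sub>R f a s"
    proof (rule AE_I2)
      fix s assume "s \<in> space M"
      then have "(\<lambda>n. f (u n) s) \<longlonglongrightarrow> f a s"
        using cont[unfolded continuous_on_sequentially] u by (auto simp: o_def)
      then show "(\<lambda>n. k s *\<^sub>R f (u n) s) \<longlonglongrightarrow> k s *\<^sub>R f a s"
        by (intro tendsto_intros)
    qed
  qed
qed

text \<open>Derivatives as limits of difference quotients: in this form dominated convergence along
  sequences, membership in closed subspaces and the gluing of one-sided derivatives become
  statements about limits.\<close>

lemma has_vector_derivative_within_iff:
  fixes f :: "real \<Rightarrow> 'b::real_normed_vector"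
  shows "(f has_vector_derivative D) (at x within S) \<longleftrightarrow>
    ((\<lambda>y. inverse (y - x) *\<^sub>R (f y - f x)) \<longlongrightarrow> D) (at x within S)"
proof -
  have "(f has_vector_derivative D) (at x within S) \<longleftrightarrow>
     ((\<lambda>y. norm ((f y - f x - (y - x) *\<^sub>R D)) / norm (y - x)) \<longlongrightarrow> 0) (at x within S)"
    unfolding has_vector_derivative_def has_derivative_within
    by (subst (1) tendsto_norm_zero_iff[symmetric]) (simp add: bounded_linear_scaleR_left divide_inverse mult.commute diff_diff_eq)
  also have "\<dots> \<longleftrightarrow> ((\<lambda>y. norm (inverse (y - x) *\<^sub>R (f y - f x) - D)) \<longlongrightarrow> 0) (at x within S)"
  proof (rule filterlim_cong[OF refl refl])
    show "\<forall>\<^sub>F y in at x within S. norm (f y - f x - (y - x) *\<^sub>R D) / norm (y - x)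
        = norm (inverse (y - x) *\<^sub>R (f y - f x) - D)"
      unfolding eventually_at_filter
    proof (intro always_eventually allI impI)
      fix y assume "y \<noteq> x"
      then have "inverse (y - x) *\<^sub>R (f y - f x) - D
          = inverse (y - x) *\<^sub>R (f y - f x - (y - x) *\<^sub>R D)"
        by (simp add: scaleR_diff_right)
      then show "norm (f y - f x - (y - x) *\<^sub>R D) / norm (y - x)
          = norm (inverse (y - x) *\<^sub>R (f y - f x) - D)"
        by (simp add: divide_inverse mult.commute)
    qed
  qed
  also have "\<dots> \<longleftrightarrow> ((\<lambda>y. inverse (y - x) *\<^sub>R (f y - f x)) \<longlongrightarrow> D) (at x within S)"
    by (simp add: tendsto_norm_zero_iff LIM_zero_iff)
  finally show ?thesis .
qed

lemma vector_differentiable_bound: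
  fixes f :: "real \<Rightarrow> 'b::real_normed_vector"
  assumes "convex S" "\<And>x. x \<in> S \<Longrightarrow> (f has_vector_derivative f' x) (at x within S)"
    "\<And>x. x \<in> S \<Longrightarrow> norm (f' x) \<le> B" "x \<in> S" "y \<in> S"
  shows "norm (f x - f y) \<le> B * \<bar>x - y\<bar>"
  using differentiable_bound[of S f "\<lambda>x h. h *\<^sub>R f' x" B x y] assms
  by (simp add: has_vector_derivative_def onorm_scaleR_left[OF bounded_linear_ident] onorm_id)

text \<open>On a convex set the mean value inequality bounds every difference quotient by
  \<open>\<beta>\<close>, which is the majorant for dominated convergence. Derivatives within
  \<open>S\<close> cover the end point 0 of a time half-line and the boundary of the
  manifold.\<close>

lemma has_vector_derivative_integral:
  fixes f :: "real \<Rightarrow> 'x \<Rightarrow> 'b::{banach,second_countable_topology}"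
  assumes S: "convex S" "x \<in> S"
    and int: "\<And>y. y \<in> S \<Longrightarrow> integrable M (f y)"
    and der: "\<And>y s. y \<in> S \<Longrightarrow> s \<in> space M \<Longrightarrow> ((\<lambda>y. f y s) has_vector_derivative f' y s) (at y within S)"
    and bound: "\<And>y s. y \<in> S \<Longrightarrow> s \<in> space M \<Longrightarrow> norm (f' y s) \<le> \<beta> s"
    and \<beta>: "integrable M \<beta>"
  shows "((\<lambda>y. integral\<^sup>L M (f y)) has_vector_derivative integral\<^sup>L M (f' x)) (at x within S)"
  unfolding has_vector_derivative_within_iff tendsto_at_iff_sequentially o_def
proof (intro allI impI)
  fix X assume X: "\<forall>i. X i \<in> S - {x}" "X \<longlonglongrightarrow> x"
  let ?q = "\<lambda>i s. inverse (X i - x) *\<^sub>R (f (X i) s - f x s)"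
  have lim: "(\<lambda>i. ?q i s) \<longlonglongrightarrow> f' x s" if "s \<in> space M" for s
    using der[OF S(2) that] X
    unfolding has_vector_derivative_within_iff tendsto_at_iff_sequentially o_def by blast
  have "(\<lambda>i. integral\<^sup>L M (?q i)) \<longlonglongrightarrow> integral\<^sup>L M (f' x)"
  proof (rule integral_dominated_convergence[OF _ _ \<beta>])
    show meas: "?q i \<in> borel_measurable M" for i
      using int X S by (intro borel_measurable_scaleR borel_measurable_diff) auto
    \<comment> \<open>Measurability of the derivative in the integration variable is not assumed: it
      is a pointwise limit of measurable difference quotients.\<close>
    show "f' x \<in> borel_measurable M"
      by (rule borel_measurable_LIMSEQ_metric[OF meas lim])
    show "AE s in M. (\<lambda>i. ?q i s) \<longlonglongrightarrow> f' x s"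
      using lim by auto
    show "AE s in M. norm (?q i s) \<le> \<beta> s" for i
    proof (rule AE_I2)
      fix s assume s: "s \<in> space M"
      have "norm (f (X i) s - f x s) \<le> \<beta> s * \<bar>X i - x\<bar>"
        by (rule vector_differentiable_bound[OF S(1) der]) (use s bound X S in auto)
      moreover have "\<bar>X i - x\<bar> > 0"
        using X by auto
      ultimately show "norm (?q i s) \<le> \<beta> s"
        unfolding norm_scaleR abs_inverse by (simp add: field_simps)
    qed
  qed
  moreover have "integral\<^sup>L M (?q i) = inverse (X i - x) *\<^sub>R (integral\<^sup>L M (f (X i)) - integral\<^sup>L M (f x))" for i
    using int X S by simp
  ultimately show "(\<lambda>i. inverse (X i - x) *\<^sub>R (integral\<^sup>L M (f (X i)) - integral\<^sup>L M (f x)))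
      \<longlonglongrightarrow> integral\<^sup>L M (f' x)"
    by (simp only:)
qed


subsection \<open>Extension of functions on the half-line\<close>

text \<open>Restricting the measure instead of the integrand turns the set integrals into plain
  ones, to which the lemmas for arbitrary measures apply; pointwise bounds are then required for
  \<open>s > 0\<close> only.\<close>

abbreviation half_line :: "real measure" where
  "half_line \<equiv> restrict_space lborel {0<..}"

text \<open>One component of \<open>e_plus\<close>, so that the calculus in time is done for
  functions of one real variable. The kernel is a parameter because differentiation changes
  it.\<close>

definition extend :: "(real \<Rightarrow> real) \<Rightarrow> (real \<Rightarrow> 'b::{banach,second_countable_topology}) \<Rightarrow> real \<Rightarrow> 'b" where
  "extend k f t = (if 0 \<le> t then f t else \<integral>s. k s *\<^sub>R f (- s * t) \<partial>half_line)"

lemma e_plus_extend: "e_plus k v t p \<kappa> I L = extend k (\<lambda>t. v t p \<kappa> I L) t"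
  by (simp add: e_plus_def extend_def set_lebesgue_integral_def integral_restrict_space)

lemma space_half_line [simp]: "space half_line = {0<..}"
  by (simp add: space_restrict_space)

lemma measurable_half_line:
  fixes f :: "real \<Rightarrow> 'b::real_normed_vector"
  assumes "continuous_on {0<..} f" shows "f \<in> borel_measurable half_line"
  using borel_measurable_continuous_on_restrict[OF assms]
  by (simp cong: measurable_cong_sets sets_restrict_space_cong)

lemma measurable_reflected:
  fixes f :: "real \<Rightarrow> 'b::real_normed_vector"
  assumes "continuous_on {0..} f" "t \<le> 0"
  shows "(\<lambda>s. f (- s * t)) \<in> borel_measurable half_line"
  by (rule measurable_half_line, rule continuous_on_compose2[OF assms(1)])
    (use assms in \<open>auto intro!: continuous_intros simp: mult_nonneg_nonpos\<close>)

lemma integrable_reflected: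
  fixes f :: "real \<Rightarrow> 'b::{banach,second_countable_topology}"
  assumes "integrable half_line k" "continuous_on {0..} f" "\<And>t. 0 \<le> t \<Longrightarrow> norm (f t) \<le> B" "t \<le> 0"
  shows "integrable half_line (\<lambda>s. k s *\<^sub>R f (- s * t))"
  by (rule integrable_scaleR_bounded[OF assms(1) measurable_reflected, where B = B])
    (use assms in \<open>auto simp: mult_nonneg_nonpos\<close>)

lemma continuous_on_extend:
  fixes f :: "real \<Rightarrow> 'a::metric_space \<Rightarrow> 'b::{banach,second_countable_topology}"
  assumes k: "integrable half_line k" "integral\<^sup>L half_line k = 1"
    and f: "continuous_on ({0..} \<times> U) (\<lambda>(t, p). f t p)"
    and bound: "\<And>t p. 0 \<le> t \<Longrightarrow> p \<in> U \<Longrightarrow> norm (f t p) \<le> B"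
  shows "continuous_on (UNIV \<times> U) (\<lambda>(t, p). extend k (\<lambda>t. f t p) t)"
proof -
  have f': "continuous_on S (\<lambda>x. f (a x) (b x))"
    if "continuous_on S a" "continuous_on S b" "\<And>x. x \<in> S \<Longrightarrow> 0 \<le> a x \<and> b x \<in> U" for S a b
    using continuous_on_compose2[OF f, of S "\<lambda>x. (a x, b x)"] that by (auto intro: continuous_intros)
  \<comment> \<open>a single formula for both half-lines, so that no gluing at 0 is needed\<close>
  let ?c = "\<lambda>x. \<integral>s. k s *\<^sub>R f (s * max (- fst x) 0) (snd x) \<partial>half_line"
  have c0: "?c (t, p) = f 0 p" if "0 \<le> t" for t p
    using that k integral_scaleR_left[of "f 0 p" half_line k] by (simp add: max_def)
  have eq: "extend k (\<lambda>t. f t p) t = f (max t 0) p + ?c (t, p) - f 0 p" for t p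
    using c0[of t p] by (cases "0 \<le> t") (auto simp: extend_def max_def)
  have c: "continuous_on (UNIV \<times> U) ?c"
    using k(1)
  proof (rule continuous_on_integral_scaleR)
    fix y :: "real \<times> 'a" assume y: "y \<in> UNIV \<times> U"
    show "(\<lambda>s. f (s * max (- fst y) 0) (snd y)) \<in> borel_measurable half_line"
      by (rule measurable_half_line, rule f') (use y in \<open>auto intro!: continuous_intros\<close>)
  next
    fix y :: "real \<times> 'a" and s assume "y \<in> UNIV \<times> U" "s \<in> space half_line"
    then show "norm (f (s * max (- fst y) 0) (snd y)) \<le> B"
      by (intro bound) auto
  next
    fix s assume "s \<in> space half_line"
    then show "continuous_on (UNIV \<times> U) (\<lambda>y::real \<times> 'a. f (s * max (- fst y) 0) (snd y))"
      by (intro f') (auto intro!: continuous_intros)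
  qed
  have "continuous_on (UNIV \<times> U) (\<lambda>x::real \<times> 'a. f (max (fst x) 0) (snd x) + ?c x - f 0 (snd x))"
    by (intro continuous_on_add continuous_on_diff f' c) (auto intro!: continuous_intros)
  then show ?thesis
    by (simp add: eq case_prod_unfold)
qed

text \<open>Each of the two normalizations serves the point 0: that of \<open>k\<close> makes the
  values of both branches agree there, that of \<open>- s * k s\<close> makes the one-sided
  derivatives agree.\<close>

lemma has_vector_derivative_extend:
  fixes f :: "real \<Rightarrow> 'b::{banach,second_countable_topology}"
  assumes k: "integrable half_line k" "integral\<^sup>L half_line k = 1"
    and k': "integrable half_line (\<lambda>s. - s * k s)" "integral\<^sup>L half_line (\<lambda>s. - s * k s) = 1"
    and der: "\<And>t. 0 \<le> t \<Longrightarrow> (f has_vector_derivative f' t) (at t within {0..})"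
    and f: "\<And>t. 0 \<le> t \<Longrightarrow> norm (f t) \<le> B" and f': "\<And>t. 0 \<le> t \<Longrightarrow> norm (f' t) \<le> B'"
  shows "(extend k f has_vector_derivative extend (\<lambda>s. - s * k s) f' t) (at t)"
proof -
  have cf: "continuous_on {0..} f"
    unfolding continuous_on_eq_continuous_within
    using der by (auto intro: has_vector_derivative_continuous)
  let ?G = "\<lambda>t. \<integral>s. k s *\<^sub>R f (- s * t) \<partial>half_line"
  let ?G' = "\<lambda>t. \<integral>s. (- s * k s) *\<^sub>R f' (- s * t) \<partial>half_line"
  \<comment> \<open>The closed half-line is used so that the left derivative at 0 is included; the
    reflected argument \<open>- s * t\<close> then runs in \<open>{0..}\<close>, where
    \<open>f\<close> is differentiable.\<close>
  have G: "(?G has_vector_derivative ?G' t) (at t within {..0})" if "t \<le> 0" for t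
  proof (rule has_vector_derivative_integral)
    show "integrable half_line (\<lambda>s. k s *\<^sub>R f (- s * y))" if "y \<in> {..0}" for y
      by (rule integrable_reflected[OF k(1) cf f]) (use that in auto)
    show "integrable half_line (\<lambda>s. \<bar>- s * k s\<bar> * B')"
      by (intro integrable_mult_left integrable_abs k')
    fix y s :: real assume y: "y \<in> {..0}" and s: "s \<in> space half_line"
    have *: "((\<lambda>y. - s * y) has_vector_derivative - s) (at y within {..0})"
      by (auto intro!: derivative_eq_intros)
    have "(- s * y) \<ge> 0" "(\<lambda>y. - s * y) ` {..0} \<subseteq> {0..}"
      using y s by (auto simp: mult_nonneg_nonpos)
    then have "(f has_vector_derivative f' (- s * y)) (at (- s * y) within (\<lambda>y. - s * y) ` {..0})"
      by (auto intro: has_vector_derivative_within_subset[OF der])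
    from vector_diff_chain_within[OF * this]
    have "((\<lambda>y. f (- s * y)) has_vector_derivative - s *\<^sub>R f' (- s * y)) (at y within {..0})"
      by (simp add: o_def)
    from has_vector_derivative_scaleR[OF _ this, of "\<lambda>_. k s" 0]
    show "((\<lambda>y. k s *\<^sub>R f (- s * y)) has_vector_derivative (- s * k s) *\<^sub>R f' (- s * y)) (at y within {..0})"
      by (simp add: mult.commute)
    show "norm ((- s * k s) *\<^sub>R f' (- s * y)) \<le> \<bar>- s * k s\<bar> * B'"
      using f'[of "- s * y"] y s by (auto simp: mult_nonneg_nonpos intro!: mult_left_mono)
  qed (use that in auto)
  have e: "extend k f t = ?G t" if "t \<le> 0" for t
    using that k integral_scaleR_left[of "f 0" half_line k]
    by (cases "t = 0") (auto simp: extend_def)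
  have e': "extend (\<lambda>s. - s * k s) f' t = ?G' t" if "t \<le> 0" for t
  proof (cases "t = 0")
    case True
    then have "?G' t = (integral\<^sup>L half_line (\<lambda>s. - s * k s)) *\<^sub>R f' 0"
      using k'(1) by (simp only: integral_scaleR_left mult_zero_right)
    then show ?thesis
      using True k'(2) by (simp add: extend_def)
  qed (use that in \<open>auto simp: extend_def\<close>)
  have neg: "(extend k f has_vector_derivative extend (\<lambda>s. - s * k s) f' t) (at t within {..0})" if "t \<le> 0"
    unfolding e'[OF that]
    by (rule has_vector_derivative_transform[OF _ _ G]) (use e that in auto)
  have pos: "(extend k f has_vector_derivative extend (\<lambda>s. - s * k s) f' t) (at t within {0..})" if "0 \<le> t"
    by (rule has_vector_derivative_transform[OF _ _ has_vector_derivative_eq_rhs[OF der]]) (use that in \<open>auto simp: extend_def\<close>)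
  consider "t < 0" | "0 < t" | "t = 0"
    by linarith
  then show ?thesis
  proof cases
    case 1
    then show ?thesis
      using neg at_within_interior[of t "{..0}"] by simp
  next
    case 2
    then show ?thesis
      using pos at_within_interior[of t "{0..}"] by simp
  next
    case 3
    have "{..0::real} \<union> {0..} = UNIV"
      by auto
    moreover have "(extend k f has_vector_derivative extend (\<lambda>s. - s * k s) f' t) (at t within {..0} \<union> {0..})"
      using 3 neg pos unfolding has_vector_derivative_within_iff Lim_within_Un by simp
    ultimately show ?thesis
      by simp
  qed
qed


subsection \<open>Tensor powers of positive definite forms\<close>

lemma finite_idx [simp]: "finite (idx n :: 'm::finite list set)"
  using finite_lists_length_eq[of "UNIV :: 'm set" n] by (simp add: idx_def)

lemma idx_Suc: "idx (Suc n) = (\<lambda>(i, I). i # I) ` (UNIV \<times> idx n)"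
  by (force simp: idx_def length_Suc_conv)

text \<open>Distributivity over index lists: an identity between tensor powers of matrices reduces
  to the identity for the single factors.\<close>

lemma sum_idx_prod:
  fixes f :: "nat \<Rightarrow> 'm::finite \<Rightarrow> real"
  shows "(\<Sum>J\<in>idx n. \<Prod>a<n. f a (J ! a)) = (\<Prod>a<n. \<Sum>j\<in>UNIV. f a j)"
proof (induction n arbitrary: f)
  case 0
  then show ?case
    by (simp add: idx_def)
next
  case (Suc n)
  have "inj_on (\<lambda>(i, I). i # I) (UNIV \<times> (idx n :: 'm list set))"
    by (auto simp: inj_on_def)
  then have "(\<Sum>J\<in>idx (Suc n). \<Prod>a<Suc n. f a (J ! a))
      = (\<Sum>(j, J)\<in>UNIV \<times> idx n. f 0 j * (\<Prod>a<n. f (Suc a) (J ! a)))"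
    by (simp add: idx_Suc sum.reindex case_prod_unfold prod.lessThan_Suc_shift del: prod.lessThan_Suc)
  also have "\<dots> = (\<Sum>j\<in>UNIV. f 0 j) * (\<Sum>J\<in>idx n. \<Prod>a<n. f (Suc a) (J ! a))"
    by (simp add: sum_product sum.cartesian_product)
  also have "\<dots> = (\<Prod>a<Suc n. \<Sum>j\<in>UNIV. f a j)"
    unfolding Suc.IH[of "\<lambda>a. f (Suc a)"] by (simp only: prod.lessThan_Suc_shift o_def)
  finally show ?case .
qed

text \<open>The tensor power of the identity matrix is again an identity matrix, indexed by
  lists.\<close>

lemma prod_idx_delta:
  assumes "I \<in> idx n" "I' \<in> idx n"
  shows "(\<Prod>a<n. if I ! a = I' ! a then 1 else 0 :: real) = (if I = I' then 1 else 0)"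
proof (cases "I = I'")
  case False
  then obtain a where "a < n" "I ! a \<noteq> I' ! a"
    using assms by (auto simp: idx_def list_eq_iff_nth_eq)
  then show ?thesis
    using False by (auto intro!: prod_zero)
qed simp

text \<open>Gram-Schmidt for the scalar product given by \<open>G\<close>, by induction on the set
  of indices already treated; the values of \<open>e\<close> at other indices are left free.\<close>

lemma gram_schmidt_form:
  fixes G :: "real^'m^'m"
  assumes sym: "transpose G = G" and pos: "\<And>\<xi>. \<xi> \<noteq> 0 \<Longrightarrow> 0 < \<xi> \<bullet> (G *v \<xi>)"
  shows "\<exists>e::'m \<Rightarrow> real^'m. \<forall>i\<in>S. \<forall>j\<in>S. e i \<bullet> (G *v e j) = (if i = j then 1 else 0)"
  using finite[of S]
proof (induction S rule: finite_induct)
  case empty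
  then show ?case by simp
next
  case (insert k S)
  have commute: "x \<bullet> (G *v y) = y \<bullet> (G *v x)" for x y
    by (metis dot_lmul_matrix inner_commute sym vector_transpose_matrix transpose_transpose)
  from insert.IH obtain e where e: "\<And>i j. i \<in> S \<Longrightarrow> j \<in> S \<Longrightarrow> e i \<bullet> (G *v e j) = (if i = j then 1 else 0)"
    by blast
  \<comment> \<open>As \<open>k\<close> lies outside \<open>S\<close>, fewer than
    \<open>CARD('m)\<close> vectors have been chosen, so some \<open>x\<close> lies outside their
    span.\<close>
  have "dim (e ` S) \<le> card S"
    by (meson card_image_le dim_le_card' finite finite_imageI le_trans)
  also have "\<dots> < CARD('m)"
    using insert.hyps by (metis card_mono finite insertI1 le_neq_implies_less top_greatest card_subset_eq UNIV_I)
  finally have "span (e ` S) \<noteq> UNIV"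
    by (metis DIM_cart DIM_real dim_UNIV dim_span less_irrefl mult_1_right)
  then obtain x where x: "x \<notin> span (e ` S)"
    by auto
  define y where "y = x - (\<Sum>i\<in>S. (e i \<bullet> (G *v x)) *\<^sub>R e i)"
  have "y \<noteq> 0"
  proof
    assume "y = 0"
    then have "x = (\<Sum>i\<in>S. (e i \<bullet> (G *v x)) *\<^sub>R e i)"
      by (simp add: y_def)
    also have "\<dots> \<in> span (e ` S)"
      by (intro span_sum span_scale span_base) auto
    finally show False
      using x by simp
  qed
  then have ypos: "0 < y \<bullet> (G *v y)"
    by (rule pos)
  have orth: "e j \<bullet> (G *v y) = 0" if "j \<in> S" for j
  proof -
    have "e j \<bullet> (G *v y) = e j \<bullet> (G *v x) - (\<Sum>i\<in>S. (e i \<bullet> (G *v x)) * (e j \<bullet> (G *v e i)))"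
      by (simp add: y_def matrix_vector_mult_diff_distrib inner_diff_right inner_sum_right
        linear_sum[OF matrix_vector_mul_linear] matrix_vector_mult_scaleR)
    also have "(\<Sum>i\<in>S. (e i \<bullet> (G *v x)) * (e j \<bullet> (G *v e i))) = (\<Sum>i\<in>S. if i = j then e i \<bullet> (G *v x) else 0)"
      using that by (intro sum.cong) (auto simp: e)
    finally show ?thesis
      using that by (simp add: sum.delta)
  qed
  define e' where "e' = e(k := (1 / sqrt (y \<bullet> (G *v y))) *\<^sub>R y)"
  have "e' i \<bullet> (G *v e' j) = (if i = j then 1 else 0)" if "i \<in> insert k S" "j \<in> insert k S" for i j
    using that insert.hyps ypos orth orth[unfolded commute[of _ y]]
    by (auto simp: e'_def e matrix_vector_mult_scaleR real_sqrt_mult_self simp flip: real_sqrt_mult)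
  then show ?case
    by blast
qed

text \<open>The columns of \<open>E\<close> form a basis orthonormal for \<open>G\<close>, and
  \<open>A = transpose E ** G\<close> is its inverse. The bound for \<open>A\<close> holds because
  the squared norm of its \<open>j\<close>th column is a diagonal entry of \<open>G\<close>; the one
  for \<open>E\<close> because a column \<open>e\<close> satisfies
  \<open>c1 * (norm e)\<^sup>2 \<le> e \<bullet> (G *v e) = 1\<close>.\<close>

lemma form_diagonalization:
  fixes G :: "real^'m^'m"
  assumes sym: "transpose G = G" and c: "0 < c1"
    and bounds: "\<And>\<xi>. c1 * (norm \<xi>)\<^sup>2 \<le> \<xi> \<bullet> (G *v \<xi>)" "\<And>\<xi>. \<xi> \<bullet> (G *v \<xi>) \<le> c2 * (norm \<xi>)\<^sup>2"
  obtains A E :: "real^'m^'m" where "E ** A = mat 1" "G = transpose A ** A" "matrix_inv G = E ** transpose E"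
    "\<And>i j. \<bar>A $ i $ j\<bar> \<le> sqrt c2" "\<And>i j. \<bar>E $ i $ j\<bar> \<le> 1 / sqrt c1"
proof -
  have "0 < \<xi> \<bullet> (G *v \<xi>)" if "\<xi> \<noteq> 0" for \<xi>
    using bounds(1)[of \<xi>] that c by (smt (verit) mult_pos_pos zero_less_norm_iff zero_less_power)
  from gram_schmidt_form[OF sym this, of UNIV] obtain e :: "'m \<Rightarrow> real^'m"
    where e: "\<And>i j. e i \<bullet> (G *v e j) = (if i = j then 1 else 0)"
    by blast
  define E where "E = (\<chi> i j. e j $ i)"
  have Ee: "E *v axis j 1 = e j" for j
    by (simp add: E_def matrix_vector_mult_basis column_def vec_eq_iff)
  have "(transpose E ** G ** E) $ i $ j = (mat 1 :: real^'m^'m) $ i $ j" for i j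
  proof -
    have "(transpose E ** G ** E) $ i $ j = axis i 1 \<bullet> ((transpose E ** G ** E) *v axis j 1)"
      by (simp add: inner_axis' matrix_vector_mult_basis column_def)
    also have "\<dots> = (E *v axis i 1) \<bullet> (G *v (E *v axis j 1))"
      by (metis dot_lmul_matrix matrix_vector_mul_assoc transpose_matrix_vector transpose_transpose)
    finally show ?thesis
      by (simp add: Ee e mat_def)
  qed
  then have EGE: "transpose E ** G ** E = mat 1"
    by (simp add: vec_eq_iff)
  define A where "A = transpose E ** G"
  have AE: "A ** E = mat 1"
    using EGE by (simp add: A_def)
  then have EA: "E ** A = mat 1"
    by (simp add: matrix_left_right_inverse)
  have AtEt: "transpose A ** transpose E = mat 1"
    by (metis EA matrix_transpose_mul transpose_mat)
  have "transpose A ** A = (transpose A ** transpose E) ** G"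
    by (simp add: A_def matrix_mul_assoc)
  then have G: "G = transpose A ** A"
    by (simp add: AtEt)
  have EtAt: "transpose E ** transpose A = mat 1"
    by (metis AE matrix_transpose_mul transpose_mat)
  have inv1: "G ** (E ** transpose E) = mat 1"
    by (metis AE AtEt G matrix_mul_assoc matrix_mul_rid)
  then have inv2: "(E ** transpose E) ** G = mat 1"
    by (simp add: matrix_left_right_inverse)
  \<comment> \<open>\<open>matrix_inv\<close> is defined by choice, so the existence of a two-sided
    inverse comes first; uniqueness then identifies the chosen one with
    \<open>E ** transpose E\<close>.\<close>
  have "invertible G"
    using inv1 inv2 by (auto simp: invertible_def)
  then have "G ** matrix_inv G = mat 1"
    using inv1 inv2 someI[of "\<lambda>B. G ** B = mat 1 \<and> B ** G = mat 1"] by (auto simp: matrix_inv_def)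
  then have Ginv: "matrix_inv G = E ** transpose E"
    by (metis inv2 matrix_mul_assoc matrix_mul_lid matrix_mul_rid)
  have normA: "(norm (A *v \<xi>))\<^sup>2 = \<xi> \<bullet> (G *v \<xi>)" for \<xi>
    unfolding G power2_norm_eq_inner
    by (metis dot_lmul_matrix matrix_vector_mul_assoc transpose_matrix_vector transpose_transpose)
  have "\<bar>A $ i $ j\<bar> \<le> sqrt c2" for i j
  proof -
    have "(norm (A *v axis j 1))\<^sup>2 \<le> c2"
      using bounds(2)[of "axis j 1"] by (simp add: normA)
    then have "norm (A *v axis j 1) \<le> sqrt c2"
      by (simp add: real_le_rsqrt)
    moreover have "\<bar>A $ i $ j\<bar> \<le> norm (A *v axis j 1)"
      using component_le_norm_cart[of "A *v axis j 1" i]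
      by (simp add: matrix_vector_mult_basis column_def)
    ultimately show ?thesis
      by linarith
  qed
  moreover have "\<bar>E $ i $ j\<bar> \<le> 1 / sqrt c1" for i j
  proof -
    have "c1 * (norm (E *v axis j 1))\<^sup>2 \<le> 1"
      using bounds(1)[of "E *v axis j 1"] unfolding Ee by (simp add: e)
    then have "(sqrt c1 * norm (E *v axis j 1))\<^sup>2 \<le> 1\<^sup>2"
      using c by (simp add: power_mult_distrib)
    then have "sqrt c1 * norm (E *v axis j 1) \<le> 1"
      by (rule power2_le_imp_le) simp
    then have "norm (E *v axis j 1) \<le> 1 / sqrt c1"
      using c by (simp add: field_simps)
    moreover have "\<bar>E $ i $ j\<bar> \<le> norm (E *v axis j 1)"
      using component_le_norm_cart[of "E *v axis j 1" i]
      by (simp add: matrix_vector_mult_basis column_def)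
    ultimately show ?thesis
      by linarith
  qed
  ultimately show ?thesis
    using that EA G Ginv by blast
qed

text \<open>If the coefficients form a Gram matrix, the double sum is a sum of values of the form on
  the diagonal, hence of squares when the form is positive semidefinite.\<close>

lemma gram_form:
  fixes \<beta> :: "'b::euclidean_space \<Rightarrow> 'b \<Rightarrow> real" and r :: "'y \<Rightarrow> 'x \<Rightarrow> real"
  assumes "bilinear \<beta>"
  shows "(\<Sum>x\<in>X. \<Sum>x'\<in>X. (\<Sum>y\<in>Y. r y x * r y x') * \<beta> (v x) (v x'))
    = (\<Sum>y\<in>Y. \<beta> (\<Sum>x\<in>X. r y x *\<^sub>R v x) (\<Sum>x\<in>X. r y x *\<^sub>R v x))"
proof -
  interpret bounded_bilinear \<beta>
    using assms by (simp add: bilinear_conv_bounded_bilinear)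
  have "(\<Sum>y\<in>Y. \<beta> (\<Sum>x\<in>X. r y x *\<^sub>R v x) (\<Sum>x\<in>X. r y x *\<^sub>R v x))
      = (\<Sum>y\<in>Y. \<Sum>x\<in>X. \<Sum>x'\<in>X. r y x * r y x' * \<beta> (v x) (v x'))"
    unfolding sum_left unfolding sum_right by (simp add: scaleR_left scaleR_right ac_simps)
  also have "\<dots> = (\<Sum>x\<in>X. \<Sum>y\<in>Y. \<Sum>x'\<in>X. r y x * r y x' * \<beta> (v x) (v x'))"
    by (rule sum.swap)
  also have "\<dots> = (\<Sum>x\<in>X. \<Sum>x'\<in>X. \<Sum>y\<in>Y. r y x * r y x' * \<beta> (v x) (v x'))"
    by (intro sum.cong refl sum.swap)
  finally show ?thesis
    by (simp add: sum_distrib_right)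
qed

text \<open>
  With \<open>q\<close> the value of the form at the integral and \<open>C\<close> the integral of \<open>\<bar>k\<bar>\<close>, pulling one of the
  two arguments out of the integral and applying \<open>2 \<beta>(u, z) \<le> C \<beta>(u, u) + \<beta>(z, z) / C\<close>
  gives \<open>q \<le> C * (C * N\<^sup>2 + q / C) / 2\<close>.
\<close>

lemma form_integral_le:
  fixes \<beta> :: "'b::euclidean_space \<Rightarrow> 'b \<Rightarrow> real"
  assumes bil: "bilinear \<beta>" and sym: "\<And>a b. \<beta> a b = \<beta> b a" and pos: "\<And>a. 0 \<le> \<beta> a a"
    and k: "integrable M k" and C: "0 < (\<integral>s. \<bar>k s\<bar> \<partial>M)"
    and int: "\<And>y. y \<in> Y \<Longrightarrow> integrable M (\<lambda>s. k s *\<^sub>R u s y)"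
    and bound: "\<And>s. s \<in> space M \<Longrightarrow> (\<Sum>y\<in>Y. \<beta> (u s y) (u s y)) \<le> N\<^sup>2"
  shows "(\<Sum>y\<in>Y. \<beta> (\<integral>s. k s *\<^sub>R u s y \<partial>M) (\<integral>s. k s *\<^sub>R u s y \<partial>M)) \<le> (\<integral>s. \<bar>k s\<bar> \<partial>M)\<^sup>2 * N\<^sup>2"
proof -
  interpret bounded_bilinear \<beta>
    using bil by (simp add: bilinear_conv_bounded_bilinear)
  define C where "C = (\<integral>s. \<bar>k s\<bar> \<partial>M)"
  have "0 < C"
    using C by (simp add: C_def)
  define z where "z y = (\<integral>s. k s *\<^sub>R u s y \<partial>M)" for y
  define q where "q = (\<Sum>y\<in>Y. \<beta> (z y) (z y))"
  have 1: "2 * C * \<bar>\<Sum>y\<in>Y. \<beta> (u s y) (z y)\<bar> \<le> C\<^sup>2 * N\<^sup>2 + q" if "s \<in> space M" for s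
  proof -
    \<comment> \<open>Used for \<open>t = 1\<close> and \<open>t = -1\<close>: the two signs
      together bound the absolute value of the mixed term.\<close>
    have expand: "\<beta> (C *\<^sub>R u s y + t *\<^sub>R z y) (C *\<^sub>R u s y + t *\<^sub>R z y)
        = C\<^sup>2 * \<beta> (u s y) (u s y) + 2 * C * t * \<beta> (u s y) (z y) + t\<^sup>2 * \<beta> (z y) (z y)" for t y
      using sym[of "z y" "u s y"]
      by (simp add: add_left add_right scaleR_left scaleR_right power2_eq_square algebra_simps)
    have "0 \<le> (\<Sum>y\<in>Y. \<beta> (C *\<^sub>R u s y + t *\<^sub>R z y) (C *\<^sub>R u s y + t *\<^sub>R z y))" for t
      by (intro sum_nonneg pos)
    then have q: "0 \<le> C\<^sup>2 * (\<Sum>y\<in>Y. \<beta> (u s y) (u s y)) + 2 * C * t * (\<Sum>y\<in>Y. \<beta> (u s y) (z y)) + t\<^sup>2 * q" for t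
      by (simp add: expand sum.distrib q_def sum_distrib_left)
    moreover have "C\<^sup>2 * (\<Sum>y\<in>Y. \<beta> (u s y) (u s y)) \<le> C\<^sup>2 * N\<^sup>2"
      by (intro mult_left_mono bound that) auto
    moreover have "2 * C * \<bar>\<Sum>y\<in>Y. \<beta> (u s y) (z y)\<bar> = \<bar>2 * C * (\<Sum>y\<in>Y. \<beta> (u s y) (z y))\<bar>"
      using \<open>0 < C\<close> by (simp add: abs_mult)
    ultimately show ?thesis
      using q[of 1] q[of "-1"] by simp
  qed
  have int': "integrable M (\<lambda>s. \<beta> (k s *\<^sub>R u s y) (z y))" if "y \<in> Y" for y
    using integrable_bounded_linear[OF bounded_linear_left int[OF that], of "z y"] .
  have "q = (\<Sum>y\<in>Y. \<integral>s. \<beta> (k s *\<^sub>R u s y) (z y) \<partial>M)"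
    unfolding q_def
  proof (rule sum.cong[OF refl])
    fix y assume "y \<in> Y"
    from integral_bounded_linear[OF bounded_linear_left int[OF this], of "z y"]
    show "\<beta> (z y) (z y) = (\<integral>s. \<beta> (k s *\<^sub>R u s y) (z y) \<partial>M)"
      by (simp add: z_def)
  qed
  also have "\<dots> = (\<integral>s. (\<Sum>y\<in>Y. \<beta> (k s *\<^sub>R u s y) (z y)) \<partial>M)"
    using int' by (simp add: Bochner_Integration.integral_sum)
  also have "\<dots> \<le> (\<integral>s. \<bar>k s\<bar> * ((C\<^sup>2 * N\<^sup>2 + q) / (2 * C)) \<partial>M)"
  proof (rule integral_mono)
    show "integrable M (\<lambda>s. \<Sum>y\<in>Y. \<beta> (k s *\<^sub>R u s y) (z y))"
      using int' by auto
    show "integrable M (\<lambda>s. \<bar>k s\<bar> * ((C\<^sup>2 * N\<^sup>2 + q) / (2 * C)))"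
      using k by auto
    fix s assume "s \<in> space M"
    then have "\<bar>\<Sum>y\<in>Y. \<beta> (u s y) (z y)\<bar> \<le> (C\<^sup>2 * N\<^sup>2 + q) / (2 * C)"
      using 1[of s] \<open>0 < C\<close> by (simp add: field_simps)
    then have "\<bar>k s\<bar> * \<bar>\<Sum>y\<in>Y. \<beta> (u s y) (z y)\<bar> \<le> \<bar>k s\<bar> * ((C\<^sup>2 * N\<^sup>2 + q) / (2 * C))"
      by (intro mult_left_mono) auto
    moreover have "(\<Sum>y\<in>Y. \<beta> (k s *\<^sub>R u s y) (z y)) = k s * (\<Sum>y\<in>Y. \<beta> (u s y) (z y))"
      by (simp add: scaleR_left sum_distrib_left)
    ultimately show "(\<Sum>y\<in>Y. \<beta> (k s *\<^sub>R u s y) (z y)) \<le> \<bar>k s\<bar> * ((C\<^sup>2 * N\<^sup>2 + q) / (2 * C))"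
      using abs_ge_self[of "k s * (\<Sum>y\<in>Y. \<beta> (u s y) (z y))"] by (simp add: abs_mult)
  qed
  also have "\<dots> = C * ((C\<^sup>2 * N\<^sup>2 + q) / (2 * C))"
    unfolding integral_mult_left_zero by (simp only: C_def)
  also have "\<dots> = (C\<^sup>2 * N\<^sup>2 + q) / 2"
    using \<open>0 < C\<close> by simp
  finally have "q \<le> C\<^sup>2 * N\<^sup>2"
    by simp
  then show ?thesis
    by (simp add: q_def z_def C_def)
qed



subsection \<open>The norm of tensors\<close>

lemma re_part_scaleR [simp]: "re_part (c *\<^sub>R z) = c * re_part z"
  by (simp add: re_part_def)

lemma re_part_add [simp]: "re_part (y + z) = re_part y + re_part z"
  by (simp add: re_part_def inner_add_left)

lemma re_part_sum: "re_part (sum f A) = (\<Sum>x\<in>A. re_part (f x))"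
  by (simp add: re_part_def inner_sum_left)

lemma re_part_kconj [simp]: "re_part (kconj z) = re_part z"
  by (simp add: kconj_def re_part_def inner_diff_left of_real_def norm_eq_1[symmetric])

lemma scaleR_eq_scalar_mult:
  fixes x :: "'k::real_normed_field^'n" shows "c *\<^sub>R x = of_real c *s x"
  by (simp add: vec_eq_iff scaleR_conv_of_real[symmetric])

lemma subspace_if_vec_subspace:
  fixes F :: "('k::{real_normed_field,euclidean_space}^'n::finite) set"
  assumes "vec.subspace F" shows "subspace F"
  unfolding subspace_def scaleR_eq_scalar_mult
  using assms by (auto simp: vec.subspace_def)

text \<open>The forms and operators of the bundle are known to be linear on the model fiber only.
  Composition with a projection onto it yields maps defined and linear on the whole space.\<close>

lemma obtain_linear_projection:
  fixes F :: "'b::euclidean_space set"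
  assumes "subspace F"
  obtains P where "linear P" "\<And>x. P x \<in> F" "\<And>x. x \<in> F \<Longrightarrow> P x = x"
proof -
  from linear_exists_left_inverse_on[OF linear_id assms] obtain P
    where "P ` UNIV \<subseteq> F" "linear P" "\<forall>v\<in>F. P (id v) = v"
    by auto
  then show ?thesis
    using that[of P] by (auto simp: image_subset_iff)
qed

text \<open>The real part of a Hermitian form is symmetric and bilinear over the reals. The form is
  extended from \<open>F\<close> through a projection, on whose kernel it vanishes, whence only
  \<open>0 \<le> \<beta> a a\<close>.\<close>

lemma obtain_real_inner_product:
  fixes H :: "'k::{real_normed_field,euclidean_space}^'n::finite \<Rightarrow> 'k^'n \<Rightarrow> 'k"
  assumes F: "vec.subspace F" and H: "inner_product_on F H"
  obtains \<beta> where "bilinear \<beta>" "\<And>a b. \<beta> a b = \<beta> b a" "\<And>a. 0 \<le> \<beta> a a"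
    "\<And>a b. a \<in> F \<Longrightarrow> b \<in> F \<Longrightarrow> \<beta> a b = re_part (H a b)"
proof -
  obtain P where P: "linear P" "\<And>x. P x \<in> F" "\<And>x. x \<in> F \<Longrightarrow> P x = x"
    using obtain_linear_projection[OF subspace_if_vec_subspace[OF F]] by blast
  define \<beta> where "\<beta> a b = re_part (H (P a) (P b))" for a b
  have add: "H (P a + P a') (P b) = H (P a) (P b) + H (P a') (P b)"
    and scale: "H (z *s P a) (P b) = z * H (P a) (P b)"
    and conj: "H (P b) (P a) = kconj (H (P a) (P b))"
    and pos: "P a \<noteq> 0 \<Longrightarrow> 0 < re_part (H (P a) (P a))" for a a' b z
    using H P(2) unfolding inner_product_on_def by blast+
  have sym: "\<beta> a b = \<beta> b a" for a b
    unfolding \<beta>_def conj[of b a] by simp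
  have lin: "linear (\<lambda>a. \<beta> a b)" for b
  proof (rule linearI)
    show "\<beta> (a + a') b = \<beta> a b + \<beta> a' b" for a a'
      by (simp add: \<beta>_def linear_add[OF P(1)] add)
    show "\<beta> (c *\<^sub>R a) b = c *\<^sub>R \<beta> a b" for a c
      unfolding \<beta>_def linear_scale[OF P(1)] unfolding scaleR_eq_scalar_mult scale
      by (simp flip: scaleR_conv_of_real)
  qed
  have "0 \<le> \<beta> a a" for a
  proof (cases "P a = 0")
    case True
    then have "\<beta> a a = \<beta> 0 a"
      by (simp add: \<beta>_def linear_0[OF P(1)])
    then show ?thesis
      using linear_0[OF lin] by simp
  next
    case False
    then show ?thesis
      using pos by (simp add: \<beta>_def less_imp_le)
  qed
  moreover have "\<beta> a = (\<lambda>b. \<beta> b a)" for a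
    using sym by blast
  then have "bilinear \<beta>"
    unfolding bilinear_def using lin by metis
  ultimately show ?thesis
    using that[of \<beta>] sym P(3) by (simp add: \<beta>_def)
qed

text \<open>\<open>r\<close> passes to the components in an orthonormal frame, with a factor
  \<open>A\<close> for each contravariant and a factor \<open>E\<close> for each covariant index.
  \<open>S\<close>, with the two roles exchanged, recovers the original components; its entries are
  products of \<open>\<sigma>\<close> entries of \<open>E\<close> and \<open>n\<close> entries of
  \<open>A\<close>.\<close>

lemma obtain_tensor_diagonalization:
  fixes G :: "real^'m^'m"
  assumes sym: "transpose G = G" and c: "0 < c1"
    and bounds: "\<And>\<xi>. c1 * (norm \<xi>)\<^sup>2 \<le> \<xi> \<bullet> (G *v \<xi>)" "\<And>\<xi>. \<xi> \<bullet> (G *v \<xi>) \<le> c2 * (norm \<xi>)\<^sup>2"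
  obtains r S :: "'m list \<times> 'm list \<Rightarrow> 'm list \<times> 'm list \<Rightarrow> real" where
    "\<And>I L I' L'. (\<Prod>a<\<sigma>. G $ (I ! a) $ (I' ! a)) * (\<Prod>b<n. matrix_inv G $ (L ! b) $ (L' ! b))
       = (\<Sum>y\<in>idx \<sigma> \<times> idx n. r y (I, L) * r y (I', L'))"
    "\<And>x x'. x \<in> idx \<sigma> \<times> idx n \<Longrightarrow> x' \<in> idx \<sigma> \<times> idx n \<Longrightarrow>
       (\<Sum>y\<in>idx \<sigma> \<times> idx n. S x y * r y x') = (if x = x' then 1 else 0)"
    "\<And>x y. \<bar>S x y\<bar> \<le> (1 / sqrt c1) ^ \<sigma> * sqrt c2 ^ n"
proof -
  obtain A E :: "real^'m^'m" where EA: "E ** A = mat 1" and G: "G = transpose A ** A"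
    and Ginv: "matrix_inv G = E ** transpose E"
    and A: "\<And>i j. \<bar>A $ i $ j\<bar> \<le> sqrt c2" and E: "\<And>i j. \<bar>E $ i $ j\<bar> \<le> 1 / sqrt c1"
    using form_diagonalization[OF sym c bounds] by blast
  define r where "r y x = (\<Prod>a<\<sigma>. A $ (fst y ! a) $ (fst x ! a)) * (\<Prod>b<n. E $ (snd x ! b) $ (snd y ! b))"
    for x y :: "'m list \<times> 'm list"
  define S where "S x y = (\<Prod>a<\<sigma>. E $ (fst x ! a) $ (fst y ! a)) * (\<Prod>b<n. A $ (snd y ! b) $ (snd x ! b))"
    for x y :: "'m list \<times> 'm list"
  have EA': "(\<Sum>j\<in>UNIV. E $ i $ j * A $ j $ i') = (if i = i' then 1 else 0)" for i i'
    using EA by (simp add: vec_eq_iff matrix_matrix_mult_def mat_def)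
  have split: "(\<Sum>y\<in>idx \<sigma> \<times> idx n. (\<Prod>a<\<sigma>. f a (fst y ! a)) * (\<Prod>b<n. f' b (snd y ! b)))
      = (\<Prod>a<\<sigma>. \<Sum>j\<in>UNIV. f a j) * (\<Prod>b<n. \<Sum>j\<in>UNIV. f' b j)" for f f' :: "nat \<Rightarrow> 'm \<Rightarrow> real"
    by (simp add: sum_idx_prod[symmetric] sum_product sum.cartesian_product case_prod_unfold)
  have "(\<Prod>a<\<sigma>. G $ (I ! a) $ (I' ! a)) * (\<Prod>b<n. matrix_inv G $ (L ! b) $ (L' ! b))
       = (\<Sum>y\<in>idx \<sigma> \<times> idx n. r y (I, L) * r y (I', L'))" for I L I' L'
  proof -
    have "(\<Prod>a<\<sigma>. G $ (I ! a) $ (I' ! a)) * (\<Prod>b<n. matrix_inv G $ (L ! b) $ (L' ! b))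
        = (\<Prod>a<\<sigma>. \<Sum>j\<in>UNIV. A $ j $ (I ! a) * A $ j $ (I' ! a))
          * (\<Prod>b<n. \<Sum>j\<in>UNIV. E $ (L ! b) $ j * E $ (L' ! b) $ j)"
      unfolding Ginv by (simp add: G matrix_matrix_mult_def transpose_def)
    then show ?thesis
      unfolding split[symmetric] by (simp add: r_def prod.distrib ac_simps)
  qed
  moreover have "(\<Sum>y\<in>idx \<sigma> \<times> idx n. S x y * r y x') = (if x = x' then 1 else 0)"
    if "x \<in> idx \<sigma> \<times> idx n" "x' \<in> idx \<sigma> \<times> idx n" for x x'
  proof -
    have "(\<Sum>y\<in>idx \<sigma> \<times> idx n. S x y * r y x')
        = (\<Prod>a<\<sigma>. \<Sum>j\<in>UNIV. E $ (fst x ! a) $ j * A $ j $ (fst x' ! a))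
          * (\<Prod>b<n. \<Sum>j\<in>UNIV. E $ (snd x' ! b) $ j * A $ j $ (snd x ! b))"
      unfolding split[symmetric] by (simp add: r_def S_def prod.distrib ac_simps)
    also have "\<dots> = (if fst x = fst x' then 1 else 0) * (if snd x' = snd x then 1 else 0)"
      unfolding EA' using that by (simp add: prod_idx_delta mem_Times_iff)
    finally show ?thesis
      by (auto simp: prod_eq_iff)
  qed
  moreover have "\<bar>S x y\<bar> \<le> (1 / sqrt c1) ^ \<sigma> * sqrt c2 ^ n" for x y
  proof -
    have "(\<Prod>a<\<sigma>. \<bar>E $ (fst x ! a) $ (fst y ! a)\<bar>) \<le> (\<Prod>a<\<sigma>. 1 / sqrt c1)"
      by (intro prod_mono) (use E in auto)
    moreover have "(\<Prod>b<n. \<bar>A $ (snd y ! b) $ (snd x ! b)\<bar>) \<le> (\<Prod>b<n. sqrt c2)"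
      by (intro prod_mono) (use A in auto)
    ultimately show ?thesis
      unfolding S_def abs_mult abs_prod by (auto intro!: mult_mono prod_nonneg simp: less_imp_le c)
  qed
  ultimately show ?thesis
    using that by blast
qed

text \<open>Diagonalizing the form turns the norm into the root of a sum of squares of the components
  with respect to an orthonormal frame.\<close>

lemma tnorm_eq_sum_of_squares:
  fixes g :: "('a,'m::finite) metric" and W :: "('w,'a,'m,'k::{real_normed_field,euclidean_space},'n::finite) vbundle"
    and r :: "'m list \<times> 'm list \<Rightarrow> 'm list \<times> 'm list \<Rightarrow> real"
  assumes \<beta>: "bilinear \<beta>" "\<And>a b. a \<in> F \<Longrightarrow> b \<in> F \<Longrightarrow> \<beta> a b = re_part (hloc W \<kappa> p a b)"
    and r: "\<And>I L I' L'. (\<Prod>a<\<sigma>. g \<kappa> p $ (I ! a) $ (I' ! a)) * (\<Prod>b<n. matrix_inv (g \<kappa> p) $ (L ! b) $ (L' ! b))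
       = (\<Sum>y\<in>idx \<sigma> \<times> idx n. r y (I, L) * r y (I', L'))"
    and v: "\<And>I L. v \<kappa> I L \<in> F"
  shows "tnorm g W \<sigma> n \<kappa> p v = sqrt (\<Sum>y\<in>idx \<sigma> \<times> idx n.
    \<beta> (\<Sum>(I, L)\<in>idx \<sigma> \<times> idx n. r y (I, L) *\<^sub>R v \<kappa> I L) (\<Sum>(I, L)\<in>idx \<sigma> \<times> idx n. r y (I, L) *\<^sub>R v \<kappa> I L))"
proof -
  let ?X = "idx \<sigma> \<times> idx n :: ('m list \<times> 'm list) set"
  let ?h = "\<lambda>I L I' L'. (\<Sum>y\<in>?X. r y (I, L) * r y (I', L')) * \<beta> (v \<kappa> I L) (v \<kappa> I' L')"
  have "re_part (\<Sum>I\<in>idx \<sigma>. \<Sum>I'\<in>idx \<sigma>. \<Sum>L\<in>idx n. \<Sum>L'\<in>idx n.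
        ((\<Prod>a<\<sigma>. g \<kappa> p $ (I ! a) $ (I' ! a)) * (\<Prod>b<n. matrix_inv (g \<kappa> p) $ (L ! b) $ (L' ! b)))
          *\<^sub>R hloc W \<kappa> p (v \<kappa> I L) (v \<kappa> I' L'))
      = (\<Sum>I\<in>idx \<sigma>. \<Sum>I'\<in>idx \<sigma>. \<Sum>L\<in>idx n. \<Sum>L'\<in>idx n. ?h I L I' L')"
    by (simp add: re_part_sum r \<beta>(2) v)
  also have "\<dots> = (\<Sum>I\<in>idx \<sigma>. \<Sum>L\<in>idx n. \<Sum>I'\<in>idx \<sigma>. \<Sum>L'\<in>idx n. ?h I L I' L')"
    by (intro sum.cong refl sum.swap)
  also have "\<dots> = (\<Sum>x\<in>?X. \<Sum>x'\<in>?X. (\<Sum>y\<in>?X. r y x * r y x') * \<beta> (v \<kappa> (fst x) (snd x)) (v \<kappa> (fst x') (snd x')))"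
  proof -
    have "sum f ?X = (\<Sum>I\<in>idx \<sigma>. \<Sum>L\<in>idx n. f (I, L))" for f :: "_ \<Rightarrow> real"
      by (simp add: sum.cartesian_product)
    then show ?thesis
      by simp
  qed
  also have "\<dots> = (\<Sum>y\<in>?X. \<beta> (\<Sum>(I, L)\<in>?X. r y (I, L) *\<^sub>R v \<kappa> I L) (\<Sum>(I, L)\<in>?X. r y (I, L) *\<^sub>R v \<kappa> I L))"
    unfolding gram_form[OF \<beta>(1)] by (simp add: case_prod_unfold)
  finally show ?thesis
    by (simp add: tnorm_def)
qed

text \<open>Each component in the orthonormal frame is at most \<open>sqrt c\<close> times the fiber
  norm, since its square is at most \<open>c\<close> times one of the nonnegative summands.
  \<open>S\<close> recovers the original component; the constant is the number of frame components
  times the entry bound of \<open>S\<close> times \<open>sqrt c\<close>.\<close>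

lemma norm_component_le_tnorm:
  fixes g :: "('a,'m::finite) metric" and W :: "('w,'a,'m,'k::{real_normed_field,euclidean_space},'n::finite) vbundle"
  assumes F: "vec.subspace F" "inner_product_on F (hloc W \<kappa> p)"
    and h: "0 < c" "\<And>a. a \<in> F \<Longrightarrow> (norm a)\<^sup>2 / c \<le> re_part (hloc W \<kappa> p a a)"
    and g: "transpose (g \<kappa> p) = g \<kappa> p" "0 < c1"
      "\<And>\<xi>. c1 * (norm \<xi>)\<^sup>2 \<le> \<xi> \<bullet> (g \<kappa> p *v \<xi>)" "\<And>\<xi>. \<xi> \<bullet> (g \<kappa> p *v \<xi>) \<le> c2 * (norm \<xi>)\<^sup>2"
    and v: "\<And>I L. v \<kappa> I L \<in> F" and IL: "I \<in> idx \<sigma>" "L \<in> idx n"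
  shows "norm (v \<kappa> I L) \<le> real (card (idx \<sigma> \<times> idx n :: ('m list \<times> 'm list) set))
    * ((1 / sqrt c1) ^ \<sigma> * sqrt c2 ^ n * sqrt c) * tnorm g W \<sigma> n \<kappa> p v"
proof -
  obtain \<beta> where \<beta>: "bilinear \<beta>" "\<And>a b. \<beta> a b = \<beta> b a" "\<And>a. 0 \<le> \<beta> a a"
    "\<And>a b. a \<in> F \<Longrightarrow> b \<in> F \<Longrightarrow> \<beta> a b = re_part (hloc W \<kappa> p a b)"
    using obtain_real_inner_product[OF F] by blast
  obtain r S :: "'m list \<times> 'm list \<Rightarrow> 'm list \<times> 'm list \<Rightarrow> real" where
    r: "\<And>I L I' L'. (\<Prod>a<\<sigma>. g \<kappa> p $ (I ! a) $ (I' ! a)) * (\<Prod>b<n. matrix_inv (g \<kappa> p) $ (L ! b) $ (L' ! b))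
       = (\<Sum>y\<in>idx \<sigma> \<times> idx n. r y (I, L) * r y (I', L'))"
    and Sr: "\<And>x x'. x \<in> idx \<sigma> \<times> idx n \<Longrightarrow> x' \<in> idx \<sigma> \<times> idx n \<Longrightarrow>
       (\<Sum>y\<in>idx \<sigma> \<times> idx n. S x y * r y x') = (if x = x' then 1 else 0)"
    and S: "\<And>x y. \<bar>S x y\<bar> \<le> (1 / sqrt c1) ^ \<sigma> * sqrt c2 ^ n"
    using obtain_tensor_diagonalization[OF g, of \<sigma> n] by blast
  let ?X = "idx \<sigma> \<times> idx n :: ('m list \<times> 'm list) set"
  let ?u = "\<lambda>y. \<Sum>(I, L)\<in>?X. r y (I, L) *\<^sub>R v \<kappa> I L"
  let ?T = "tnorm g W \<sigma> n \<kappa> p v"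
  have T: "?T = sqrt (\<Sum>y\<in>?X. \<beta> (?u y) (?u y))"
    using tnorm_eq_sum_of_squares[where \<beta> = \<beta> and F = F and W = W and \<kappa> = \<kappa> and p = p and g = g and r = r and \<sigma> = \<sigma> and n = n and v = v, OF \<beta>(1) \<beta>(4) r v] .
  have uF: "?u y \<in> F" for y
    using subspace_if_vec_subspace[OF F(1)] v
    by (auto intro!: subspace_sum subspace_scale)
  have u: "norm (?u y) \<le> sqrt c * ?T" if "y \<in> ?X" for y
  proof -
    have "(norm (?u y))\<^sup>2 \<le> c * \<beta> (?u y) (?u y)"
      using h(2)[OF uF[of y]] h(1) \<beta>(4)[OF uF[of y] uF[of y]] by (simp add: field_simps)
    also have "\<dots> \<le> c * (\<Sum>y\<in>?X. \<beta> (?u y) (?u y))"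
      using member_le_sum[OF that, of "\<lambda>y. \<beta> (?u y) (?u y)"] h(1) \<beta>(3) by (intro mult_left_mono) auto
    finally show ?thesis
      unfolding T real_sqrt_mult[symmetric] by (rule real_le_rsqrt)
  qed
  have "(\<Sum>y\<in>?X. S (I, L) y *\<^sub>R ?u y) = (\<Sum>y\<in>?X. \<Sum>x\<in>?X. (S (I, L) y * r y x) *\<^sub>R v \<kappa> (fst x) (snd x))"
    by (simp add: scaleR_sum_right case_prod_unfold)
  also have "\<dots> = (\<Sum>x\<in>?X. \<Sum>y\<in>?X. (S (I, L) y * r y x) *\<^sub>R v \<kappa> (fst x) (snd x))"
    by (rule sum.swap)
  also have "\<dots> = (\<Sum>x\<in>?X. (if (I, L) = x then 1 else 0) *\<^sub>R v \<kappa> (fst x) (snd x))"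
    unfolding scaleR_sum_left[symmetric] by (intro sum.cong refl) (use Sr[of "(I, L)"] IL in auto)
  also have "\<dots> = v \<kappa> I L"
    using IL by (subst sum.remove[of _ "(I, L)"]) (auto intro!: sum.neutral split: if_splits)
  finally have "norm (v \<kappa> I L) = norm (\<Sum>y\<in>?X. S (I, L) y *\<^sub>R ?u y)"
    by simp
  also have "\<dots> \<le> (\<Sum>y\<in>?X. ((1 / sqrt c1) ^ \<sigma> * sqrt c2 ^ n) * (sqrt c * ?T))"
    by (rule sum_norm_le) (unfold norm_scaleR, intro mult_mono S u, use order_trans[OF abs_ge_zero S] in auto)
  finally show ?thesis
    by simp
qed

text \<open>The real function \<open>sqrt\<close> is odd, hence negative at negative arguments, so
  the sign has to come from the positivity of the form.\<close>

lemma tnorm_nonneg: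
  fixes g :: "('a,'m::finite) metric" and W :: "('w,'a,'m,'k::{real_normed_field,euclidean_space},'n::finite) vbundle"
  assumes F: "vec.subspace F" "inner_product_on F (hloc W \<kappa> p)"
    and g: "transpose (g \<kappa> p) = g \<kappa> p" "0 < c1"
      "\<And>\<xi>. c1 * (norm \<xi>)\<^sup>2 \<le> \<xi> \<bullet> (g \<kappa> p *v \<xi>)" "\<And>\<xi>. \<xi> \<bullet> (g \<kappa> p *v \<xi>) \<le> c2 * (norm \<xi>)\<^sup>2"
    and v: "\<And>I L. v \<kappa> I L \<in> F"
  shows "0 \<le> tnorm g W \<sigma> n \<kappa> p v"
proof -
  obtain \<beta> where \<beta>: "bilinear \<beta>" "\<And>a b. \<beta> a b = \<beta> b a" "\<And>a. 0 \<le> \<beta> a a"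
    "\<And>a b. a \<in> F \<Longrightarrow> b \<in> F \<Longrightarrow> \<beta> a b = re_part (hloc W \<kappa> p a b)"
    using obtain_real_inner_product[OF F] by blast
  obtain r S :: "'m list \<times> 'm list \<Rightarrow> 'm list \<times> 'm list \<Rightarrow> real" where
    r: "\<And>I L I' L'. (\<Prod>a<\<sigma>. g \<kappa> p $ (I ! a) $ (I' ! a)) * (\<Prod>b<n. matrix_inv (g \<kappa> p) $ (L ! b) $ (L' ! b))
       = (\<Sum>y\<in>idx \<sigma> \<times> idx n. r y (I, L) * r y (I', L'))"
    and "\<And>x x'. x \<in> idx \<sigma> \<times> idx n \<Longrightarrow> x' \<in> idx \<sigma> \<times> idx n \<Longrightarrow>
       (\<Sum>y\<in>idx \<sigma> \<times> idx n. S x y * r y x') = (if x = x' then 1 else 0)"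
    and "\<And>x y. \<bar>S x y\<bar> \<le> (1 / sqrt c1) ^ \<sigma> * sqrt c2 ^ n"
    using obtain_tensor_diagonalization[OF g, of \<sigma> n] by blast
  have T: "tnorm g W \<sigma> n \<kappa> p v = sqrt (\<Sum>y\<in>idx \<sigma> \<times> idx n.
      \<beta> (\<Sum>(I, L)\<in>idx \<sigma> \<times> idx n. r y (I, L) *\<^sub>R v \<kappa> I L) (\<Sum>(I, L)\<in>idx \<sigma> \<times> idx n. r y (I, L) *\<^sub>R v \<kappa> I L))"
    if "\<And>I L. v \<kappa> I L \<in> F" for v
    by (rule tnorm_eq_sum_of_squares[where F = F, OF \<beta>(1)]) (use \<beta>(4) r that in auto)
  show ?thesis
    unfolding T[of v, OF v] by (intro real_sqrt_ge_zero sum_nonneg \<beta>(3))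
qed

text \<open>Minkowski's inequality for the fiber norm: passing to the orthonormal frame is linear
  with coefficients independent of \<open>s\<close>, so it commutes with the integral, and the claim
  reduces to a sum of squares.\<close>

lemma tnorm_integral_le:
  fixes g :: "('a,'m::finite) metric" and W :: "('w,'a,'m,'k::{real_normed_field,euclidean_space},'n::finite) vbundle"
  assumes F: "vec.subspace F" "inner_product_on F (hloc W \<kappa> p)"
    and g: "transpose (g \<kappa> p) = g \<kappa> p" "0 < c1"
      "\<And>\<xi>. c1 * (norm \<xi>)\<^sup>2 \<le> \<xi> \<bullet> (g \<kappa> p *v \<xi>)" "\<And>\<xi>. \<xi> \<bullet> (g \<kappa> p *v \<xi>) \<le> c2 * (norm \<xi>)\<^sup>2"
    and k: "integrable N k" "0 < (\<integral>s. \<bar>k s\<bar> \<partial>N)"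
    and v: "\<And>s I L. s \<in> space N \<Longrightarrow> v s \<kappa> I L \<in> F" "\<And>I L. integrable N (\<lambda>s. k s *\<^sub>R v s \<kappa> I L)"
    and w: "\<And>I L. w \<kappa> I L = (\<integral>s. k s *\<^sub>R v s \<kappa> I L \<partial>N)" "\<And>I L. w \<kappa> I L \<in> F"
    and bound: "\<And>s. s \<in> space N \<Longrightarrow> tnorm g W \<sigma> n \<kappa> p (v s) \<le> B" "0 \<le> B"
  shows "tnorm g W \<sigma> n \<kappa> p w \<le> (\<integral>s. \<bar>k s\<bar> \<partial>N) * B"
proof -
  obtain \<beta> where \<beta>: "bilinear \<beta>" "\<And>a b. \<beta> a b = \<beta> b a" "\<And>a. 0 \<le> \<beta> a a"
    "\<And>a b. a \<in> F \<Longrightarrow> b \<in> F \<Longrightarrow> \<beta> a b = re_part (hloc W \<kappa> p a b)"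
    using obtain_real_inner_product[OF F] by blast
  obtain r S :: "'m list \<times> 'm list \<Rightarrow> 'm list \<times> 'm list \<Rightarrow> real" where
    r: "\<And>I L I' L'. (\<Prod>a<\<sigma>. g \<kappa> p $ (I ! a) $ (I' ! a)) * (\<Prod>b<n. matrix_inv (g \<kappa> p) $ (L ! b) $ (L' ! b))
       = (\<Sum>y\<in>idx \<sigma> \<times> idx n. r y (I, L) * r y (I', L'))"
    and "\<And>x x'. x \<in> idx \<sigma> \<times> idx n \<Longrightarrow> x' \<in> idx \<sigma> \<times> idx n \<Longrightarrow>
       (\<Sum>y\<in>idx \<sigma> \<times> idx n. S x y * r y x') = (if x = x' then 1 else 0)"
    and "\<And>x y. \<bar>S x y\<bar> \<le> (1 / sqrt c1) ^ \<sigma> * sqrt c2 ^ n"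
    using obtain_tensor_diagonalization[OF g, of \<sigma> n] by blast
  have T: "tnorm g W \<sigma> n \<kappa> p v = sqrt (\<Sum>y\<in>idx \<sigma> \<times> idx n.
      \<beta> (\<Sum>(I, L)\<in>idx \<sigma> \<times> idx n. r y (I, L) *\<^sub>R v \<kappa> I L) (\<Sum>(I, L)\<in>idx \<sigma> \<times> idx n. r y (I, L) *\<^sub>R v \<kappa> I L))"
    if "\<And>I L. v \<kappa> I L \<in> F" for v
    by (rule tnorm_eq_sum_of_squares[where F = F, OF \<beta>(1)]) (use \<beta>(4) r that in auto)
  let ?X = "idx \<sigma> \<times> idx n :: ('m list \<times> 'm list) set"
  define u where "u s y = (\<Sum>(I, L)\<in>?X. r y (I, L) *\<^sub>R v s \<kappa> I L)" for s y
  have ku: "k s *\<^sub>R u s y = (\<Sum>x\<in>?X. r y x *\<^sub>R (k s *\<^sub>R v s \<kappa> (fst x) (snd x)))" for s y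
    by (simp add: u_def scaleR_sum_right case_prod_unfold mult.commute)
  have int: "integrable N (\<lambda>s. k s *\<^sub>R u s y)" for y
    unfolding ku by (intro Bochner_Integration.integrable_sum integrable_scaleR_right v)
  have uw: "(\<integral>s. k s *\<^sub>R u s y \<partial>N) = (\<Sum>(I, L)\<in>?X. r y (I, L) *\<^sub>R w \<kappa> I L)" for y
    unfolding ku using v(2) by (simp add: Bochner_Integration.integral_sum w(1) case_prod_unfold del: scaleR_scaleR)
  have "(\<Sum>y\<in>?X. \<beta> (\<integral>s. k s *\<^sub>R u s y \<partial>N) (\<integral>s. k s *\<^sub>R u s y \<partial>N)) \<le> (\<integral>s. \<bar>k s\<bar> \<partial>N)\<^sup>2 * B\<^sup>2"
  proof (rule form_integral_le[OF \<beta>(1-3) k int])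
    fix s assume s: "s \<in> space N"
    from bound(1)[OF s] have "sqrt (\<Sum>y\<in>?X. \<beta> (u s y) (u s y)) \<le> B"
      by (simp add: T v(1) s u_def)
    then show "(\<Sum>y\<in>?X. \<beta> (u s y) (u s y)) \<le> B\<^sup>2"
      by (simp add: sqrt_le_D)
  qed
  then show ?thesis
    unfolding T[of w, OF w(2)] uw[symmetric]
    using k(2) bound(2) by (intro real_le_lsqrt) (auto intro!: sum_nonneg \<beta>(3) simp: power_mult_distrib)
qed


subsection \<open>Fibers and partial derivatives\<close>

text \<open>Difference quotients stay in the subspace, which is closed. Applied to the model fiber
  it keeps derivatives in the fiber; applied to \<open>{0}\<close> it keeps the default entries
  0.\<close>

lemma has_vector_derivative_in_subspace:
  fixes f :: "real \<Rightarrow> 'b::euclidean_space"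
  assumes "subspace F" "(f has_vector_derivative D) (at x within S)" "at x within S \<noteq> bot"
    "\<And>y. y \<in> S \<Longrightarrow> f y \<in> F" "x \<in> S"
  shows "D \<in> F"
proof (rule Lim_in_closed_set[OF closed_subspace[OF assms(1)] _ assms(3)])
  show "((\<lambda>y. inverse (y - x) *\<^sub>R (f y - f x)) \<longlongrightarrow> D) (at x within S)"
    using assms(2) by (simp add: has_vector_derivative_within_iff)
  show "\<forall>\<^sub>F y in at x within S. inverse (y - x) *\<^sub>R (f y - f x) \<in> F"
    using assms by (auto simp: eventually_at_filter intro!: always_eventually subspace_scale subspace_diff)
qed

lemma has_vector_derivative_pd:
  assumes "pdiff S l f x"
  shows "((\<lambda>s. f (x + s *\<^sub>R axis l 1)) has_vector_derivative pd S l f x) (at 0 within line_dom S l x)"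
  using assms by (simp add: pdiff_def pd_def vector_derivative_works)

text \<open>\<open>pd\<close> is a derivative at parameter 0 of the line through the base point. For
  the mean value inequality it is needed at all parameters of one fixed line, which is a translation
  of the parameter.\<close>

lemma has_vector_derivative_pd_shift:
  assumes "pdiff S l f (x + y *\<^sub>R axis l 1)"
  shows "((\<lambda>s. f (x + s *\<^sub>R axis l 1)) has_vector_derivative pd S l f (x + y *\<^sub>R axis l 1))
    (at y within line_dom S l x)"
proof -
  have img: "(\<lambda>s. s - y) ` line_dom S l x = line_dom S l (x + y *\<^sub>R axis l 1)"
  proof (intro equalityI subsetI)
    fix s assume "s \<in> line_dom S l (x + y *\<^sub>R axis l 1)"
    then have "s + y \<in> line_dom S l x"
      by (simp add: line_dom_def algebra_simps)
    then show "s \<in> (\<lambda>s. s - y) ` line_dom S l x"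
      by (rule rev_image_eqI) simp
  qed (auto simp: line_dom_def algebra_simps)
  have 1: "((\<lambda>s. s - y) has_vector_derivative 1) (at y within line_dom S l x)"
    by (auto intro!: derivative_eq_intros)
  have 2: "((\<lambda>s. f (x + y *\<^sub>R axis l 1 + s *\<^sub>R axis l 1)) has_vector_derivative pd S l f (x + y *\<^sub>R axis l 1))
     (at (y - y) within (\<lambda>s. s - y) ` line_dom S l x)"
    unfolding img using has_vector_derivative_pd[OF assms] by simp
  show ?thesis
    using vector_diff_chain_within[OF 1 2] by (simp add: o_def algebra_simps)
qed

lemma linear_on_imp_bounded_linear:
  fixes A :: "'k::{real_normed_field,euclidean_space}^'n::finite \<Rightarrow> 'k^'n"
  assumes F: "vec.subspace F" and A: "linear_on F A"
  obtains A' where "bounded_linear A'" "\<And>a. a \<in> F \<Longrightarrow> A' a = A a" "\<And>a. A' a \<in> F"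
proof -
  obtain P where P: "linear P" "\<And>x. P x \<in> F" "\<And>x. x \<in> F \<Longrightarrow> P x = x"
    using obtain_linear_projection[OF subspace_if_vec_subspace[OF F]] by blast
  have "linear (\<lambda>a. A (P a))"
  proof (rule linearI)
    show "A (P (a + b)) = A (P a) + A (P b)" for a b
      using A P(2) by (simp add: linear_add[OF P(1)] linear_on_def)
    have "A (z *s P a) = z *s A (P a)" for z a
      using A P(2) by (simp add: linear_on_def)
    then show "A (P (c *\<^sub>R a)) = c *\<^sub>R A (P a)" for c a
      unfolding linear_scale[OF P(1)] unfolding scaleR_eq_scalar_mult by blast
  qed
  then show ?thesis
    using that[of "\<lambda>a. A (P a)"] P A by (simp add: linear_conv_bounded_linear linear_on_def)
qed

lemma linear_on_0: "linear_on F A \<Longrightarrow> vec.subspace F \<Longrightarrow> A 0 = 0"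
  unfolding linear_on_def by (metis vec.subspace_0 vec.scale_zero_left)

lemma linear_on_diff:
  fixes A :: "'k::{real_normed_field,euclidean_space}^'n::finite \<Rightarrow> 'k^'n"
  assumes "vec.subspace F" "linear_on F A" "a \<in> F" "b \<in> F"
  shows "A (a - b) = A a - A b"
proof -
  obtain A' where A': "bounded_linear A'" "\<And>a. a \<in> F \<Longrightarrow> A' a = A a" "\<And>a. A' a \<in> F"
    using linear_on_imp_bounded_linear[OF assms(1,2)] by blast
  have "a - b \<in> F"
    using assms by (simp add: vec.subspace_diff)
  then show ?thesis
    using bounded_linear.linear[OF A'(1), THEN linear_diff, of a b] A'(2) assms by simp
qed

lemma integral_in_subspace:
  fixes v :: "'x \<Rightarrow> 'b::euclidean_space"
  assumes "subspace F" "\<And>s. s \<in> space N \<Longrightarrow> v s \<in> F"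
  shows "integral\<^sup>L N v \<in> F"
proof (cases "integrable N v")
  case True
  obtain P where P: "linear P" "\<And>x. P x \<in> F" "\<And>x. x \<in> F \<Longrightarrow> P x = x"
    using obtain_linear_projection[OF assms(1)] by blast
  have "integral\<^sup>L N v = (\<integral>s. P (v s) \<partial>N)"
    using P(3) assms(2) by (intro Bochner_Integration.integral_cong) auto
  also have "\<dots> = P (integral\<^sup>L N v)"
    using integral_bounded_linear[of P N v] P(1) True by (simp add: linear_conv_bounded_linear)
  finally show ?thesis
    using P(2) by metis
next
  \<comment> \<open>The integral of a non-integrable function is 0, which lies in the subspace;
    hence no integrability hypothesis in the statement.\<close>
  case False
  then show ?thesis
    using assms(1) by (simp add: not_integrable_integral_eq subspace_0)
qed

lemma linear_on_integral:
  fixes A :: "'k::{real_normed_field,euclidean_space}^'n::finite \<Rightarrow> 'k^'n" and k :: "'x \<Rightarrow> real"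
  assumes F: "vec.subspace F" and A: "linear_on F A"
    and v: "\<And>s. s \<in> space N \<Longrightarrow> v s \<in> F" "integrable N (\<lambda>s. k s *\<^sub>R v s)"
  shows "integrable N (\<lambda>s. k s *\<^sub>R A (v s))"
    and "A (\<integral>s. k s *\<^sub>R v s \<partial>N) = (\<integral>s. k s *\<^sub>R A (v s) \<partial>N)"
proof -
  obtain A' where A': "bounded_linear A'" "\<And>a. a \<in> F \<Longrightarrow> A' a = A a" "\<And>a. A' a \<in> F"
    using linear_on_imp_bounded_linear[OF F A] by blast
  have sub: "subspace F"
    by (rule subspace_if_vec_subspace[OF F])
  have eq: "A' (k s *\<^sub>R v s) = k s *\<^sub>R A (v s)" if "s \<in> space N" for s
    using A' v that by (simp add: linear_scale bounded_linear.linear)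
  have "integrable N (\<lambda>s. A' (k s *\<^sub>R v s))"
    by (rule integrable_bounded_linear[OF A'(1) v(2)])
  then show "integrable N (\<lambda>s. k s *\<^sub>R A (v s))"
    by (subst (asm) Bochner_Integration.integrable_cong[OF refl eq])
  have "(\<integral>s. k s *\<^sub>R A (v s) \<partial>N) = (\<integral>s. A' (k s *\<^sub>R v s) \<partial>N)"
    by (intro Bochner_Integration.integral_cong) (use eq in auto)
  also have "\<dots> = A' (\<integral>s. k s *\<^sub>R v s \<partial>N)"
    by (rule integral_bounded_linear[OF A'(1) v(2)])
  also have "\<dots> = A (\<integral>s. k s *\<^sub>R v s \<partial>N)"
    using v sub by (intro A'(2) integral_in_subspace) (auto intro: subspace_scale)
  finally show "A (\<integral>s. k s *\<^sub>R v s \<partial>N) = (\<integral>s. k s *\<^sub>R A (v s) \<partial>N)"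
    by simp
qed


subsection \<open>Local estimates on singular manifolds\<close>

lemma cube_eq_box: "(cube :: (real^'m::finite) set) = box (\<chi> i. -1) (\<chi> i. 1)"
  by (auto simp: cube_def mem_box_cart abs_less_iff minus_less_iff)

lemma cube_convex: "convex (cube :: (real^'m::finite) set)"
  unfolding cube_eq_box by (rule convex_box)

lemma half_space_convex: "convex (half_space :: (real^'m::{finite,linorder}) set)"
  unfolding half_space_def convex_def by (auto intro: add_nonneg_nonneg)

text \<open>The part of \<open>covd\<close> of order zero. It acts on the component array at a
  single point, so that it can be bounded and exchanged with integrals by algebra alone.\<close>

definition lower_order ::
  "('a,'m::finite) metric \<Rightarrow> ('w,'a,'m,'k::{real_normed_field,euclidean_space},'n::finite) vbundle
   \<Rightarrow> ('a,'m) chart \<Rightarrow> 'a \<Rightarrow> 'm \<Rightarrow> 'm list \<Rightarrow> 'm list \<Rightarrow> ('m list \<Rightarrow> 'm list \<Rightarrow> 'k^'n) \<Rightarrow> 'k^'n" where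
  "lower_order g W \<kappa> p l I L u = Chr W \<kappa> p l (u I L)
     + (\<Sum>a<length I. \<Sum>k\<in>UNIV. christoffel g \<kappa> p (I ! a) l k *\<^sub>R u (I[a := k]) L)
     - (\<Sum>b<length L. \<Sum>k\<in>UNIV. christoffel g \<kappa> p k l (L ! b) *\<^sub>R u I (L[b := k]))"

lemma covd_Cons:
  "\<kappa> \<in> K \<Longrightarrow> p \<in> dom \<kappa> \<Longrightarrow> covd K g W u p \<kappa> I (l # L)
    = pd (ran \<kappa>) l (loc \<kappa> (\<lambda>q. u q \<kappa> I L)) (ch \<kappa> p) + lower_order g W \<kappa> p l I L (u p \<kappa>)"
  by (simp add: lower_order_def)

locale singular_bundle =
  fixes M :: "('a::{metric_space,second_countable_topology}, 'm::{finite,linorder}) sing_mf"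
    and W :: "('w, 'a, 'm, 'k::{real_normed_field,euclidean_space}, 'n::finite) vbundle"
  assumes singular: "singular_manifold M"
    and regular_bundle: "fully_uniformly_regular M W"
begin

abbreviation "K \<equiv> Atlas M"
abbreviation "g \<equiv> Metric M"
abbreviation "\<rho> \<equiv> Weight M"
abbreviation "F \<equiv> MFiber W"

section \<open>Charts, the model fiber and one-sided partial derivatives\<close>

lemma vec_subspace_F: "vec.subspace F"
  using regular_bundle by (simp add: fully_uniformly_regular_def metric_bundle_def)

lemma subspace_F: "subspace F"
  by (rule subspace_if_vec_subspace[OF vec_subspace_F])

lemma zero_in_F [simp]: "0 \<in> F"
  using subspace_F by (simp add: subspace_0)

lemma weight_pos: "0 < \<rho> p"
  using singular by (simp add: singular_manifold_def)

lemma ran_chart: "\<kappa> \<in> K \<Longrightarrow> ran \<kappa> = cube_of K \<kappa>"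
  using singular by (simp add: singular_manifold_def uniformly_regular_atlas_def)

lemma
  assumes "\<kappa> \<in> K"
  shows chinv_ch: "p \<in> dom \<kappa> \<Longrightarrow> chinv \<kappa> (ch \<kappa> p) = p"
    and ch_in_ran: "p \<in> dom \<kappa> \<Longrightarrow> ch \<kappa> p \<in> ran \<kappa>"
    and chinv_in_dom: "x \<in> ran \<kappa> \<Longrightarrow> chinv \<kappa> x \<in> dom \<kappa>"
    and ch_chinv: "x \<in> ran \<kappa> \<Longrightarrow> ch \<kappa> (chinv \<kappa> x) = x"
proof -
  have "homeomorphism (dom \<kappa>) (ran \<kappa>) (ch \<kappa>) (chinv \<kappa>)"
    using singular assms unfolding singular_manifold_def uniformly_regular_atlas_def by blast
  then show "p \<in> dom \<kappa> \<Longrightarrow> chinv \<kappa> (ch \<kappa> p) = p" "p \<in> dom \<kappa> \<Longrightarrow> ch \<kappa> p \<in> ran \<kappa>"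
    "x \<in> ran \<kappa> \<Longrightarrow> chinv \<kappa> x \<in> dom \<kappa>" "x \<in> ran \<kappa> \<Longrightarrow> ch \<kappa> (chinv \<kappa> x) = x"
    unfolding homeomorphism_def by blast+
qed

lemma convex_ran: "\<kappa> \<in> K \<Longrightarrow> convex (ran \<kappa>)"
  by (simp add: ran_chart cube_of_def cube_convex half_space_convex convex_Int)

text \<open>Differentiation under the integral uses a mean value inequality along coordinate lines;
  it is available because patches are mapped onto a cube or half of one.\<close>

lemma convex_line_dom:
  assumes "\<kappa> \<in> K" shows "convex (line_dom (ran \<kappa>) l x)"
proof -
  have "line_dom (ran \<kappa>) l x = (\<lambda>s. s *\<^sub>R axis l 1) -` ((\<lambda>z. z - x) ` ran \<kappa>)"
    by (auto simp: line_dom_def image_iff algebra_simps)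
  moreover have "convex ((\<lambda>z. z - x) ` ran \<kappa>)"
    using convex_ran[OF assms] by (simp add: convex_translation_subtract)
  moreover have "linear (\<lambda>s. s *\<^sub>R axis l (1::real))"
    by (simp add: linear_scale_left)
  ultimately show ?thesis
    by (simp add: convex_linear_vimage)
qed

text \<open>Makes one-sided derivatives unique. Moving in a positive coordinate direction stays in
  the cube for parameters below \<open>1 - x $ l\<close> and never leaves the half-space, so
  boundary points need no separate treatment.\<close>

lemma line_dom_not_bot:
  assumes "\<kappa> \<in> K" "x \<in> ran \<kappa>" shows "at 0 within line_dom (ran \<kappa>) l x \<noteq> bot"
proof -
  have x: "\<bar>x $ i\<bar> < 1" for i
    using assms by (auto simp: ran_chart cube_of_def cube_def split: if_splits)
  have "{0..<1 - x $ l} \<subseteq> line_dom (ran \<kappa>) l x"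
  proof
    fix s assume s: "s \<in> {0..<1 - x $ l}"
    have "\<bar>(x + s *\<^sub>R axis l 1) $ i\<bar> < 1" for i
      using x[of i] s by (auto simp: axis_def abs_less_iff)
    moreover have "x $ i \<le> (x + s *\<^sub>R axis l 1) $ i" for i
      using s by (auto simp: axis_def)
    ultimately show "s \<in> line_dom (ran \<kappa>) l x"
      using assms by (auto simp: line_dom_def ran_chart cube_of_def cube_def half_space_def
        split: if_splits intro: order_trans)
  qed
  then have "at 0 within {0..<1 - x $ l} \<le> at 0 within line_dom (ran \<kappa>) l x"
    by (rule at_le)
  moreover have "at 0 within {0..<1 - x $ l} \<noteq> bot"
    using x[of l] by (simp add: trivial_limit_within islimpt_Ico abs_less_iff)
  ultimately show ?thesis
    by (metis bot.extremum_uniqueI)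
qed

lemma pd_eqI:
  assumes "\<kappa> \<in> K" "x \<in> ran \<kappa>"
    "((\<lambda>s. f (x + s *\<^sub>R axis l 1)) has_vector_derivative D) (at 0 within line_dom (ran \<kappa>) l x)"
  shows "pd (ran \<kappa>) l f x = D"
  unfolding pd_def by (rule vector_derivative_within[OF line_dom_not_bot[OF assms(1,2)] assms(3)])

section \<open>Bounds for the metric, the fiber norm and the Christoffel symbols on a patch\<close>

lemma metric_symmetric: "\<kappa> \<in> K \<Longrightarrow> p \<in> dom \<kappa> \<Longrightarrow> transpose (g \<kappa> p) = g \<kappa> p"
  using singular by (simp add: singular_manifold_def riemannian_metric_def)

text \<open>Regularity bounds \<open>g\<close> only after division by the squared weight. On one
  patch the weight is comparable to its value at the centre, so bounds for \<open>g\<close> itself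
  follow, with constants depending on the chart.\<close>

lemma metric_bounds:
  assumes "\<kappa> \<in> K"
  obtains c1 c2 where "0 < c1" "\<And>p \<xi>. p \<in> dom \<kappa> \<Longrightarrow> c1 * (norm \<xi>)\<^sup>2 \<le> \<xi> \<bullet> (g \<kappa> p *v \<xi>)"
    "\<And>p \<xi>. p \<in> dom \<kappa> \<Longrightarrow> \<xi> \<bullet> (g \<kappa> p *v \<xi>) \<le> c2 * (norm \<xi>)\<^sup>2"
proof -
  obtain c where c: "1 \<le> c" and g: "\<And>p \<xi>. p \<in> dom \<kappa> \<Longrightarrow>
      (norm \<xi>)\<^sup>2 / c \<le> \<xi> \<bullet> (((1 / (\<rho> p)\<^sup>2) *\<^sub>R g \<kappa> p) *v \<xi>) \<and>
      \<xi> \<bullet> (((1 / (\<rho> p)\<^sup>2) *\<^sub>R g \<kappa> p) *v \<xi>) \<le> c * (norm \<xi>)\<^sup>2"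
    using singular assms unfolding singular_manifold_def uniformly_regular_riemannian_def by blast
  obtain d where d: "1 \<le> d" and \<rho>: "\<And>p. p \<in> dom \<kappa> \<Longrightarrow>
      \<rho> (chinv \<kappa> 0) / d \<le> \<rho> p \<and> \<rho> p \<le> d * \<rho> (chinv \<kappa> 0)"
    using singular assms unfolding singular_manifold_def by blast
  let ?r = "\<rho> (chinv \<kappa> 0)"
  have r: "0 < ?r"
    by (rule weight_pos)
  have g': "(\<rho> p)\<^sup>2 * ((norm \<xi>)\<^sup>2 / c) \<le> \<xi> \<bullet> (g \<kappa> p *v \<xi>)" "\<xi> \<bullet> (g \<kappa> p *v \<xi>) \<le> (\<rho> p)\<^sup>2 * (c * (norm \<xi>)\<^sup>2)"
    if "p \<in> dom \<kappa>" for p \<xi>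
  proof -
    have "\<xi> \<bullet> (((1 / (\<rho> p)\<^sup>2) *\<^sub>R g \<kappa> p) *v \<xi>) = (\<xi> \<bullet> (g \<kappa> p *v \<xi>)) / (\<rho> p)\<^sup>2"
      by (simp add: scaleR_matrix_vector_assoc[symmetric])
    moreover have "0 < (\<rho> p)\<^sup>2"
      using weight_pos[of p] by simp
    ultimately show "(\<rho> p)\<^sup>2 * ((norm \<xi>)\<^sup>2 / c) \<le> \<xi> \<bullet> (g \<kappa> p *v \<xi>)" "\<xi> \<bullet> (g \<kappa> p *v \<xi>) \<le> (\<rho> p)\<^sup>2 * (c * (norm \<xi>)\<^sup>2)"
      using g[OF that, of \<xi>] by (simp_all add: pos_le_divide_eq pos_divide_le_eq mult.commute)
  qed
  show thesis
  proof (rule that)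
    show "0 < (?r / d)\<^sup>2 / c"
      using r c d by simp
    fix p and \<xi> :: "(real, 'm) vec" assume p: "p \<in> dom \<kappa>"
    have "(?r / d)\<^sup>2 \<le> (\<rho> p)\<^sup>2" "(\<rho> p)\<^sup>2 \<le> (d * ?r)\<^sup>2"
      using \<rho>[OF p] r d weight_pos[of p] by (auto intro!: power_mono)
    moreover have "0 \<le> (norm \<xi>)\<^sup>2 / c" "0 \<le> c * (norm \<xi>)\<^sup>2"
      using c by simp_all
    ultimately have "(?r / d)\<^sup>2 * ((norm \<xi>)\<^sup>2 / c) \<le> (\<rho> p)\<^sup>2 * ((norm \<xi>)\<^sup>2 / c)"
      "(\<rho> p)\<^sup>2 * (c * (norm \<xi>)\<^sup>2) \<le> (d * ?r)\<^sup>2 * (c * (norm \<xi>)\<^sup>2)"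
      by (blast intro: mult_right_mono)+
    moreover have "(?r / d)\<^sup>2 / c * (norm \<xi>)\<^sup>2 = (?r / d)\<^sup>2 * ((norm \<xi>)\<^sup>2 / c)"
      "((d * ?r)\<^sup>2 * c) * (norm \<xi>)\<^sup>2 = (d * ?r)\<^sup>2 * (c * (norm \<xi>)\<^sup>2)"
      by simp_all
    ultimately show "(?r / d)\<^sup>2 / c * (norm \<xi>)\<^sup>2 \<le> \<xi> \<bullet> (g \<kappa> p *v \<xi>)"
      "\<xi> \<bullet> (g \<kappa> p *v \<xi>) \<le> ((d * ?r)\<^sup>2 * c) * (norm \<xi>)\<^sup>2"
      using g'[OF p, of \<xi>] by linarith+
  qed
qed

lemma inner_product_hloc: "\<kappa> \<in> K \<Longrightarrow> p \<in> dom \<kappa> \<Longrightarrow> inner_product_on F (hloc W \<kappa> p)"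
  using regular_bundle by (simp add: fully_uniformly_regular_def metric_bundle_def)

lemma norm_le_tnorm:
  assumes "\<kappa> \<in> K"
  obtains C where "0 \<le> C" "\<And>p v I L. p \<in> dom \<kappa> \<Longrightarrow> (\<And>I L. v \<kappa> I L \<in> F) \<Longrightarrow> I \<in> idx \<sigma> \<Longrightarrow> L \<in> idx n
    \<Longrightarrow> norm (v \<kappa> I L) \<le> C * tnorm g W \<sigma> n \<kappa> p v"
proof -
  obtain c1 c2 where c: "0 < c1" "\<And>p \<xi>. p \<in> dom \<kappa> \<Longrightarrow> c1 * (norm \<xi>)\<^sup>2 \<le> \<xi> \<bullet> (g \<kappa> p *v \<xi>)"
    "\<And>p \<xi>. p \<in> dom \<kappa> \<Longrightarrow> \<xi> \<bullet> (g \<kappa> p *v \<xi>) \<le> c2 * (norm \<xi>)\<^sup>2"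
    using metric_bounds[OF assms] by blast
  obtain c where "1 \<le> c" and h: "\<And>p a. p \<in> dom \<kappa> \<Longrightarrow> a \<in> F \<Longrightarrow> (norm a)\<^sup>2 / c \<le> re_part (hloc W \<kappa> p a a)"
  proof -
    have "\<exists>c\<ge>1. \<forall>\<kappa>\<in>K. \<forall>p\<in>dom \<kappa>. \<forall>a\<in>F.
        (norm a)\<^sup>2 / c \<le> re_part (hloc W \<kappa> p a a) \<and> re_part (hloc W \<kappa> p a a) \<le> c * (norm a)\<^sup>2"
      using regular_bundle unfolding fully_uniformly_regular_def by (elim conjE)
    then show ?thesis
      using that assms by blast
  qed
  let ?C = "real (card (idx \<sigma> \<times> idx n :: ('m list \<times> 'm list) set))
    * ((1 / sqrt c1) ^ \<sigma> * sqrt c2 ^ n * sqrt c)"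
  have C: "norm (v \<kappa> I L) \<le> ?C * tnorm g W \<sigma> n \<kappa> p v"
    if "p \<in> dom \<kappa>" "\<And>I L. v \<kappa> I L \<in> F" "I \<in> idx \<sigma>" "L \<in> idx n" for p v I L
    using \<open>1 \<le> c\<close>
    by (intro norm_component_le_tnorm[where v = v and g = g and \<kappa> = \<kappa> and p = p and W = W and F = F, OF vec_subspace_F inner_product_hloc[OF assms that(1)] _ h[OF that(1)]
      metric_symmetric[OF assms that(1)] c(1) c(2)[OF that(1)] c(3)[OF that(1)] that(2-4)]) auto
  show thesis
  proof (rule that)
    fix p and I L :: "'m list" and v :: "('a,'m,'k,'n) tensor"
    assume *: "p \<in> dom \<kappa>" "\<And>I L. v \<kappa> I L \<in> F" "I \<in> idx \<sigma>" "L \<in> idx n"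
    \<comment> \<open>The sign of \<open>c2\<close>, hence of \<open>?C\<close>, is not recorded.
      Nonnegativity of the norm permits replacing \<open>?C\<close> by its absolute value.\<close>
    have "0 \<le> tnorm g W \<sigma> n \<kappa> p v"
      by (rule tnorm_nonneg[where v = v and g = g and \<kappa> = \<kappa> and p = p and W = W and F = F, OF vec_subspace_F inner_product_hloc[OF assms *(1)]
        metric_symmetric[OF assms *(1)] c(1) c(2)[OF *(1)] c(3)[OF *(1)] *(2)])
    then have "?C * tnorm g W \<sigma> n \<kappa> p v \<le> \<bar>?C\<bar> * tnorm g W \<sigma> n \<kappa> p v"
      by (intro mult_right_mono) auto
    moreover have "norm (v \<kappa> I L) \<le> ?C * tnorm g W \<sigma> n \<kappa> p v"
      by (rule C) (use * in auto)
    ultimately show "norm (v \<kappa> I L) \<le> \<bar>?C\<bar> * tnorm g W \<sigma> n \<kappa> p v"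
      by linarith
  qed simp
qed

lemma tnorm_integral:
  fixes k :: "'x \<Rightarrow> real"
  assumes "\<kappa> \<in> K" "p \<in> dom \<kappa>"
    and k: "integrable N k" "0 < (\<integral>s. \<bar>k s\<bar> \<partial>N)"
    and v: "\<And>s I L. s \<in> space N \<Longrightarrow> v s \<kappa> I L \<in> F" "\<And>I L. integrable N (\<lambda>s. k s *\<^sub>R v s \<kappa> I L)"
    and w: "\<And>I L. w \<kappa> I L = (\<integral>s. k s *\<^sub>R v s \<kappa> I L \<partial>N)"
    and bound: "\<And>s. s \<in> space N \<Longrightarrow> tnorm g W \<sigma> n \<kappa> p (v s) \<le> B" "0 \<le> B"
  shows "tnorm g W \<sigma> n \<kappa> p w \<le> (\<integral>s. \<bar>k s\<bar> \<partial>N) * B"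
proof -
  obtain c1 c2 where c: "0 < c1" "\<And>p \<xi>. p \<in> dom \<kappa> \<Longrightarrow> c1 * (norm \<xi>)\<^sup>2 \<le> \<xi> \<bullet> (g \<kappa> p *v \<xi>)"
    "\<And>p \<xi>. p \<in> dom \<kappa> \<Longrightarrow> \<xi> \<bullet> (g \<kappa> p *v \<xi>) \<le> c2 * (norm \<xi>)\<^sup>2"
    using metric_bounds[OF assms(1)] by blast
  have wF: "w \<kappa> I L \<in> F" for I L
    unfolding w using v subspace_F by (intro integral_in_subspace) (auto intro: subspace_scale)
  show ?thesis
    by (rule tnorm_integral_le[where v = v and w = w and g = g and \<kappa> = \<kappa> and p = p and W = W and F = F, OF vec_subspace_F inner_product_hloc[OF assms(1,2)] metric_symmetric[OF assms(1,2)]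
      c(1) c(2)[OF assms(2)] c(3)[OF assms(2)] k]) (use v w wF bound in auto)
qed

text \<open>The inverse metric is bounded on the whole patch by diagonalization, and the first
  derivatives of the metric near \<open>x0\<close> by continuity. A local bound is enough, as it is
  used to differentiate at the single point \<open>x0\<close>.\<close>

lemma christoffel_locally_bounded:
  assumes "\<kappa> \<in> K" "x0 \<in> ran \<kappa>"
  obtains \<delta> C where "0 < \<delta>" "\<And>x i j k. x \<in> ran \<kappa> \<Longrightarrow> dist x x0 < \<delta> \<Longrightarrow> \<bar>christoffel g \<kappa> (chinv \<kappa> x) k i j\<bar> \<le> C"
proof -
  obtain c1 c2 where c: "0 < c1" "\<And>p \<xi>. p \<in> dom \<kappa> \<Longrightarrow> c1 * (norm \<xi>)\<^sup>2 \<le> \<xi> \<bullet> (g \<kappa> p *v \<xi>)"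
    "\<And>p \<xi>. p \<in> dom \<kappa> \<Longrightarrow> \<xi> \<bullet> (g \<kappa> p *v \<xi>) \<le> c2 * (norm \<xi>)\<^sup>2"
    using metric_bounds[OF assms(1)] by blast
  \<comment> \<open>An entry of \<open>E ** transpose E\<close> is a sum of \<open>CARD('m)\<close>
    products of two entries of \<open>E\<close>.\<close>
  let ?B1 = "real CARD('m) * (1 / sqrt c1 * (1 / sqrt c1))"
  have inv: "\<bar>matrix_inv (g \<kappa> p) $ i $ j\<bar> \<le> ?B1" if p: "p \<in> dom \<kappa>" for p i j
  proof (rule form_diagonalization[OF metric_symmetric[OF assms(1) p] c(1) c(2)[OF p] c(3)[OF p]])
    fix E :: "((real, 'm) vec, 'm) vec"
    assume Ginv: "matrix_inv (g \<kappa> p) = E ** transpose E" and E: "\<And>i j. \<bar>E $ i $ j\<bar> \<le> 1 / sqrt c1"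
    have EE: "\<bar>E $ i $ k * E $ j $ k\<bar> \<le> 1 / sqrt c1 * (1 / sqrt c1)" for k
      unfolding abs_mult by (rule mult_mono[OF E E]) (use c(1) in simp_all)
    have "\<bar>\<Sum>k\<in>UNIV. E $ i $ k * E $ j $ k\<bar> \<le> (\<Sum>k\<in>(UNIV::'m set). \<bar>E $ i $ k * E $ j $ k\<bar>)"
      by (rule sum_abs)
    also have "\<dots> \<le> (\<Sum>k\<in>(UNIV::'m set). 1 / sqrt c1 * (1 / sqrt c1))"
      by (rule sum_mono[OF EE])
    finally have "\<bar>\<Sum>k\<in>UNIV. E $ i $ k * E $ j $ k\<bar> \<le> (\<Sum>k\<in>(UNIV::'m set). 1 / sqrt c1 * (1 / sqrt c1))" .
    then show ?thesis
      by (simp add: Ginv matrix_matrix_mult_def transpose_def)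
  qed
  have smooth: "smooth_on (ran \<kappa>) (loc \<kappa> (g \<kappa>))"
    using singular assms(1) by (simp add: singular_manifold_def riemannian_metric_def)
  let ?d = "\<lambda>l. pd (ran \<kappa>) l (loc \<kappa> (g \<kappa>))"
  have comp: "pd (ran \<kappa>) l (\<lambda>x. loc \<kappa> (g \<kappa>) x $ i $ j) x = ?d l x $ i $ j" if "x \<in> ran \<kappa>" for l i j x
  proof (rule pd_eqI[OF assms(1) that])
    have "bounded_linear (\<lambda>A::((real, 'm) vec, 'm) vec. A $ i $ j)"
      by (intro bounded_linear_compose[OF bounded_linear_vec_nth, of "\<lambda>A. A $ i", unfolded o_def] bounded_linear_vec_nth)
    moreover have "pdiff (ran \<kappa>) l (loc \<kappa> (g \<kappa>)) x"
      using smooth that unfolding smooth_on_def by (metis pds.simps(1))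
    ultimately show "((\<lambda>s. loc \<kappa> (g \<kappa>) (x + s *\<^sub>R axis l 1) $ i $ j) has_vector_derivative ?d l x $ i $ j)
      (at 0 within line_dom (ran \<kappa>) l x)"
      by (intro bounded_linear.has_vector_derivative[where f = "\<lambda>A. A $ i $ j"] has_vector_derivative_pd)
  qed
  have "\<forall>l. \<forall>\<^sub>F x in at x0 within ran \<kappa>. norm (?d l x) < norm (?d l x0) + 1"
  proof
    fix l
    have "continuous_on (ran \<kappa>) (?d l)"
      using smooth unfolding smooth_on_def by (metis pds.simps)
    then have "((\<lambda>x. norm (?d l x)) \<longlongrightarrow> norm (?d l x0)) (at x0 within ran \<kappa>)"
      using assms(2) by (auto simp: continuous_on intro: tendsto_norm)
    then show "\<forall>\<^sub>F x in at x0 within ran \<kappa>. norm (?d l x) < norm (?d l x0) + 1"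
      by (rule order_tendstoD) simp
  qed
  then have "\<forall>\<^sub>F x in at x0 within ran \<kappa>. \<forall>l. norm (?d l x) < norm (?d l x0) + 1"
    by (simp add: eventually_all_finite)
  then obtain \<delta> where \<delta>: "0 < \<delta>" "\<And>x l. x \<in> ran \<kappa> \<Longrightarrow> x \<noteq> x0 \<Longrightarrow> dist x x0 < \<delta> \<Longrightarrow> norm (?d l x) < norm (?d l x0) + 1"
    unfolding eventually_at by metis
  \<comment> \<open>The sum serves all directions at once, and 1 is the margin left by continuity.
    The neighbourhood above is punctured, so the point \<open>x0\<close> is a separate case
    below.\<close>
  define B2 where "B2 = (\<Sum>l\<in>UNIV. norm (?d l x0)) + 1"
  have d: "\<bar>?d l x $ i $ j\<bar> \<le> B2" if "x \<in> ran \<kappa>" "dist x x0 < \<delta>" for l x i j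
  proof -
    have "\<bar>?d l x $ i $ j\<bar> \<le> norm (?d l x)"
      by (metis component_le_norm_cart Finite_Cartesian_Product.norm_nth_le order_trans)
    also have "\<dots> \<le> norm (?d l x0) + 1"
      using \<delta>(2)[of x l] that by (cases "x = x0") auto
    also have "\<dots> \<le> B2"
      unfolding B2_def using member_le_sum[of l UNIV "\<lambda>l. norm (?d l x0)"] by simp
    finally show ?thesis .
  qed
  show thesis
  proof (rule that[OF \<delta>(1)])
    fix x i j k assume x: "x \<in> ran \<kappa>" "dist x x0 < \<delta>"
    have p: "chinv \<kappa> x \<in> dom \<kappa>" "ch \<kappa> (chinv \<kappa> x) = x"
      using assms(1) x(1) by (auto simp: chinv_in_dom ch_chinv)
    have "\<bar>christoffel g \<kappa> (chinv \<kappa> x) k i j\<bar>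
        = 1/2 * \<bar>\<Sum>l\<in>UNIV. matrix_inv (g \<kappa> (chinv \<kappa> x)) $ k $ l * (?d i x $ j $ l + ?d j x $ i $ l - ?d l x $ i $ j)\<bar>"
      by (simp add: christoffel_def Let_def p(2) comp[OF x(1)] abs_mult)
    also have "\<dots> \<le> 1/2 * (\<Sum>l\<in>(UNIV::'m set). ?B1 * (3 * B2))"
    proof (intro mult_left_mono order_trans[OF sum_abs] sum_mono)
      fix l
      have "\<bar>?d i x $ j $ l + ?d j x $ i $ l - ?d l x $ i $ j\<bar> \<le> 3 * B2"
        using d[OF x, of i j l] d[OF x, of j i l] d[OF x, of l i j] by linarith
      then show "\<bar>matrix_inv (g \<kappa> (chinv \<kappa> x)) $ k $ l * (?d i x $ j $ l + ?d j x $ i $ l - ?d l x $ i $ j)\<bar> \<le> ?B1 * (3 * B2)"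
        unfolding abs_mult by (intro mult_mono inv[OF p(1)]) (use order_trans[OF abs_ge_zero inv[OF p(1)]] in auto)
    qed simp
    finally show "\<bar>christoffel g \<kappa> (chinv \<kappa> x) k i j\<bar> \<le> 1/2 * (\<Sum>l\<in>(UNIV::'m set). ?B1 * (3 * B2))" .
  qed
qed

section \<open>The terms of order zero: linearity, integrals and local bounds\<close>

lemma Chr_linear: "\<kappa> \<in> K \<Longrightarrow> p \<in> dom \<kappa> \<Longrightarrow> linear_on F (Chr W \<kappa> p l)"
  using regular_bundle
  by (simp add: fully_uniformly_regular_def metric_connection_def connection_def)

lemma Chr_bounded:
  obtains c where "\<And>\<kappa> p l a. \<kappa> \<in> K \<Longrightarrow> p \<in> dom \<kappa> \<Longrightarrow> a \<in> F \<Longrightarrow> norm (Chr W \<kappa> p l a) \<le> c * norm a"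
proof -
  obtain c where c: "\<And>\<kappa> l a. \<kappa> \<in> K \<Longrightarrow> a \<in> F \<Longrightarrow>
      derivs_le 0 (c * norm a) (ran \<kappa>) (loc \<kappa> (\<lambda>p. Chr W \<kappa> p l a))"
  proof -
    have "\<forall>k. \<exists>c. \<forall>\<kappa>\<in>K. \<forall>l. \<forall>a\<in>F. derivs_le k (c * norm a) (ran \<kappa>) (loc \<kappa> (\<lambda>p. Chr W \<kappa> p l a))"
      using regular_bundle unfolding fully_uniformly_regular_def by (elim conjE)
    then show ?thesis
      using that by blast
  qed
  have "norm (Chr W \<kappa> p l a) \<le> c * norm a" if "\<kappa> \<in> K" "p \<in> dom \<kappa>" "a \<in> F" for \<kappa> p l a
    using c[OF that(1,3), of l] ch_in_ran[OF that(1,2)]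
    by (auto simp: derivs_le_def loc_def chinv_ch[OF that(1,2)] dest!: bspec)
  then show ?thesis
    using that by blast
qed

lemma lower_order_in_F:
  assumes "\<kappa> \<in> K" "p \<in> dom \<kappa>" "\<And>I L. u I L \<in> F"
  shows "lower_order g W \<kappa> p l I L u \<in> F"
  unfolding lower_order_def
  using assms Chr_linear[OF assms(1,2), of l] subspace_F
  by (auto simp: linear_on_def intro!: subspace_add subspace_diff subspace_sum subspace_scale)

lemma lower_order_diff:
  fixes u v :: "'m list \<Rightarrow> 'm list \<Rightarrow> 'k^'n"
  assumes "\<kappa> \<in> K" "p \<in> dom \<kappa>" "\<And>I L. u I L \<in> F" "\<And>I L. v I L \<in> F"
  shows "lower_order g W \<kappa> p l I L (u - v) = lower_order g W \<kappa> p l I L u - lower_order g W \<kappa> p l I L v"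
  unfolding lower_order_def
  using linear_on_diff[OF vec_subspace_F Chr_linear[OF assms(1,2), of l] assms(3,4)]
  by (simp add: scaleR_diff_right sum_subtractf)

lemma lower_order_integral:
  fixes k :: "'x \<Rightarrow> real" and v :: "'x \<Rightarrow> 'm list \<Rightarrow> 'm list \<Rightarrow> 'k^'n"
  assumes "\<kappa> \<in> K" "p \<in> dom \<kappa>" "\<And>s I L. s \<in> space N \<Longrightarrow> v s I L \<in> F"
    "\<And>I L. integrable N (\<lambda>s. k s *\<^sub>R v s I L)"
  shows "integrable N (\<lambda>s. k s *\<^sub>R lower_order g W \<kappa> p l I L (v s))"
    and "lower_order g W \<kappa> p l I L (\<lambda>I L. \<integral>s. k s *\<^sub>R v s I L \<partial>N)
      = (\<integral>s. k s *\<^sub>R lower_order g W \<kappa> p l I L (v s) \<partial>N)"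
proof -
  note chr = linear_on_integral[OF vec_subspace_F Chr_linear[OF assms(1,2), of l] assms(3) assms(4), of I L]
  have eq: "k s *\<^sub>R lower_order g W \<kappa> p l I L (v s) = k s *\<^sub>R Chr W \<kappa> p l (v s I L)
     + (\<Sum>a<length I. \<Sum>j\<in>UNIV. christoffel g \<kappa> p (I ! a) l j *\<^sub>R (k s *\<^sub>R v s (I[a := j]) L))
     - (\<Sum>b<length L. \<Sum>j\<in>UNIV. christoffel g \<kappa> p j l (L ! b) *\<^sub>R (k s *\<^sub>R v s I (L[b := j])))" for s
    by (simp add: lower_order_def scaleR_diff_right scaleR_add_right scaleR_sum_right mult.commute)
  show "integrable N (\<lambda>s. k s *\<^sub>R lower_order g W \<kappa> p l I L (v s))"
    unfolding eq using assms(4) chr(1)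
    by (intro Bochner_Integration.integrable_add Bochner_Integration.integrable_diff
        Bochner_Integration.integrable_sum integrable_scaleR_right) auto
  show "lower_order g W \<kappa> p l I L (\<lambda>I L. \<integral>s. k s *\<^sub>R v s I L \<partial>N)
      = (\<integral>s. k s *\<^sub>R lower_order g W \<kappa> p l I L (v s) \<partial>N)"
    unfolding eq using assms(4) chr
    by (simp add: lower_order_def Bochner_Integration.integral_sum del: scaleR_scaleR)
qed

text \<open>\<open>C\<close> depends on the array only through the bound \<open>B\<close>, so one
  constant serves an evolution at all times simultaneously.\<close>

lemma lower_order_locally_bounded:
  assumes "\<kappa> \<in> K" "x0 \<in> ran \<kappa>"
  obtains \<delta> C where "0 < \<delta>" "\<And>x u. x \<in> ran \<kappa> \<Longrightarrow> dist x x0 < \<delta> \<Longrightarrow> (\<And>I L. u I L \<in> F) \<Longrightarrow>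
     (\<And>I L. norm (u I L) \<le> B) \<Longrightarrow> norm (lower_order g W \<kappa> (chinv \<kappa> x) l I L u) \<le> C"
proof -
  obtain \<delta> C where \<delta>: "0 < \<delta>" and
    C: "\<And>x i j k. x \<in> ran \<kappa> \<Longrightarrow> dist x x0 < \<delta> \<Longrightarrow> \<bar>christoffel g \<kappa> (chinv \<kappa> x) k i j\<bar> \<le> C"
    using christoffel_locally_bounded[OF assms] by metis
  obtain c where c: "\<And>\<kappa> p l a. \<kappa> \<in> K \<Longrightarrow> p \<in> dom \<kappa> \<Longrightarrow> a \<in> F \<Longrightarrow> norm (Chr W \<kappa> p l a) \<le> c * norm a"
    using Chr_bounded by blast
  let ?C = "\<bar>c\<bar> * B + (\<Sum>a<length I. \<Sum>k\<in>(UNIV::'m set). C * B) + (\<Sum>b<length L. \<Sum>k\<in>(UNIV::'m set). C * B)"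
  show thesis
  proof (rule that[OF \<delta>])
    fix x and u :: "'m list \<Rightarrow> 'm list \<Rightarrow> 'k^'n"
    assume x: "x \<in> ran \<kappa>" "dist x x0 < \<delta>" and u: "\<And>I L. u I L \<in> F" "\<And>I L. norm (u I L) \<le> B"
    have p: "chinv \<kappa> x \<in> dom \<kappa>"
      using assms(1) x(1) by (rule chinv_in_dom)
    have "norm (Chr W \<kappa> (chinv \<kappa> x) l (u I L)) \<le> \<bar>c\<bar> * B"
      by (rule order_trans[OF c[OF assms(1) p u(1)]], rule order_trans[OF mult_right_mono[of c "\<bar>c\<bar>"]])
        (auto intro!: mult_left_mono u)
    moreover have 1: "norm (christoffel g \<kappa> (chinv \<kappa> x) i j k *\<^sub>R u I L) \<le> C * B" for i j k I L
      unfolding norm_scaleR by (intro mult_mono C[OF x] u) (use order_trans[OF abs_ge_zero C[OF x]] in auto)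
    moreover have "norm (\<Sum>a<length I. \<Sum>k\<in>UNIV. christoffel g \<kappa> (chinv \<kappa> x) (I ! a) l k *\<^sub>R u (I[a := k]) L)
        \<le> (\<Sum>a<length I. \<Sum>k\<in>(UNIV::'m set). C * B)"
      by (intro sum_norm_le 1)
    moreover have "norm (\<Sum>b<length L. \<Sum>k\<in>UNIV. christoffel g \<kappa> (chinv \<kappa> x) k l (L ! b) *\<^sub>R u I (L[b := k]))
        \<le> (\<Sum>b<length L. \<Sum>k\<in>(UNIV::'m set). C * B)"
      by (intro sum_norm_le 1)
    ultimately show "norm (lower_order g W \<kappa> (chinv \<kappa> x) l I L u) \<le> ?C"
      unfolding lower_order_def by (intro norm_triangle_le_diff norm_triangle_le add_mono)
  qed
qed

end


subsection \<open>Commuting the extension with derivatives\<close>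

text \<open>The functions on which the reflected integrals are genuine rather than the default 0;
  here \<open>e_plus h\<close> is linear.\<close>

definition extension_integrable ::
  "(real \<Rightarrow> real) \<Rightarrow> ('a,'m::finite,'k::{real_normed_field,euclidean_space},'n::finite) evol \<Rightarrow> bool" where
  "extension_integrable h v \<longleftrightarrow>
     (\<forall>t\<le>0. \<forall>p \<kappa> I L. integrable half_line (\<lambda>s. h s *\<^sub>R v (- s * t) p \<kappa> I L))"

context singular_bundle
begin

text \<open>\<open>tensor_fiber\<close> without the transformation law. Unlike the law, this part
  passes to derivatives by a computation in one chart, and the estimates for derivatives use nothing
  more.\<close>

definition bundle_array :: "nat \<Rightarrow> nat \<Rightarrow> 'a \<Rightarrow> ('a,'m,'k,'n) tensor \<Rightarrow> bool" where
  "bundle_array \<sigma> n p v \<longleftrightarrow>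
     (\<forall>\<kappa> I L. if \<kappa> \<in> K \<and> p \<in> dom \<kappa> \<and> I \<in> idx \<sigma> \<and> L \<in> idx n then v \<kappa> I L \<in> F else v \<kappa> I L = 0)"

lemma bundle_array_in_F: "bundle_array \<sigma> n p v \<Longrightarrow> v \<kappa> I L \<in> F"
  unfolding bundle_array_def by (metis zero_in_F)

lemma bundle_array_eq_0:
  "bundle_array \<sigma> n p v \<Longrightarrow> \<not> (\<kappa> \<in> K \<and> p \<in> dom \<kappa> \<and> I \<in> idx \<sigma> \<and> L \<in> idx n) \<Longrightarrow> v \<kappa> I L = 0"
  unfolding bundle_array_def by metis

text \<open>What integration against a kernel requires: continuity, and a bound uniform in time on
  each patch. The bound may vary with the chart because the global norms are weighted.\<close>

definition regular_evol :: "nat \<Rightarrow> nat \<Rightarrow> ('a,'m,'k,'n) evol \<Rightarrow> bool" where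
  "regular_evol \<sigma> n w \<longleftrightarrow> (\<forall>t\<ge>0. \<forall>p. bundle_array \<sigma> n p (w t p)) \<and> continuous_evol K {0..} w \<and>
     (\<forall>\<kappa>\<in>K. \<exists>B. \<forall>t\<ge>0. \<forall>p\<in>dom \<kappa>. \<forall>I L. norm (w t p \<kappa> I L) \<le> B)"

lemma regular_evol_array: "regular_evol \<sigma> n w \<Longrightarrow> 0 \<le> t \<Longrightarrow> bundle_array \<sigma> n p (w t p)"
  by (simp add: regular_evol_def)

lemma regular_evol_in_F: "regular_evol \<sigma> n w \<Longrightarrow> 0 \<le> t \<Longrightarrow> w t p \<kappa> I L \<in> F"
  by (rule bundle_array_in_F[OF regular_evol_array])

lemma regular_evol_bound:
  assumes "regular_evol \<sigma> n w" "\<kappa> \<in> K"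
  obtains B where "\<And>t p I L. 0 \<le> t \<Longrightarrow> norm (w t p \<kappa> I L) \<le> B"
proof -
  have "\<exists>B. \<forall>t\<ge>0. \<forall>p\<in>dom \<kappa>. \<forall>I L. norm (w t p \<kappa> I L) \<le> B"
    using assms by (simp add: regular_evol_def)
  then obtain B where B: "\<And>t p I L. 0 \<le> t \<Longrightarrow> p \<in> dom \<kappa> \<Longrightarrow> norm (w t p \<kappa> I L) \<le> B"
    by blast
  have "norm (w t p \<kappa> I L) \<le> \<bar>B\<bar>" if "0 \<le> t" for t p I L
  proof (cases "p \<in> dom \<kappa>")
    case True
    then show ?thesis
      using B[OF that True, of I L] by linarith
  next
    case False
    then show ?thesis
      using bundle_array_eq_0[OF regular_evol_array[OF assms(1) that, of p], of \<kappa> I L] by simp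
  qed
  then show ?thesis
    by (rule that)
qed

lemma regular_evol_continuous:
  assumes "regular_evol \<sigma> n w"
  shows "continuous_on {0..} (\<lambda>t. w t p \<kappa> I L)"
proof (cases "\<kappa> \<in> K \<and> p \<in> dom \<kappa>")
  case True
  then have "continuous_on ({0..} \<times> dom \<kappa>) (\<lambda>(t, p). w t p \<kappa> I L)"
    using assms by (simp add: regular_evol_def continuous_evol_def)
  moreover have "continuous_on {0..} (\<lambda>t::real. (t, p))" "(\<lambda>t. (t, p)) ` {0..} \<subseteq> {0..} \<times> dom \<kappa>"
    using True by (auto intro!: continuous_intros)
  ultimately show ?thesis
    using continuous_on_compose2[of _ "\<lambda>(t, p). w t p \<kappa> I L" "{0..}" "\<lambda>t. (t, p)"] by simp
next
  case False
  have "w t p \<kappa> I L = 0" if "0 \<le> t" for t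
    by (rule bundle_array_eq_0[OF regular_evol_array[OF assms that]]) (use False in auto)
  then show ?thesis
    by (intro continuous_on_eq[OF continuous_on_const[of _ 0]]) simp
qed

lemma regular_evol_bound_all:
  assumes "regular_evol \<sigma> n w"
  obtains B where "\<And>t p. 0 \<le> t \<Longrightarrow> norm (w t p \<kappa> I L) \<le> B"
proof (cases "\<kappa> \<in> K")
  case True
  then show ?thesis
    using regular_evol_bound[OF assms True] that by metis
next
  case False
  have "norm (w t p \<kappa> I L) \<le> 0" if "0 \<le> t" for t p
    using bundle_array_eq_0[OF regular_evol_array[OF assms that, of p], of \<kappa> I L] False by simp
  then show ?thesis
    by (rule that)
qed

lemma regular_evol_integrable:
  assumes "regular_evol \<sigma> n w" "integrable half_line k" "t \<le> 0"
  shows "integrable half_line (\<lambda>s. k s *\<^sub>R w (- s * t) p \<kappa> I L)"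
proof -
  obtain B where "\<And>t p. 0 \<le> t \<Longrightarrow> norm (w t p \<kappa> I L) \<le> B"
    using regular_evol_bound_all[OF assms(1)] by metis
  then show ?thesis
    by (rule integrable_reflected[OF assms(2) regular_evol_continuous[OF assms(1)] _ assms(3)])
qed

lemma extend_eq_integral: "t < 0 \<Longrightarrow> extend k f t = (\<integral>s. k s *\<^sub>R f (- s * t) \<partial>half_line)"
  by (simp add: extend_def)

lemma continuous_evol_e_plus:
  assumes w: "regular_evol \<sigma> n w" and k: "integrable half_line k" "integral\<^sup>L half_line k = 1"
  shows "continuous_evol K UNIV (e_plus k w)"
  unfolding continuous_evol_def e_plus_extend
proof (intro ballI allI)
  fix \<kappa> I L assume \<kappa>: "\<kappa> \<in> K"
  obtain B where B: "\<And>t p I L. 0 \<le> t \<Longrightarrow> norm (w t p \<kappa> I L) \<le> B"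
    using regular_evol_bound[OF w \<kappa>] by blast
  show "continuous_on (UNIV \<times> dom \<kappa>) (\<lambda>(t, p). extend k (\<lambda>t. w t p \<kappa> I L) t)"
    by (rule continuous_on_extend[OF k]) (use w \<kappa> B in \<open>auto simp: regular_evol_def continuous_evol_def\<close>)
qed

lemma has_vector_derivative_tder:
  assumes "time_differentiable J w" "t \<in> J"
  shows "((\<lambda>s. w s p \<kappa> I L) has_vector_derivative tder J w t p \<kappa> I L) (at t within J)"
  using assms by (simp add: time_differentiable_def tder_def vector_derivative_works)

lemma has_vector_derivative_e_plus:
  assumes w: "regular_evol \<sigma> n w" "time_differentiable {0..} w" "regular_evol \<sigma> n' (tder {0..} w)"
    and k: "integrable half_line k" "integral\<^sup>L half_line k = 1"
    and k': "integrable half_line (\<lambda>s. - s * k s)" "integral\<^sup>L half_line (\<lambda>s. - s * k s) = 1"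
  shows "((\<lambda>t. e_plus k w t p \<kappa> I L) has_vector_derivative e_plus (\<lambda>s. - s * k s) (tder {0..} w) t p \<kappa> I L) (at t)"
proof -
  obtain B where B: "\<And>t p. 0 \<le> t \<Longrightarrow> norm (w t p \<kappa> I L) \<le> B"
    using regular_evol_bound_all[OF w(1)] by metis
  obtain B' where B': "\<And>t p. 0 \<le> t \<Longrightarrow> norm (tder {0..} w t p \<kappa> I L) \<le> B'"
    using regular_evol_bound_all[OF w(3)] by metis
  show ?thesis
    unfolding e_plus_extend
    by (rule has_vector_derivative_extend[OF k k' has_vector_derivative_tder[OF w(2)] B B']) auto
qed

lemma
  assumes w: "regular_evol \<sigma> n w" "time_differentiable {0..} w" "regular_evol \<sigma> n' (tder {0..} w)"
    and k: "integrable half_line k" "integral\<^sup>L half_line k = 1"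
    and k': "integrable half_line (\<lambda>s. - s * k s)" "integral\<^sup>L half_line (\<lambda>s. - s * k s) = 1"
  shows time_differentiable_e_plus: "time_differentiable UNIV (e_plus k w)"
    and tder_e_plus: "tder UNIV (e_plus k w) = e_plus (\<lambda>s. - s * k s) (tder {0..} w)"
  using differentiableI_vector[OF has_vector_derivative_e_plus[OF assms]]
    vector_derivative_at[OF has_vector_derivative_e_plus[OF assms]]
  by (simp_all add: time_differentiable_def tder_def fun_eq_iff)

lemma has_vector_derivative_space_e_plus:
  assumes w: "regular_evol \<sigma> n w" "space_differentiable K {0..} w" "regular_evol \<sigma> n' (\<lambda>t. covd K g W (w t))"
    and k: "integrable half_line k" and \<kappa>: "\<kappa> \<in> K" and x0: "x0 \<in> ran \<kappa>" and t: "t < 0"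
  shows "((\<lambda>y. loc \<kappa> (\<lambda>p. e_plus k w t p \<kappa> I L) (x0 + y *\<^sub>R axis l 1)) has_vector_derivative
      (\<integral>s. k s *\<^sub>R pd (ran \<kappa>) l (loc \<kappa> (\<lambda>p. w (- s * t) p \<kappa> I L)) x0 \<partial>half_line))
      (at 0 within line_dom (ran \<kappa>) l x0)"
proof -
  obtain B where B: "\<And>t p I L. 0 \<le> t \<Longrightarrow> norm (w t p \<kappa> I L) \<le> B"
    using regular_evol_bound[OF w(1) \<kappa>] by blast
  obtain B' where B': "\<And>t p I L. 0 \<le> t \<Longrightarrow> norm (covd K g W (w t) p \<kappa> I L) \<le> B'"
    using regular_evol_bound[OF w(3) \<kappa>] by blast
  obtain \<delta> C where \<delta>: "0 < \<delta>" and C: "\<And>x u. x \<in> ran \<kappa> \<Longrightarrow> dist x x0 < \<delta> \<Longrightarrow> (\<And>I L. u I L \<in> F) \<Longrightarrow>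
     (\<And>I L. norm (u I L) \<le> B) \<Longrightarrow> norm (lower_order g W \<kappa> (chinv \<kappa> x) l I L u) \<le> C"
    using lower_order_locally_bounded[OF \<kappa> x0, of B l I L] by blast
  \<comment> \<open>\<open>C\<close> is valid only within distance \<open>\<delta>\<close> of
    \<open>x0\<close>. The shortened line is still convex, and the derivative at 0 does not notice
    the cut.\<close>
  define S where "S = line_dom (ran \<kappa>) l x0 \<inter> {-\<delta><..<\<delta>}"
  let ?f = "\<lambda>\<tau>. loc \<kappa> (\<lambda>p. w \<tau> p \<kappa> I L)"
  have pd_bound: "norm (pd (ran \<kappa>) l (?f \<tau>) (x0 + y *\<^sub>R axis l 1)) \<le> B' + C" if \<tau>: "0 \<le> \<tau>" and y: "y \<in> S" for \<tau> y
  proof -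
    let ?x = "x0 + y *\<^sub>R axis l 1"
    have x: "?x \<in> ran \<kappa>" "dist ?x x0 < \<delta>"
      using y by (auto simp: S_def line_dom_def dist_norm)
    have p: "chinv \<kappa> ?x \<in> dom \<kappa>" "ch \<kappa> (chinv \<kappa> ?x) = ?x"
      using chinv_in_dom[OF \<kappa> x(1)] ch_chinv[OF \<kappa> x(1)] by simp_all
    have "pd (ran \<kappa>) l (?f \<tau>) ?x = covd K g W (w \<tau>) (chinv \<kappa> ?x) \<kappa> I (l # L)
        - lower_order g W \<kappa> (chinv \<kappa> ?x) l I L (w \<tau> (chinv \<kappa> ?x) \<kappa>)"
      unfolding covd_Cons[OF \<kappa> p(1)] p(2) by simp
    moreover have "norm (lower_order g W \<kappa> (chinv \<kappa> ?x) l I L (w \<tau> (chinv \<kappa> ?x) \<kappa>)) \<le> C"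
      by (rule C[OF x]) (use regular_evol_in_F[OF w(1) \<tau>] B[OF \<tau>] in auto)
    ultimately show ?thesis
      using B'[OF \<tau>, of "chinv \<kappa> ?x" I "l # L"] by (metis add_mono norm_triangle_le_diff)
  qed
  have "((\<lambda>y. \<integral>s. k s *\<^sub>R ?f (- s * t) (x0 + y *\<^sub>R axis l 1) \<partial>half_line) has_vector_derivative
      (\<integral>s. k s *\<^sub>R pd (ran \<kappa>) l (?f (- s * t)) (x0 + 0 *\<^sub>R axis l 1) \<partial>half_line)) (at 0 within S)"
  proof (rule has_vector_derivative_integral)
    show "convex S"
      unfolding S_def by (intro convex_Int convex_line_dom \<kappa>) auto
    show "0 \<in> S"
      using x0 \<delta> by (simp add: S_def line_dom_def)
    show "integrable half_line (\<lambda>s. k s *\<^sub>R ?f (- s * t) (x0 + y *\<^sub>R axis l 1))" for y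
      unfolding loc_def using t by (intro regular_evol_integrable[OF w(1) k]) auto
    show "integrable half_line (\<lambda>s. \<bar>k s\<bar> * (B' + C))"
      using k by auto
  next
    fix y s assume y: "y \<in> S" and s: "s \<in> space half_line"
    have st: "0 \<le> - s * t"
      using s t by (simp add: mult_nonneg_nonpos)
    have "x0 + y *\<^sub>R axis l 1 \<in> ran \<kappa>"
      using y by (simp add: S_def line_dom_def)
    then have "pdiff (ran \<kappa>) l (?f (- s * t)) (x0 + y *\<^sub>R axis l 1)"
      using w(2) \<kappa> st by (simp add: space_differentiable_def)
    from has_vector_derivative_pd_shift[OF this]
    have "((\<lambda>y. ?f (- s * t) (x0 + y *\<^sub>R axis l 1)) has_vector_derivative
        pd (ran \<kappa>) l (?f (- s * t)) (x0 + y *\<^sub>R axis l 1)) (at y within S)"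
      by (rule has_vector_derivative_within_subset) (auto simp: S_def)
    from has_vector_derivative_scaleR[OF _ this, of "\<lambda>_. k s" 0]
    show "((\<lambda>y. k s *\<^sub>R ?f (- s * t) (x0 + y *\<^sub>R axis l 1)) has_vector_derivative
        k s *\<^sub>R pd (ran \<kappa>) l (?f (- s * t)) (x0 + y *\<^sub>R axis l 1)) (at y within S)"
      by simp
    show "norm (k s *\<^sub>R pd (ran \<kappa>) l (?f (- s * t)) (x0 + y *\<^sub>R axis l 1)) \<le> \<bar>k s\<bar> * (B' + C)"
      unfolding norm_scaleR by (intro mult_left_mono pd_bound st y) auto
  qed
  moreover have "at 0 within S = at 0 within line_dom (ran \<kappa>) l x0"
    by (rule at_within_nhd[of 0 "{-\<delta><..<\<delta>}"]) (use \<delta> in \<open>auto simp: S_def\<close>)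
  ultimately show ?thesis
    using t by (simp add: loc_def e_plus_extend extend_eq_integral)
qed

lemma e_plus_nonneg: "0 \<le> t \<Longrightarrow> e_plus k w t = w t"
  by (simp add: e_plus_def)

lemma space_differentiable_e_plus:
  assumes w: "regular_evol \<sigma> n w" "space_differentiable K {0..} w" "regular_evol \<sigma> n' (\<lambda>t. covd K g W (w t))"
    and k: "integrable half_line k"
  shows "space_differentiable K UNIV (e_plus k w)"
  unfolding space_differentiable_def
proof (intro ballI allI)
  fix t \<kappa> x l I L assume \<kappa>: "\<kappa> \<in> K" "x \<in> ran \<kappa>"
  show "pdiff (ran \<kappa>) l (loc \<kappa> (\<lambda>p. e_plus k w t p \<kappa> I L)) x"
  proof (cases "0 \<le> t")
    case True
    then show ?thesis
      using w(2) \<kappa> by (simp add: e_plus_nonneg space_differentiable_def)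
  next
    case False
    then show ?thesis
      unfolding pdiff_def
      by (intro differentiableI_vector[OF has_vector_derivative_space_e_plus[OF w k \<kappa>]]) simp
  qed
qed

lemma covd_e_plus:
  assumes w: "regular_evol \<sigma> n w" "space_differentiable K {0..} w" "regular_evol \<sigma> n' (\<lambda>t. covd K g W (w t))"
    and k: "integrable half_line k"
  shows "covd K g W (e_plus k w t) = e_plus k (\<lambda>t. covd K g W (w t)) t"
proof (cases "0 \<le> t")
  case True
  then show ?thesis
    by (simp add: e_plus_nonneg)
next
  case False
  then have t: "t < 0"
    by simp
  have "covd K g W (e_plus k w t) p \<kappa> I L' = e_plus k (\<lambda>t. covd K g W (w t)) t p \<kappa> I L'" for p \<kappa> I L'
  proof (cases "\<exists>l L. L' = l # L \<and> \<kappa> \<in> K \<and> p \<in> dom \<kappa>")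
    case False
    then have "covd K g W u p \<kappa> I L' = 0" for u
      by (cases L') auto
    then show ?thesis
      using t by (simp add: e_plus_extend extend_def)
  next
    case True
    then obtain l L where L': "L' = l # L" and \<kappa>: "\<kappa> \<in> K" and p: "p \<in> dom \<kappa>"
      by blast
    let ?v = "\<lambda>s. w (- s * t) p \<kappa>"
    let ?d = "\<lambda>s. pd (ran \<kappa>) l (loc \<kappa> (\<lambda>q. w (- s * t) q \<kappa> I L)) (ch \<kappa> p)"
    let ?lo = "lower_order g W \<kappa> p l I L"
    have st: "0 \<le> - s * t" if "s \<in> space half_line" for s
      using that t by (simp add: mult_nonneg_nonpos)
    have v: "?v s I L \<in> F" if "s \<in> space half_line" for s I L
      by (rule regular_evol_in_F[OF w(1) st[OF that]])
    have int: "integrable half_line (\<lambda>s. k s *\<^sub>R ?v s I L)" for I L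
      using t by (intro regular_evol_integrable[OF w(1) k]) auto
    note lo = lower_order_integral[where v = ?v and k = k and N = half_line and l = l and I = I and L = L, OF \<kappa> p v int]
    have cv: "covd K g W (w (- s * t)) p \<kappa> I (l # L) = ?d s + ?lo (?v s)" for s
      by (rule covd_Cons[OF \<kappa> p])
    \<comment> \<open>Nothing is known about the time dependence of the bare partial derivative. It
      becomes integrable as the covariant derivative minus the terms of order zero, both of which
      are integrable.\<close>
    have "integrable half_line (\<lambda>s. k s *\<^sub>R covd K g W (w (- s * t)) p \<kappa> I (l # L))"
      using t by (intro regular_evol_integrable[OF w(3) k]) auto
    from Bochner_Integration.integrable_diff[OF this lo(1)]
    have d: "integrable half_line (\<lambda>s. k s *\<^sub>R ?d s)"
      unfolding cv by (simp add: scaleR_add_right)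
    have "covd K g W (e_plus k w t) p \<kappa> I (l # L)
        = pd (ran \<kappa>) l (loc \<kappa> (\<lambda>q. e_plus k w t q \<kappa> I L)) (ch \<kappa> p) + ?lo (e_plus k w t p \<kappa>)"
      by (rule covd_Cons[OF \<kappa> p])
    also have "pd (ran \<kappa>) l (loc \<kappa> (\<lambda>q. e_plus k w t q \<kappa> I L)) (ch \<kappa> p) = (\<integral>s. k s *\<^sub>R ?d s \<partial>half_line)"
      by (rule pd_eqI[OF \<kappa> ch_in_ran[OF \<kappa> p] has_vector_derivative_space_e_plus[OF w k \<kappa> ch_in_ran[OF \<kappa> p] t]])
    also have "e_plus k w t p \<kappa> = (\<lambda>I L. \<integral>s. k s *\<^sub>R ?v s I L \<partial>half_line)"
      using t by (simp add: fun_eq_iff e_plus_extend extend_def)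
    also note lo(2)
    also have "(\<integral>s. k s *\<^sub>R ?d s \<partial>half_line) + (\<integral>s. k s *\<^sub>R ?lo (?v s) \<partial>half_line)
        = (\<integral>s. k s *\<^sub>R covd K g W (w (- s * t)) p \<kappa> I (l # L) \<partial>half_line)"
      unfolding cv scaleR_add_right using d lo(1) by (rule Bochner_Integration.integral_add[symmetric])
    finally show ?thesis
      unfolding L' e_plus_extend extend_eq_integral[OF t] .
  qed
  then show ?thesis
    by (simp add: fun_eq_iff)
qed

section \<open>The transformation law under the integral\<close>

lemma tensor_fiber_array: "v \<in> tensor_fiber K W \<sigma> n p \<Longrightarrow> bundle_array \<sigma> n p v"
  by (simp add: tensor_fiber_def bundle_array_def)

lemma btrans_linear:
  "\<kappa> \<in> K \<Longrightarrow> \<kappa>' \<in> K \<Longrightarrow> p \<in> dom \<kappa> \<inter> dom \<kappa>' \<Longrightarrow> linear_on F (btrans W \<kappa> \<kappa>' p)"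
  using regular_bundle by (simp add: fully_uniformly_regular_def metric_bundle_def)

lemma tensor_fiber_integral:
  fixes k :: "'x \<Rightarrow> real"
  assumes v: "\<And>s. s \<in> space N \<Longrightarrow> v s \<in> tensor_fiber K W \<sigma> n p"
    and int: "\<And>\<kappa> I L. integrable N (\<lambda>s. k s *\<^sub>R v s \<kappa> I L)"
  shows "(\<lambda>\<kappa> I L. \<integral>s. k s *\<^sub>R v s \<kappa> I L \<partial>N) \<in> tensor_fiber K W \<sigma> n p"
proof -
  let ?w = "\<lambda>\<kappa> I L. \<integral>s. k s *\<^sub>R v s \<kappa> I L \<partial>N"
  have arr: "bundle_array \<sigma> n p (v s)" if "s \<in> space N" for s
    by (rule tensor_fiber_array[OF v[OF that]])
  have "if \<kappa> \<in> K \<and> p \<in> dom \<kappa> \<and> I \<in> idx \<sigma> \<and> L \<in> idx n then ?w \<kappa> I L \<in> F else ?w \<kappa> I L = 0" for \<kappa> I L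
  proof (cases "\<kappa> \<in> K \<and> p \<in> dom \<kappa> \<and> I \<in> idx \<sigma> \<and> L \<in> idx n")
    case True
    have "?w \<kappa> I L \<in> F"
      by (intro integral_in_subspace subspace_F subspace_scale bundle_array_in_F[OF arr])
    with True show ?thesis
      by simp
  next
    case False
    then have "?w \<kappa> I L = (\<integral>s. 0 \<partial>N)"
      using bundle_array_eq_0[OF arr] by (intro Bochner_Integration.integral_cong) auto
    with False show ?thesis
      by auto
  qed
  moreover have "?w \<kappa>' I L = (\<Sum>I'\<in>idx \<sigma>. \<Sum>L'\<in>idx n.
      ((\<Prod>a<\<sigma>. jac \<kappa> \<kappa>' p (I ! a) (I' ! a)) * (\<Prod>b<n. jac \<kappa>' \<kappa> p (L' ! b) (L ! b))) *\<^sub>R btrans W \<kappa> \<kappa>' p (?w \<kappa> I' L'))"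
    if \<kappa>: "\<kappa> \<in> K" "\<kappa>' \<in> K" "p \<in> dom \<kappa> \<inter> dom \<kappa>'" and IL: "I \<in> idx \<sigma>" "L \<in> idx n" for \<kappa> \<kappa>' I L
  proof -
    let ?c = "\<lambda>I' L'. (\<Prod>a<\<sigma>. jac \<kappa> \<kappa>' p (I ! a) (I' ! a)) * (\<Prod>b<n. jac \<kappa>' \<kappa> p (L' ! b) (L ! b))"
    have "v s \<kappa>' I L = (\<Sum>I'\<in>idx \<sigma>. \<Sum>L'\<in>idx n. ?c I' L' *\<^sub>R btrans W \<kappa> \<kappa>' p (v s \<kappa> I' L'))"
      if "s \<in> space N" for s
      using v[OF that] \<kappa> IL unfolding tensor_fiber_def by blast
    then have "?w \<kappa>' I L = (\<integral>s. (\<Sum>I'\<in>idx \<sigma>. \<Sum>L'\<in>idx n. ?c I' L' *\<^sub>R (k s *\<^sub>R btrans W \<kappa> \<kappa>' p (v s \<kappa> I' L'))) \<partial>N)"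
      by (intro Bochner_Integration.integral_cong) (auto simp: scaleR_sum_right mult.commute)
    also note btr = linear_on_integral[OF vec_subspace_F btrans_linear[OF \<kappa>] bundle_array_in_F[OF arr] int]
    have "\<dots> = (\<Sum>I'\<in>idx \<sigma>. \<Sum>L'\<in>idx n. ?c I' L' *\<^sub>R btrans W \<kappa> \<kappa>' p (?w \<kappa> I' L'))"
      using btr(1) by (simp add: Bochner_Integration.integral_sum btr(2) del: scaleR_scaleR)
    finally show ?thesis .
  qed
  ultimately show ?thesis
    unfolding tensor_fiber_def by blast
qed

end


subsection \<open>The anisotropic spaces of integer order\<close>

context singular_bundle
begin

lemma at_within_nonneg_neq_bot:
  assumes "t \<in> {0..}" shows "at t within {0..} \<noteq> (bot :: real filter)"
proof -
  have "at_right t \<le> at t within {0..}"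
    using assms by (intro at_le) auto
  then show ?thesis
    using trivial_limit_at_right_real[of t] by (metis bot.extremum_uniqueI)
qed

lemma nabla_dt_0: "nabla_dt M W J 0 j u = (tder J ^^ j) u"
  by (simp add: nabla_dt_def fun_eq_iff)

lemma nabla_dt_0_Suc: "nabla_dt M W J 0 (Suc j) u = tder J (nabla_dt M W J 0 j u)"
  by (simp add: nabla_dt_0)

lemma nabla_dt_Suc: "nabla_dt M W J (Suc i) j u = (\<lambda>t. covd K g W (nabla_dt M W J i j u t))"
  by (simp add: nabla_dt_def fun_eq_iff)

lemma BC_spaceD:
  assumes "u \<in> fst (BC_space M W \<sigma> \<tau> r lam mu k J)"
  shows "t \<notin> J \<Longrightarrow> u t = 0"
    and "t \<in> J \<Longrightarrow> u t p \<in> tensor_fiber K W \<sigma> \<tau> p"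
    and "i + j * r \<le> k * r \<Longrightarrow> continuous_evol K J (nabla_dt M W J i j u)"
    and "Suc j * r \<le> k * r \<Longrightarrow> time_differentiable J (nabla_dt M W J 0 j u)"
    and "Suc i + j * r \<le> k * r \<Longrightarrow> space_differentiable K J (nabla_dt M W J i j u)"
    and "BC_norm M W \<sigma> \<tau> r lam mu k J u < \<infinity>"
  using assms unfolding BC_space_def by auto

lemma BC_spaceI:
  assumes "\<And>t. t \<notin> J \<Longrightarrow> u t = 0"
    and "\<And>t p. t \<in> J \<Longrightarrow> u t p \<in> tensor_fiber K W \<sigma> \<tau> p"
    and "\<And>i j. i + j * r \<le> k * r \<Longrightarrow> continuous_evol K J (nabla_dt M W J i j u)"
    and "\<And>j. Suc j * r \<le> k * r \<Longrightarrow> time_differentiable J (nabla_dt M W J 0 j u)"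
    and "\<And>i j. Suc i + j * r \<le> k * r \<Longrightarrow> space_differentiable K J (nabla_dt M W J i j u)"
    and "BC_norm M W \<sigma> \<tau> r lam mu k J u < \<infinity>"
  shows "u \<in> fst (BC_space M W \<sigma> \<tau> r lam mu k J)"
  using assms unfolding BC_space_def by auto

lemma BC_norm_upper:
  assumes "i + j * r \<le> k * r" "t \<in> J" "\<kappa> \<in> K" "p \<in> dom \<kappa>"
  shows "ennreal (\<rho> p powr (lam + real i + real j * mu + real \<tau> - real \<sigma>)
      * tnorm g W \<sigma> (\<tau> + i) \<kappa> p (nabla_dt M W J i j u t p)) \<le> BC_norm M W \<sigma> \<tau> r lam mu k J u"
  unfolding BC_norm_def
  by (rule SUP_upper2[of "(i, j)"], use assms in simp, simp only: prod.case,
      rule SUP_upper2[OF assms(2)], rule SUP_upper2[of p], simp, rule SUP_upper2[of \<kappa>])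
    (use assms in auto)

lemma BC_norm_least:
  assumes "\<And>i j t \<kappa> p. i + j * r \<le> k * r \<Longrightarrow> t \<in> J \<Longrightarrow> \<kappa> \<in> K \<Longrightarrow> p \<in> dom \<kappa> \<Longrightarrow>
    ennreal (\<rho> p powr (lam + real i + real j * mu + real \<tau> - real \<sigma>)
      * tnorm g W \<sigma> (\<tau> + i) \<kappa> p (nabla_dt M W J i j u t p)) \<le> N"
  shows "BC_norm M W \<sigma> \<tau> r lam mu k J u \<le> N"
  unfolding BC_norm_def by (auto intro!: SUP_least assms)

section \<open>Derivatives keep their values in the model fiber and are bounded on patches\<close>

lemma bundle_array_tder:
  assumes "\<And>t p. t \<in> J \<Longrightarrow> bundle_array \<sigma> n p (w t p)" "time_differentiable J w"
    "t \<in> J" "at t within J \<noteq> bot"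
  shows "bundle_array \<sigma> n p (tder J w t p)"
  unfolding bundle_array_def
proof (intro allI)
  fix \<kappa> I L
  note der = has_vector_derivative_tder[OF assms(2,3), of p \<kappa> I L]
  have "tder J w t p \<kappa> I L \<in> F"
    by (rule has_vector_derivative_in_subspace[OF subspace_F der assms(4)])
      (use assms in \<open>auto intro: bundle_array_in_F\<close>)
  moreover have "tder J w t p \<kappa> I L \<in> {0}" if "\<not> (\<kappa> \<in> K \<and> p \<in> dom \<kappa> \<and> I \<in> idx \<sigma> \<and> L \<in> idx n)"
    by (rule has_vector_derivative_in_subspace[OF _ der assms(4)])
      (use assms that in \<open>auto intro: bundle_array_eq_0\<close>)
  ultimately show "if \<kappa> \<in> K \<and> p \<in> dom \<kappa> \<and> I \<in> idx \<sigma> \<and> L \<in> idx n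
      then tder J w t p \<kappa> I L \<in> F else tder J w t p \<kappa> I L = 0"
    by auto
qed

lemma pd_in_subspace:
  fixes f :: "(real, 'm) vec \<Rightarrow> 'b::euclidean_space"
  assumes "\<kappa> \<in> K" "x \<in> ran \<kappa>" "pdiff (ran \<kappa>) l f x" "subspace E" "\<And>y. f y \<in> E"
  shows "pd (ran \<kappa>) l f x \<in> E"
  by (rule has_vector_derivative_in_subspace[OF assms(4) has_vector_derivative_pd[OF assms(3)]
    line_dom_not_bot[OF assms(1,2)]]) (use assms in \<open>auto simp: line_dom_def\<close>)

lemma bundle_array_covd:
  assumes u: "\<And>p. bundle_array \<sigma> n p (u p)"
    and diff: "\<And>\<kappa> x l I L. \<kappa> \<in> K \<Longrightarrow> x \<in> ran \<kappa> \<Longrightarrow> pdiff (ran \<kappa>) l (loc \<kappa> (\<lambda>p. u p \<kappa> I L)) x"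
  shows "bundle_array \<sigma> (Suc n) p (covd K g W u p)"
  unfolding bundle_array_def
proof (intro allI)
  fix \<kappa> I L'
  show "if \<kappa> \<in> K \<and> p \<in> dom \<kappa> \<and> I \<in> idx \<sigma> \<and> L' \<in> idx (Suc n)
      then covd K g W u p \<kappa> I L' \<in> F else covd K g W u p \<kappa> I L' = 0"
  proof (cases L')
    case Nil
    then show ?thesis
      by (simp add: idx_def)
  next
    case (Cons l L)
    show ?thesis
    proof (cases "\<kappa> \<in> K \<and> p \<in> dom \<kappa>")
      case False
      then show ?thesis
        by (auto simp: Cons)
    next
      case True
      then have \<kappa>: "\<kappa> \<in> K" and p: "p \<in> dom \<kappa>"
        by auto
      let ?f = "loc \<kappa> (\<lambda>q. u q \<kappa> I L)"
      note pd = pd_in_subspace[OF \<kappa> ch_in_ran[OF \<kappa> p] diff[OF \<kappa> ch_in_ran[OF \<kappa> p]]]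
      show ?thesis
      proof (cases "I \<in> idx \<sigma> \<and> L \<in> idx n")
        case True
        have "pd (ran \<kappa>) l ?f (ch \<kappa> p) \<in> F"
          by (rule pd[OF subspace_F]) (auto simp: loc_def bundle_array_in_F[OF u])
        moreover have "lower_order g W \<kappa> p l I L (u p \<kappa>) \<in> F"
          by (rule lower_order_in_F[OF \<kappa> p bundle_array_in_F[OF u]])
        ultimately have "covd K g W u p \<kappa> I L' \<in> F"
          unfolding Cons covd_Cons[OF \<kappa> p] by (rule subspace_add[OF subspace_F])
        with True \<kappa> p show ?thesis
          by (auto simp: Cons idx_def)
      next
        case False
        \<comment> \<open>Substituting an index preserves lengths, so every entry occurring in the
          covariant derivative is a default entry.\<close>
        then have zero: "u q \<kappa> I' L' = 0" if "length I' = length I" "length L' = length L" for q I' L'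
          using that by (intro bundle_array_eq_0[OF u]) (auto simp: idx_def)
        have "pd (ran \<kappa>) l ?f (ch \<kappa> p) \<in> {0}"
          by (rule pd) (auto simp: loc_def zero)
        moreover have "lower_order g W \<kappa> p l I L (u p \<kappa>) = 0"
          using linear_on_0[OF Chr_linear[OF \<kappa> p] vec_subspace_F] by (simp add: lower_order_def zero)
        ultimately have "covd K g W u p \<kappa> I L' = 0"
          unfolding Cons covd_Cons[OF \<kappa> p] by simp
        with False show ?thesis
          by (auto simp: Cons idx_def)
      qed
    qed
  qed
qed

text \<open>Time derivatives are innermost in \<open>nabla_dt\<close>. Hence the induction on
  \<open>j\<close> is carried out first, with \<open>i = 0\<close> and for all times, as a time
  derivative involves neighbouring times; the one on \<open>i\<close> then works at a fixed
  time.\<close>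

lemma bundle_array_nabla_dt:
  assumes u: "u \<in> fst (BC_space M W \<sigma> \<tau> r lam mu k J)" and J: "\<And>t. t \<in> J \<Longrightarrow> at t within J \<noteq> bot"
    and "i + j * r \<le> k * r" "t \<in> J"
  shows "bundle_array \<sigma> (\<tau> + i) p (nabla_dt M W J i j u t p)"
  using assms(3)
proof (induction i arbitrary: p)
  case 0
  have "bundle_array \<sigma> \<tau> p (nabla_dt M W J 0 j u t p)" if "j * r \<le> k * r" "t \<in> J" for t p
    using that
  proof (induction j arbitrary: t p)
    case 0
    then show ?case
      using tensor_fiber_array[OF BC_spaceD(2)[OF u]] by (simp add: nabla_dt_0)
  next
    case (Suc j)
    then have "j * r \<le> k * r"
      unfolding mult_Suc by (blast dest: add_leD2)
    then show ?case
      unfolding nabla_dt_0_Suc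
      by (intro bundle_array_tder[OF Suc.IH BC_spaceD(4)[OF u Suc.prems(1)] Suc.prems(2) J[OF Suc.prems(2)]])
  qed
  with 0 assms(4) show ?case
    by simp
next
  case (Suc i)
  have "space_differentiable K J (nabla_dt M W J i j u)"
    by (rule BC_spaceD(5)[OF u Suc.prems])
  then show ?case
    using bundle_array_covd[of \<sigma> "\<tau> + i" "nabla_dt M W J i j u t"] Suc assms(4)
    by (simp add: nabla_dt_Suc space_differentiable_def)
qed

lemma weight_powr_bounded:
  assumes "\<kappa> \<in> K"
  obtains C where "\<And>p. p \<in> dom \<kappa> \<Longrightarrow> \<rho> p powr e \<le> C"
proof -
  obtain d where d: "1 \<le> d" and \<rho>: "\<And>p. p \<in> dom \<kappa> \<Longrightarrow>
      \<rho> (chinv \<kappa> 0) / d \<le> \<rho> p \<and> \<rho> p \<le> d * \<rho> (chinv \<kappa> 0)"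
    using singular assms unfolding singular_manifold_def by blast
  let ?r = "\<rho> (chinv \<kappa> 0)"
  \<comment> \<open>The power is monotone in a direction depending on the sign of \<open>e\<close>;
    the sum of both end values covers the two cases.\<close>
  have "\<rho> p powr e \<le> (?r / d) powr e + (d * ?r) powr e" if "p \<in> dom \<kappa>" for p
  proof (cases "0 \<le> e")
    case True
    then have "\<rho> p powr e \<le> (d * ?r) powr e"
      using \<rho>[OF that] weight_pos[of p] by (intro powr_mono2) auto
    then show ?thesis
      by (simp add: add_increasing)
  next
    case False
    then have "\<rho> p powr e \<le> (?r / d) powr e"
      using \<rho>[OF that] weight_pos[of "chinv \<kappa> 0"] d by (intro powr_mono2') auto
    then show ?thesis
      by (simp add: add_increasing2)
  qed
  then show ?thesis
    by (rule that)
qed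

lemma tnorm_nabla_dt_le:
  assumes u: "u \<in> fst (BC_space M W \<sigma> \<tau> r lam mu k J)"
    and "i + j * r \<le> k * r" "t \<in> J" "\<kappa> \<in> K" "p \<in> dom \<kappa>"
  shows "\<rho> p powr (lam + real i + real j * mu + real \<tau> - real \<sigma>)
    * tnorm g W \<sigma> (\<tau> + i) \<kappa> p (nabla_dt M W J i j u t p) \<le> enn2real (BC_norm M W \<sigma> \<tau> r lam mu k J u)"
proof -
  have "ennreal (\<rho> p powr (lam + real i + real j * mu + real \<tau> - real \<sigma>)
      * tnorm g W \<sigma> (\<tau> + i) \<kappa> p (nabla_dt M W J i j u t p))
      \<le> ennreal (enn2real (BC_norm M W \<sigma> \<tau> r lam mu k J u))"
    using BC_norm_upper[OF assms(2-)] BC_spaceD(6)[OF u] by (simp add: less_top)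
  then show ?thesis
    by (simp add: ennreal_le_iff)
qed

text \<open>Turns the finite weighted norm into bounds on patches: the weight is removed by its
  reciprocal power, bounded on a patch, and the fiber norm controls the components.\<close>

lemma regular_evol_nabla_dt:
  assumes u: "u \<in> fst (BC_space M W \<sigma> \<tau> r lam mu k {0..})" and ij: "i + j * r \<le> k * r"
  shows "regular_evol \<sigma> (\<tau> + i) (nabla_dt M W {0..} i j u)"
proof -
  let ?w = "nabla_dt M W {0..} i j u"
  let ?e = "lam + real i + real j * mu + real \<tau> - real \<sigma>"
  have arr: "bundle_array \<sigma> (\<tau> + i) p (?w t p)" if "0 \<le> t" for t p
    by (rule bundle_array_nabla_dt[OF u at_within_nonneg_neq_bot ij]) (use that in auto)
  have "\<exists>B. \<forall>t\<ge>0. \<forall>p\<in>dom \<kappa>. \<forall>I L. norm (?w t p \<kappa> I L) \<le> B" if \<kappa>: "\<kappa> \<in> K" for \<kappa>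
  proof -
    obtain C where C: "0 \<le> C" "\<And>p v I L. p \<in> dom \<kappa> \<Longrightarrow> (\<And>I L. v \<kappa> I L \<in> F) \<Longrightarrow> I \<in> idx \<sigma> \<Longrightarrow> L \<in> idx (\<tau> + i)
      \<Longrightarrow> norm (v \<kappa> I L) \<le> C * tnorm g W \<sigma> (\<tau> + i) \<kappa> p v"
      using norm_le_tnorm[OF \<kappa>, of \<sigma> "\<tau> + i"] by blast
    obtain D where D: "\<And>p. p \<in> dom \<kappa> \<Longrightarrow> \<rho> p powr (- ?e) \<le> D"
      using weight_powr_bounded[OF \<kappa>, of "- ?e"] by blast
    let ?N = "enn2real (BC_norm M W \<sigma> \<tau> r lam mu k {0..} u)"
    have "norm (?w t p \<kappa> I L) \<le> C * (D * ?N)" if t: "0 \<le> t" and p: "p \<in> dom \<kappa>" for t p I L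
    proof (cases "I \<in> idx \<sigma> \<and> L \<in> idx (\<tau> + i)")
      case True
      let ?T = "tnorm g W \<sigma> (\<tau> + i) \<kappa> p (?w t p)"
      have "norm (?w t p \<kappa> I L) \<le> C * ?T"
        by (rule C(2)[OF p bundle_array_in_F[OF arr[OF t]]]) (use True in auto)
      moreover have "\<rho> p powr (- ?e) * \<rho> p powr ?e = 1"
        unfolding powr_add[symmetric] using weight_pos[of p] by simp
      then have "?T = \<rho> p powr (- ?e) * (\<rho> p powr ?e * ?T)"
        by (simp only: mult.assoc[symmetric] mult_1_left)
      moreover have "\<rho> p powr (- ?e) * (\<rho> p powr ?e * ?T) \<le> \<rho> p powr (- ?e) * ?N"
        using tnorm_nabla_dt_le[OF u ij _ \<kappa> p, of t] t by (intro mult_left_mono) auto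
      moreover have "\<rho> p powr (- ?e) * ?N \<le> D * ?N"
        by (intro mult_right_mono D p) simp
      ultimately show ?thesis
        using C(1) by (smt (verit) mult_left_mono)
    next
      case False
      have "0 \<le> D"
        using D[OF p] powr_ge_zero order_trans by blast
      then show ?thesis
        using False bundle_array_eq_0[OF arr[OF t]] C(1) by auto
    qed
    then show ?thesis
      by blast
  qed
  then show ?thesis
    unfolding regular_evol_def using arr BC_spaceD(3)[OF u ij] by blast
qed


subsection \<open>Differences of elements of the spaces of integer order\<close>

lemma tensor_fiber_diff:
  assumes "u \<in> tensor_fiber K W \<sigma> n p" "v \<in> tensor_fiber K W \<sigma> n p"
  shows "u - v \<in> tensor_fiber K W \<sigma> n p"
proof -
  note uF = bundle_array_in_F[OF tensor_fiber_array[OF assms(1)]]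
  note vF = bundle_array_in_F[OF tensor_fiber_array[OF assms(2)]]
  have "bundle_array \<sigma> n p (u - v)"
    using subspace_diff[OF subspace_F uF vF] assms[THEN tensor_fiber_array, THEN bundle_array_eq_0]
    unfolding bundle_array_def by simp
  moreover have "(u - v) \<kappa>' I L = (\<Sum>I'\<in>idx \<sigma>. \<Sum>L'\<in>idx n.
      ((\<Prod>a<\<sigma>. jac \<kappa> \<kappa>' p (I ! a) (I' ! a)) * (\<Prod>b<n. jac \<kappa>' \<kappa> p (L' ! b) (L ! b)))
        *\<^sub>R btrans W \<kappa> \<kappa>' p ((u - v) \<kappa> I' L'))"
    if \<kappa>: "\<kappa> \<in> K" "\<kappa>' \<in> K" "p \<in> dom \<kappa> \<inter> dom \<kappa>'" and IL: "I \<in> idx \<sigma>" "L \<in> idx n" for \<kappa> \<kappa>' I L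
  proof -
    have law: "w \<kappa>' I L = (\<Sum>I'\<in>idx \<sigma>. \<Sum>L'\<in>idx n.
      ((\<Prod>a<\<sigma>. jac \<kappa> \<kappa>' p (I ! a) (I' ! a)) * (\<Prod>b<n. jac \<kappa>' \<kappa> p (L' ! b) (L ! b)))
        *\<^sub>R btrans W \<kappa> \<kappa>' p (w \<kappa> I' L'))" if "w \<in> tensor_fiber K W \<sigma> n p" for w
      using that \<kappa> IL unfolding tensor_fiber_def by blast
    show ?thesis
      unfolding minus_apply law[OF assms(1)] law[OF assms(2)]
      by (simp add: linear_on_diff[OF vec_subspace_F btrans_linear[OF \<kappa>] uF vF] scaleR_diff_right sum_subtractf)
  qed
  ultimately show ?thesis
    unfolding tensor_fiber_def bundle_array_def by blast
qed

lemma has_vector_derivative_tder_diff: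
  assumes "time_differentiable J u" "time_differentiable J v" "\<And>t. t \<in> J \<Longrightarrow> w t = u t - v t" "t \<in> J"
  shows "((\<lambda>s. w s p \<kappa> I L) has_vector_derivative (tder J u t p \<kappa> I L - tder J v t p \<kappa> I L)) (at t within J)"
  by (rule has_vector_derivative_transform[OF assms(4) _ has_vector_derivative_diff[OF
    has_vector_derivative_tder[OF assms(1,4)] has_vector_derivative_tder[OF assms(2,4)]]])
    (simp add: assms(3))

lemma has_vector_derivative_pd_diff:
  assumes "pdiff S l (loc \<kappa> (\<lambda>p. u p \<kappa> I L)) x" "pdiff S l (loc \<kappa> (\<lambda>p. v p \<kappa> I L)) x"
  shows "((\<lambda>s. loc \<kappa> (\<lambda>p. (u - v) p \<kappa> I L) (x + s *\<^sub>R axis l 1)) has_vector_derivative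
    (pd S l (loc \<kappa> (\<lambda>p. u p \<kappa> I L)) x - pd S l (loc \<kappa> (\<lambda>p. v p \<kappa> I L)) x)) (at 0 within line_dom S l x)"
  using has_vector_derivative_diff[OF assms[THEN has_vector_derivative_pd]]
  by (simp add: loc_def)

lemma covd_diff:
  assumes "\<And>p. bundle_array \<sigma> n p (u p)" "\<And>p. bundle_array \<sigma> n p (v p)"
    and diff: "\<And>\<kappa> x l I L. \<kappa> \<in> K \<Longrightarrow> x \<in> ran \<kappa> \<Longrightarrow> pdiff (ran \<kappa>) l (loc \<kappa> (\<lambda>p. u p \<kappa> I L)) x"
      "\<And>\<kappa> x l I L. \<kappa> \<in> K \<Longrightarrow> x \<in> ran \<kappa> \<Longrightarrow> pdiff (ran \<kappa>) l (loc \<kappa> (\<lambda>p. v p \<kappa> I L)) x"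
  shows "covd K g W (u - v) = covd K g W u - covd K g W v"
proof -
  have "covd K g W (u - v) p \<kappa> I L' = covd K g W u p \<kappa> I L' - covd K g W v p \<kappa> I L'" for p \<kappa> I L'
  proof (cases "\<exists>l L. L' = l # L \<and> \<kappa> \<in> K \<and> p \<in> dom \<kappa>")
    case False
    then have "covd K g W u p \<kappa> I L' = 0" for u
      by (cases L') auto
    then show ?thesis
      by simp
  next
    case True
    then obtain l L where L': "L' = l # L" and \<kappa>: "\<kappa> \<in> K" and p: "p \<in> dom \<kappa>"
      by blast
    note x = ch_in_ran[OF \<kappa> p]
    have "lower_order g W \<kappa> p l I L ((u - v) p \<kappa>) = lower_order g W \<kappa> p l I L (u p \<kappa>) - lower_order g W \<kappa> p l I L (v p \<kappa>)"
    proof -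
      have eq: "(u - v) p \<kappa> = u p \<kappa> - v p \<kappa>"
        by simp
      show ?thesis
        unfolding eq by (rule lower_order_diff[OF \<kappa> p bundle_array_in_F[OF assms(1)] bundle_array_in_F[OF assms(2)]])
    qed
    moreover note pd_eqI[OF \<kappa> x has_vector_derivative_pd_diff[where u = u and v = v and \<kappa> = \<kappa>, OF diff(1)[OF \<kappa> x] diff(2)[OF \<kappa> x]], of l I L]
    ultimately show ?thesis
      unfolding L' covd_Cons[OF \<kappa> p] by simp
  qed
  then show ?thesis
    by (simp add: fun_eq_iff)
qed

lemma nabla_dt_diff:
  assumes u: "u \<in> fst (BC_space M W \<sigma> \<tau> r lam mu k J)" and v: "v \<in> fst (BC_space M W \<sigma> \<tau> r lam mu k J)"
    and J: "\<And>t. t \<in> J \<Longrightarrow> at t within J \<noteq> bot"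
    and "i + j * r \<le> k * r" "t \<in> J"
  shows "nabla_dt M W J i j (u - v) t = nabla_dt M W J i j u t - nabla_dt M W J i j v t"
  using assms(4)
proof (induction i)
  case 0
  have "nabla_dt M W J 0 j (u - v) t = nabla_dt M W J 0 j u t - nabla_dt M W J 0 j v t"
    if "j * r \<le> k * r" "t \<in> J" for t
    using that
  proof (induction j arbitrary: t)
    case 0
    then show ?case
      by (simp add: nabla_dt_0)
  next
    case (Suc j)
    then have jr: "j * r \<le> k * r"
      unfolding mult_Suc by (blast dest: add_leD2)
    have *: "((\<lambda>s. nabla_dt M W J 0 j (u - v) s p \<kappa> I L) has_vector_derivative
        (tder J (nabla_dt M W J 0 j u) t p \<kappa> I L - tder J (nabla_dt M W J 0 j v) t p \<kappa> I L)) (at t within J)" for p \<kappa> I L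
      by (rule has_vector_derivative_tder_diff[OF BC_spaceD(4)[OF u Suc.prems(1)] BC_spaceD(4)[OF v Suc.prems(1)]
          Suc.IH[OF jr] Suc.prems(2)])
    have "tder J (nabla_dt M W J 0 j (u - v)) t p \<kappa> I L
        = tder J (nabla_dt M W J 0 j u) t p \<kappa> I L - tder J (nabla_dt M W J 0 j v) t p \<kappa> I L" for p \<kappa> I L
      unfolding tder_def[of J "nabla_dt M W J 0 j (u - v)"] vector_derivative_within[OF J[OF Suc.prems(2)] *]
      using Suc.prems(2) by (simp only: if_True)
    then show ?case
      unfolding nabla_dt_0_Suc by (intro ext) (simp only: minus_apply)
  qed
  from this[OF _ assms(5)] 0 show ?case
    by (simp only: add_0)
next
  case (Suc i)
  then have "i + j * r \<le> k * r"
    by simp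
  then have IH: "nabla_dt M W J i j (u - v) t = nabla_dt M W J i j u t - nabla_dt M W J i j v t"
    by (rule Suc.IH)
  have "space_differentiable K J (nabla_dt M W J i j u)" "space_differentiable K J (nabla_dt M W J i j v)"
    using BC_spaceD(5)[OF u Suc.prems] BC_spaceD(5)[OF v Suc.prems] by auto
  then show ?case
    unfolding nabla_dt_Suc IH using Suc.prems assms(5) bundle_array_nabla_dt[OF u J, of i j t] bundle_array_nabla_dt[OF v J, of i j t]
    by (intro covd_diff[of \<sigma> "\<tau> + i"]) (auto simp: space_differentiable_def)
qed

text \<open>Needed for closures, where the bound of an operator is applied to the difference of an
  element and its approximant. Their distance is finite by the choice of the approximant, so
  finiteness can be assumed here and no triangle inequality for \<open>BC_norm\<close> is
  required.\<close>

lemma BC_space_diff: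
  assumes u: "u \<in> fst (BC_space M W \<sigma> \<tau> r lam mu k J)" and v: "v \<in> fst (BC_space M W \<sigma> \<tau> r lam mu k J)"
    and J: "\<And>t. t \<in> J \<Longrightarrow> at t within J \<noteq> bot"
    and fin: "BC_norm M W \<sigma> \<tau> r lam mu k J (u - v) < \<infinity>"
  shows "u - v \<in> fst (BC_space M W \<sigma> \<tau> r lam mu k J)"
proof (rule BC_spaceI)
  have diff: "nabla_dt M W J i j (u - v) t = nabla_dt M W J i j u t - nabla_dt M W J i j v t"
    if "i + j * r \<le> k * r" "t \<in> J" for i j t
    using nabla_dt_diff[OF u v _ that] J by blast
  show "(u - v) t = 0" if "t \<notin> J" for t
    using that BC_spaceD(1)[OF u] BC_spaceD(1)[OF v] by simp
  show "(u - v) t p \<in> tensor_fiber K W \<sigma> \<tau> p" if "t \<in> J" for t p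
    using tensor_fiber_diff[OF BC_spaceD(2)[OF u that] BC_spaceD(2)[OF v that]] by simp
  show "continuous_evol K J (nabla_dt M W J i j (u - v))" if ij: "i + j * r \<le> k * r" for i j
    unfolding continuous_evol_def
  proof (intro ballI allI)
    fix \<kappa> I L assume "\<kappa> \<in> K"
    then have "continuous_on (J \<times> dom \<kappa>) (\<lambda>(t, p). nabla_dt M W J i j u t p \<kappa> I L)"
      "continuous_on (J \<times> dom \<kappa>) (\<lambda>(t, p). nabla_dt M W J i j v t p \<kappa> I L)"
      using BC_spaceD(3)[OF u ij] BC_spaceD(3)[OF v ij] by (auto simp: continuous_evol_def)
    from continuous_on_diff[OF this]
    show "continuous_on (J \<times> dom \<kappa>) (\<lambda>(t, p). nabla_dt M W J i j (u - v) t p \<kappa> I L)"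
      by (rule continuous_on_eq) (auto simp: diff[OF ij])
  qed
  show "time_differentiable J (nabla_dt M W J 0 j (u - v))" if "Suc j * r \<le> k * r" for j
    unfolding time_differentiable_def
  proof (intro ballI allI differentiableI_vector)
    have "0 + j * r \<le> k * r"
      using that unfolding mult_Suc add_0 by (rule add_leD2)
    then show "((\<lambda>s. nabla_dt M W J 0 j (u - v) s p \<kappa> I L) has_vector_derivative
        (tder J (nabla_dt M W J 0 j u) t p \<kappa> I L - tder J (nabla_dt M W J 0 j v) t p \<kappa> I L)) (at t within J)"
      if "t \<in> J" for t p \<kappa> I L
      by (intro has_vector_derivative_tder_diff[OF BC_spaceD(4)[OF u \<open>Suc j * r \<le> k * r\<close>] BC_spaceD(4)[OF v \<open>Suc j * r \<le> k * r\<close>]] diff that)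
  qed
  show "space_differentiable K J (nabla_dt M W J i j (u - v))" if ij: "Suc i + j * r \<le> k * r" for i j
    unfolding space_differentiable_def
  proof (intro ballI allI)
    fix t \<kappa> x l I L assume *: "t \<in> J" "\<kappa> \<in> K" "x \<in> ran \<kappa>"
    have "pdiff (ran \<kappa>) l (loc \<kappa> (\<lambda>p. nabla_dt M W J i j u t p \<kappa> I L)) x"
      "pdiff (ran \<kappa>) l (loc \<kappa> (\<lambda>p. nabla_dt M W J i j v t p \<kappa> I L)) x"
      using * BC_spaceD(5)[OF u ij] BC_spaceD(5)[OF v ij] by (auto simp: space_differentiable_def)
    from has_vector_derivative_pd_diff[where u = "nabla_dt M W J i j u t" and v = "nabla_dt M W J i j v t" and \<kappa> = \<kappa>, OF this]
    show "pdiff (ran \<kappa>) l (loc \<kappa> (\<lambda>p. nabla_dt M W J i j (u - v) t p \<kappa> I L)) x"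
      using ij *(1) by (simp add: diff pdiff_def differentiableI_vector)
  qed
qed (rule fin)

end


subsection \<open>Restriction and extension on the spaces of integer order\<close>

definition moment :: "(real \<Rightarrow> real) \<Rightarrow> nat \<Rightarrow> real \<Rightarrow> real" where
  "moment h j s = (- s) ^ j * h s"

lemma moment_0: "moment h 0 = h"
  by (simp add: moment_def fun_eq_iff)

lemma moment_Suc: "moment h (Suc j) = (\<lambda>s. - s * moment h j s)"
  by (simp add: moment_def fun_eq_iff)

text \<open>The absolute integral is at least 1 because the integral is 1. So it is also an
  admissible constant at times \<open>t \<ge> 0\<close>, where the extension is the function
  itself.\<close>

lemma
  assumes "extension_kernel h"
  shows integrable_moment: "integrable half_line (moment h j)"
    and integral_moment: "integral\<^sup>L half_line (moment h j) = 1"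
    and integral_abs_moment: "1 \<le> (\<integral>s. \<bar>moment h j s\<bar> \<partial>half_line)"
proof -
  have "h differentiable (at t)" if "0 < t" for t
    using assms that unfolding extension_kernel_def by (metis funpow_0)
  then have "continuous_on {0<..} h"
    by (intro continuous_at_imp_continuous_on) (auto intro: differentiable_imp_continuous_within)
  then have meas: "moment h j \<in> borel_measurable half_line"
    unfolding moment_def by (intro measurable_half_line continuous_intros)
  have "set_integrable lborel {0<..} (\<lambda>t. t powr real j * \<bar>h t\<bar>)"
    using assms unfolding extension_kernel_def by blast
  then have "integrable half_line (\<lambda>t. t powr real j * \<bar>h t\<bar>)"
    by (simp add: set_integrable_def integrable_restrict_space)
  then show int: "integrable half_line (moment h j)"
    by (rule Bochner_Integration.integrable_bound[OF _ meas])
      (auto simp: moment_def abs_mult power_abs powr_realpow)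
  have "(-1) powi int j * (LINT t:{0<..}|lborel. t powi int j * h t) = 1"
    using assms unfolding extension_kernel_def by blast
  then have "(-1) ^ j * (\<integral>t. t ^ j * h t \<partial>half_line) = 1"
    by (simp add: set_lebesgue_integral_def integral_restrict_space)
  moreover have "moment h j t = (-1) ^ j * (t ^ j * h t)" for t
    by (simp add: moment_def power_minus[of t])
  then have "moment h j = (\<lambda>t. (-1) ^ j * (t ^ j * h t))"
    by (rule ext)
  ultimately show one: "integral\<^sup>L half_line (moment h j) = 1"
    by simp
  have "integral\<^sup>L half_line (moment h j) \<le> (\<integral>s. \<bar>moment h j s\<bar> \<partial>half_line)"
    using int by (intro integral_mono) auto
  with one show "1 \<le> (\<integral>s. \<bar>moment h j s\<bar> \<partial>half_line)"
    by simp
qed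

text \<open>Boundedness separated from linearity, which holds on a domain common to all the spaces.
  The constant is positive so that one can divide by it.\<close>

definition bounded_map :: "('v \<Rightarrow> 'w) \<Rightarrow> 'v nspace \<Rightarrow> 'w nspace \<Rightarrow> bool" where
  "bounded_map T X Y \<longleftrightarrow>
     (\<exists>c::real. 0 < c \<and> (\<forall>u\<in>fst X. T u \<in> fst Y \<and> snd Y (T u) \<le> ennreal c * snd X u))"

context singular_bundle
begin

section \<open>The restriction\<close>

lemma nabla_dt_r_plus:
  assumes u: "u \<in> fst (BC_space M W \<sigma> \<tau> r lam mu k UNIV)" and "i + j * r \<le> k * r" "0 \<le> t"
  shows "nabla_dt M W {0..} i j (r_plus u) t = nabla_dt M W UNIV i j u t"
  using assms(2)
proof (induction i)
  case 0
  have "nabla_dt M W {0..} 0 j (r_plus u) t = nabla_dt M W UNIV 0 j u t" if "j * r \<le> k * r" "0 \<le> t" for t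
    using that
  proof (induction j arbitrary: t)
    case 0
    then show ?case
      by (simp add: nabla_dt_0 r_plus_def)
  next
    case (Suc j)
    then have jr: "j * r \<le> k * r"
      unfolding mult_Suc by (blast dest: add_leD2)
    have der: "((\<lambda>s. nabla_dt M W {0..} 0 j (r_plus u) s p \<kappa> I L) has_vector_derivative
        tder UNIV (nabla_dt M W UNIV 0 j u) t p \<kappa> I L) (at t within {0..})" for p \<kappa> I L
      by (rule has_vector_derivative_transform[OF _ _ has_vector_derivative_at_within[OF
          has_vector_derivative_tder[OF BC_spaceD(4)[OF u Suc.prems(1)]]]])
        (use Suc.prems(2) Suc.IH[OF jr] in auto)
    have "tder {0..} (nabla_dt M W {0..} 0 j (r_plus u)) t p \<kappa> I L
        = tder UNIV (nabla_dt M W UNIV 0 j u) t p \<kappa> I L" for p \<kappa> I L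
      unfolding tder_def[of "{0..}"]
      using Suc.prems(2) by (simp add: vector_derivative_within[OF at_within_nonneg_neq_bot der])
    then show ?case
      unfolding nabla_dt_0_Suc by (intro ext) simp
  qed
  from this[OF _ assms(3)] 0 show ?case
    by simp
next
  case (Suc i)
  then show ?case
    by (simp add: nabla_dt_Suc)
qed

lemma r_plus_bounded:
  "bounded_map r_plus (BC_space M W \<sigma> \<tau> r lam mu k UNIV) (BC_space M W \<sigma> \<tau> r lam mu k {0..})"
  unfolding bounded_map_def
proof (intro exI[of _ 1] conjI ballI)
  fix u assume u: "u \<in> fst (BC_space M W \<sigma> \<tau> r lam mu k UNIV)"
  note nabla = nabla_dt_r_plus[OF u]
  have norm: "BC_norm M W \<sigma> \<tau> r lam mu k {0..} (r_plus u) \<le> BC_norm M W \<sigma> \<tau> r lam mu k UNIV u"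
    by (rule BC_norm_least) (simp add: nabla BC_norm_upper)
  then show "snd (BC_space M W \<sigma> \<tau> r lam mu k {0..}) (r_plus u)
      \<le> ennreal 1 * snd (BC_space M W \<sigma> \<tau> r lam mu k UNIV) u"
    by (simp add: BC_space_def)
  show "r_plus u \<in> fst (BC_space M W \<sigma> \<tau> r lam mu k {0..})"
  proof (rule BC_spaceI)
    show "r_plus u t = 0" if "t \<notin> {0..}" for t
      using that by (simp add: r_plus_def)
    show "r_plus u t p \<in> tensor_fiber K W \<sigma> \<tau> p" if "t \<in> {0..}" for t p
      using that BC_spaceD(2)[OF u] by (simp add: r_plus_def)
    show "continuous_evol K {0..} (nabla_dt M W {0..} i j (r_plus u))" if ij: "i + j * r \<le> k * r" for i j
      unfolding continuous_evol_def
    proof (intro ballI allI)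
      fix \<kappa> I L assume "\<kappa> \<in> K"
      then have "continuous_on (UNIV \<times> dom \<kappa>) (\<lambda>(t, p). nabla_dt M W UNIV i j u t p \<kappa> I L)"
        using BC_spaceD(3)[OF u ij] by (simp add: continuous_evol_def)
      then have "continuous_on ({0..} \<times> dom \<kappa>) (\<lambda>(t, p). nabla_dt M W UNIV i j u t p \<kappa> I L)"
        by (rule continuous_on_subset) auto
      then show "continuous_on ({0..} \<times> dom \<kappa>) (\<lambda>(t, p). nabla_dt M W {0..} i j (r_plus u) t p \<kappa> I L)"
        by (rule continuous_on_eq) (auto simp: nabla[OF ij])
    qed
    show "time_differentiable {0..} (nabla_dt M W {0..} 0 j (r_plus u))" if j: "Suc j * r \<le> k * r" for j
      unfolding time_differentiable_def
    proof (intro ballI allI differentiableI_vector)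
      fix t p \<kappa> I L assume "t \<in> {0::real..}"
      moreover have "0 + j * r \<le> k * r"
        using j unfolding mult_Suc add_0 by (rule add_leD2)
      ultimately show "((\<lambda>s. nabla_dt M W {0..} 0 j (r_plus u) s p \<kappa> I L) has_vector_derivative
          tder UNIV (nabla_dt M W UNIV 0 j u) t p \<kappa> I L) (at t within {0..})"
        by (intro has_vector_derivative_transform[OF _ _ has_vector_derivative_at_within[OF
            has_vector_derivative_tder[OF BC_spaceD(4)[OF u j]]]]) (auto simp: nabla)
    qed
    show "space_differentiable K {0..} (nabla_dt M W {0..} i j (r_plus u))" if ij: "Suc i + j * r \<le> k * r" for i j
      using BC_spaceD(5)[OF u ij] ij by (auto simp: space_differentiable_def nabla)
    show "BC_norm M W \<sigma> \<tau> r lam mu k {0..} (r_plus u) < \<infinity>"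
      using norm BC_spaceD(6)[OF u] by (rule le_less_trans)
  qed
qed simp

section \<open>The extension\<close>

lemma nabla_dt_e_plus:
  assumes h: "extension_kernel h" and u: "u \<in> fst (BC_space M W \<sigma> \<tau> r lam mu k {0..})"
    and "i + j * r \<le> k * r"
  shows "nabla_dt M W UNIV i j (e_plus h u) = e_plus (moment h j) (nabla_dt M W {0..} i j u)"
  using assms(3)
proof (induction i)
  case 0
  have "nabla_dt M W UNIV 0 j (e_plus h u) = e_plus (moment h j) (nabla_dt M W {0..} 0 j u)" if "j * r \<le> k * r"
    using that
  proof (induction j)
    case 0
    then show ?case
      by (simp add: nabla_dt_0 moment_0)
  next
    case (Suc j)
    then have jr: "j * r \<le> k * r"
      unfolding mult_Suc by (blast dest: add_leD2)
    have reg: "regular_evol \<sigma> \<tau> (nabla_dt M W {0..} 0 j u)"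
      "regular_evol \<sigma> \<tau> (tder {0..} (nabla_dt M W {0..} 0 j u))"
      using regular_evol_nabla_dt[OF u, of 0 j] regular_evol_nabla_dt[OF u, of 0 "Suc j"] jr Suc.prems
      by (simp_all add: nabla_dt_0_Suc)
    show ?case
      unfolding nabla_dt_0_Suc Suc.IH[OF jr] moment_Suc
      by (rule tder_e_plus[OF reg(1) BC_spaceD(4)[OF u Suc.prems] reg(2) integrable_moment[OF h] integral_moment[OF h]
          integrable_moment[OF h, of "Suc j", unfolded moment_Suc] integral_moment[OF h, of "Suc j", unfolded moment_Suc]])
  qed
  with 0 show ?case
    by simp
next
  case (Suc i)
  then have ij: "i + j * r \<le> k * r"
    by simp
  have "regular_evol \<sigma> (\<tau> + Suc i) (\<lambda>t. covd K g W (nabla_dt M W {0..} i j u t))"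
    using regular_evol_nabla_dt[OF u Suc.prems] by (simp add: nabla_dt_Suc)
  from covd_e_plus[OF regular_evol_nabla_dt[OF u ij] BC_spaceD(5)[OF u Suc.prems] this integrable_moment[OF h]]
  show ?case
    unfolding nabla_dt_Suc Suc.IH[OF ij] by (intro ext) simp
qed

lemma BC_norm_e_plus_le:
  assumes h: "extension_kernel h" and u: "u \<in> fst (BC_space M W \<sigma> \<tau> r lam mu k {0..})" and "0 < r"
  shows "BC_norm M W \<sigma> \<tau> r lam mu k UNIV (e_plus h u)
    \<le> ennreal (\<Sum>j\<le>k. \<integral>s. \<bar>moment h j s\<bar> \<partial>half_line) * BC_norm M W \<sigma> \<tau> r lam mu k {0..} u"
proof (rule BC_norm_least)
  fix i j t \<kappa> p assume ij: "i + j * r \<le> k * r" and \<kappa>: "\<kappa> \<in> K" and p: "p \<in> dom \<kappa>"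
  let ?c = "\<Sum>j\<le>k. \<integral>s. \<bar>moment h j s\<bar> \<partial>half_line"
  let ?N = "enn2real (BC_norm M W \<sigma> \<tau> r lam mu k {0..} u)"
  let ?w = "nabla_dt M W {0..} i j u"
  let ?C = "\<integral>s. \<bar>moment h j s\<bar> \<partial>half_line"
  let ?e = "\<rho> p powr (lam + real i + real j * mu + real \<tau> - real \<sigma>)"
  note C1 = integral_abs_moment[OF h]
  \<comment> \<open>With \<open>r > 0\<close> this gives \<open>j \<le> k\<close>, so the absolute
    integral of the \<open>j\<close>th kernel is one of the summands of the constant.\<close>
  have "j * r \<le> k * r"
    using ij by (rule add_leD2)
  then have "?C \<le> ?c"
    using \<open>0 < r\<close> by (intro member_le_sum) (auto intro: order_trans[OF zero_le_one C1])
  have e: "0 < ?e"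
    using weight_pos[of p] by simp
  have w: "?e * tnorm g W \<sigma> (\<tau> + i) \<kappa> p (?w t p) \<le> ?N" if "0 \<le> t" for t
    using tnorm_nabla_dt_le[OF u ij _ \<kappa> p, of t] that by simp
  have reg: "regular_evol \<sigma> (\<tau> + i) ?w"
    by (rule regular_evol_nabla_dt[OF u ij])
  have "?e * tnorm g W \<sigma> (\<tau> + i) \<kappa> p (e_plus (moment h j) ?w t p) \<le> ?C * ?N"
  proof (cases "0 \<le> t")
    case True
    have "1 * ?N \<le> ?C * ?N"
      by (intro mult_right_mono C1) simp
    with w[OF True] True show ?thesis
      by (simp add: e_plus_nonneg)
  next
    case False
    then have t: "t < 0"
      by simp
    have st: "0 \<le> - s * t" if "s \<in> space half_line" for s
      using that t by (simp add: mult_nonneg_nonpos)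
    \<comment> \<open>The weight depends on \<open>p\<close> only. Divided by it, the weighted norm
      bounds the fiber norms at all nonnegative times, as Minkowski's inequality requires.\<close>
    have "tnorm g W \<sigma> (\<tau> + i) \<kappa> p (e_plus (moment h j) ?w t p) \<le> ?C * (?N / ?e)"
    proof (rule tnorm_integral[OF \<kappa> p integrable_moment[OF h], where v = "\<lambda>s. ?w (- s * t) p"])
      show "0 < ?C"
        using C1[of j] by linarith
      show "?w (- s * t) p \<kappa> I L \<in> F" if "s \<in> space half_line" for s I L
        by (rule regular_evol_in_F[OF reg st[OF that]])
      show "integrable half_line (\<lambda>s. moment h j s *\<^sub>R ?w (- s * t) p \<kappa> I L)" for I L
        using t by (intro regular_evol_integrable[OF reg integrable_moment[OF h]]) simp
      show "e_plus (moment h j) ?w t p \<kappa> I L = (\<integral>s. moment h j s *\<^sub>R ?w (- s * t) p \<kappa> I L \<partial>half_line)" for I L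
        unfolding e_plus_extend extend_eq_integral[OF t] ..
      show "tnorm g W \<sigma> (\<tau> + i) \<kappa> p (?w (- s * t) p) \<le> ?N / ?e" if "s \<in> space half_line" for s
        using w[OF st[OF that]] e by (simp add: pos_le_divide_eq mult.commute)
      show "0 \<le> ?N / ?e"
        using e by simp
    qed
    then have "?e * tnorm g W \<sigma> (\<tau> + i) \<kappa> p (e_plus (moment h j) ?w t p) \<le> ?e * (?C * (?N / ?e))"
      using e by (intro mult_left_mono) auto
    then show ?thesis
      using e by simp
  qed
  also have "?C * ?N \<le> ?c * ?N"
    by (intro mult_right_mono \<open>?C \<le> ?c\<close>) simp
  finally have "ennreal (?e * tnorm g W \<sigma> (\<tau> + i) \<kappa> p (e_plus (moment h j) ?w t p)) \<le> ennreal (?c * ?N)"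
    by (rule ennreal_leI)
  also have "\<dots> = ennreal ?c * BC_norm M W \<sigma> \<tau> r lam mu k {0..} u"
    using BC_spaceD(6)[OF u] by (subst ennreal_mult) (auto intro!: sum_nonneg simp: less_top)
  finally show "ennreal (?e * tnorm g W \<sigma> (\<tau> + i) \<kappa> p (nabla_dt M W UNIV i j (e_plus h u) t p))
      \<le> ennreal ?c * BC_norm M W \<sigma> \<tau> r lam mu k {0..} u"
    by (simp add: nabla_dt_e_plus[OF h u ij])
qed

lemma e_plus_tensor_fiber:
  assumes h: "extension_kernel h" and u: "u \<in> fst (BC_space M W \<sigma> \<tau> r lam mu k {0..})"
  shows "e_plus h u t p \<in> tensor_fiber K W \<sigma> \<tau> p"
proof (cases "0 \<le> t")
  case True
  then show ?thesis
    using BC_spaceD(2)[OF u] by (simp add: e_plus_nonneg)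
next
  case False
  then have t: "t < 0"
    by simp
  have reg: "regular_evol \<sigma> \<tau> u"
    using regular_evol_nabla_dt[OF u, of 0 0] by (simp add: nabla_dt_0)
  have "(\<lambda>\<kappa> I L. \<integral>s. h s *\<^sub>R u (- s * t) p \<kappa> I L \<partial>half_line) \<in> tensor_fiber K W \<sigma> \<tau> p"
  proof (rule tensor_fiber_integral)
    show "u (- s * t) p \<in> tensor_fiber K W \<sigma> \<tau> p" if "s \<in> space half_line" for s
      using that t by (intro BC_spaceD(2)[OF u]) (auto simp: mult_nonneg_nonpos)
    show "integrable half_line (\<lambda>s. h s *\<^sub>R u (- s * t) p \<kappa> I L)" for \<kappa> I L
      using t integrable_moment[OF h, of 0] by (intro regular_evol_integrable[OF reg]) (auto simp: moment_0)
  qed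
  moreover have "e_plus h u t p = (\<lambda>\<kappa> I L. \<integral>s. h s *\<^sub>R u (- s * t) p \<kappa> I L \<partial>half_line)"
    using t by (simp add: fun_eq_iff e_plus_extend extend_def)
  ultimately show ?thesis
    by (simp only:)
qed

lemma e_plus_bounded:
  assumes h: "extension_kernel h" and "0 < r"
  shows "bounded_map (e_plus h) (BC_space M W \<sigma> \<tau> r lam mu k {0..}) (BC_space M W \<sigma> \<tau> r lam mu k UNIV)"
  unfolding bounded_map_def
proof (intro exI conjI ballI)
  let ?c = "\<Sum>j\<le>k. \<integral>s. \<bar>moment h j s\<bar> \<partial>half_line"
  show "0 < ?c"
    using integral_abs_moment[OF h] by (intro sum_pos) (auto intro: less_le_trans[OF zero_less_one])
  fix u assume u: "u \<in> fst (BC_space M W \<sigma> \<tau> r lam mu k {0..})"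
  note norm = BC_norm_e_plus_le[OF h u \<open>0 < r\<close>]
  note nabla = nabla_dt_e_plus[OF h u]
  note reg = regular_evol_nabla_dt[OF u]
  show "snd (BC_space M W \<sigma> \<tau> r lam mu k UNIV) (e_plus h u)
      \<le> ennreal ?c * snd (BC_space M W \<sigma> \<tau> r lam mu k {0..}) u"
    using norm by (simp add: BC_space_def)
  show "e_plus h u \<in> fst (BC_space M W \<sigma> \<tau> r lam mu k UNIV)"
  proof (rule BC_spaceI)
    show "e_plus h u t p \<in> tensor_fiber K W \<sigma> \<tau> p" for t p
      by (rule e_plus_tensor_fiber[OF h u])
    show "continuous_evol K UNIV (nabla_dt M W UNIV i j (e_plus h u))" if ij: "i + j * r \<le> k * r" for i j
      unfolding nabla[OF ij]
      by (rule continuous_evol_e_plus[OF reg[OF ij] integrable_moment[OF h] integral_moment[OF h]])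
    show "time_differentiable UNIV (nabla_dt M W UNIV 0 j (e_plus h u))" if j: "Suc j * r \<le> k * r" for j
    proof -
      have jr: "0 + j * r \<le> k * r" "0 + Suc j * r \<le> k * r"
        using j unfolding mult_Suc add_0 by (blast dest: add_leD2)+
      have "regular_evol \<sigma> (\<tau> + 0) (tder {0..} (nabla_dt M W {0..} 0 j u))"
        using reg[OF jr(2)] by (simp only: nabla_dt_0_Suc)
      then show ?thesis
        unfolding nabla[OF jr(1)]
        by (rule time_differentiable_e_plus[OF reg[OF jr(1)] BC_spaceD(4)[OF u j] _ integrable_moment[OF h] integral_moment[OF h]
          integrable_moment[OF h, of "Suc j", unfolded moment_Suc] integral_moment[OF h, of "Suc j", unfolded moment_Suc]])
    qed
    show "space_differentiable K UNIV (nabla_dt M W UNIV i j (e_plus h u))" if ij: "Suc i + j * r \<le> k * r" for i j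
    proof -
      have ij': "i + j * r \<le> k * r"
        using ij by simp
      have "regular_evol \<sigma> (\<tau> + Suc i) (\<lambda>t. covd K g W (nabla_dt M W {0..} i j u t))"
        using reg[OF ij] by (simp only: nabla_dt_Suc)
      then show ?thesis
        unfolding nabla[OF ij']
        by (rule space_differentiable_e_plus[OF reg[OF ij'] BC_spaceD(5)[OF u ij] _ integrable_moment[OF h]])
    qed
    show "BC_norm M W \<sigma> \<tau> r lam mu k UNIV (e_plus h u) < \<infinity>"
      by (rule le_less_trans[OF norm]) (use BC_spaceD(6)[OF u] in \<open>simp add: ennreal_mult_less_top\<close>)
  qed simp
qed

lemma BC_space_extension_integrable:
  assumes "extension_kernel h" "u \<in> fst (BC_space M W \<sigma> \<tau> r lam mu k {0..})"
  shows "extension_integrable h u"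
proof -
  have "regular_evol \<sigma> \<tau> u"
    using regular_evol_nabla_dt[OF assms(2), of 0 0] by (simp add: nabla_dt_0)
  then show ?thesis
    unfolding extension_integrable_def
    using regular_evol_integrable integrable_moment[OF assms(1), of 0] by (auto simp: moment_0)
qed

end


subsection \<open>Closures and interpolation\<close>

text \<open>The image of an approximant from \<open>A\<close> approximates the image. The last
  assumption replaces closedness under subtraction and concerns differences of finite norm
  only.\<close>

lemma bounded_map_closure:
  fixes X :: "'v::ab_group_add nspace" and Y :: "'w::ab_group_add nspace"
  assumes T: "bounded_map T X Y" and D: "\<And>u. u \<in> A \<Longrightarrow> T u \<in> B"
    and diff: "\<And>u v. u \<in> fst X \<Longrightarrow> v \<in> fst X \<Longrightarrow> T (u - v) = T u - T v"
    and X: "\<And>u v. u \<in> fst X \<Longrightarrow> v \<in> fst X \<Longrightarrow> snd X (u - v) < \<infinity> \<Longrightarrow> u - v \<in> fst X"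
  shows "bounded_map T (closure_in A X) (closure_in B Y)"
proof -
  obtain c :: real where c: "0 < c" and Y: "\<And>u. u \<in> fst X \<Longrightarrow> T u \<in> fst Y"
    and le: "\<And>u. u \<in> fst X \<Longrightarrow> snd Y (T u) \<le> ennreal c * snd X u"
    using T unfolding bounded_map_def by blast
  have "T u \<in> fst (closure_in B Y)" if "u \<in> fst (closure_in A X)" for u
  proof -
    have u: "u \<in> fst X" and approx: "\<And>\<epsilon>. 0 < \<epsilon> \<Longrightarrow> \<exists>v \<in> A \<inter> fst X. snd X (u - v) < \<epsilon>"
      using that by (auto simp: closure_in_def)
    have "\<exists>v \<in> B \<inter> fst Y. snd Y (T u - v) < \<epsilon>" if \<epsilon>: "0 < \<epsilon>" for \<epsilon>
    proof -
      \<comment> \<open>The second entry makes the image distance smaller than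
        \<open>\<epsilon>\<close>; the first keeps the distance finite, also for infinite
        \<open>\<epsilon>\<close>.\<close>
      have "0 < min 1 (\<epsilon> / ennreal c)"
        using \<epsilon> by (simp add: ennreal_zero_less_divide)
      then obtain v where v: "v \<in> A" "v \<in> fst X" "snd X (u - v) < min 1 (\<epsilon> / ennreal c)"
        using approx by blast
      then have uv: "u - v \<in> fst X"
        by (intro X u) (auto intro: less_trans[OF _ ennreal_one_less_top])
      have "snd Y (T u - T v) \<le> ennreal c * snd X (u - v)"
        using le[OF uv] by (simp add: diff u v)
      also have "\<dots> < \<epsilon>"
        using v(3) c unfolding min_less_iff_conj
        using divide_le_posI_ennreal[of "ennreal c" \<epsilon> "snd X (u - v)"]
        by (auto simp: not_le[symmetric])
      finally show ?thesis
        using D v Y by blast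
    qed
    then show ?thesis
      using Y[OF u] by (simp add: closure_in_def)
  qed
  then show ?thesis
    unfolding bounded_map_def using c le by (auto simp: closure_in_def intro!: exI[of _ c])
qed

text \<open>Without a decomposition the K-functional is an infimum over the empty set, hence
  infinite; the value at \<open>t = 1\<close> already makes the norm infinite.\<close>

lemma interpolation_finite_decomposition:
  assumes "interpolation_norm X0 X1 \<theta> u < \<infinity>"
  shows "\<exists>a\<in>fst X0. \<exists>b\<in>fst X1. u = a + b"
proof (rule ccontr)
  assume "\<not> ?thesis"
  then have "{(a, b). a \<in> fst X0 \<and> b \<in> fst X1 \<and> u = a + b} = {}"
    by auto
  then have "K_functional X0 X1 1 u = top"
    unfolding K_functional_def by (simp only: image_empty Inf_empty)
  then have "ennreal (1 powr (- \<theta>)) * K_functional X0 X1 1 u = \<infinity>"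
    by (simp add: ennreal_mult_top)
  moreover have "ennreal (1 powr (- \<theta>)) * K_functional X0 X1 1 u \<le> interpolation_norm X0 X1 \<theta> u"
    unfolding interpolation_norm_def by (rule SUP_upper) simp
  ultimately show False
    using assms by (simp add: top.extremum_unique)
qed

text \<open>A decomposition \<open>a + b\<close> is mapped to the decomposition
  \<open>T a + T b\<close>, and the larger of the two constants works for every \<open>t\<close>.
  Additivity is used for such sums only.\<close>

lemma bounded_map_interpolation:
  assumes T0: "bounded_map T X0 Y0" and T1: "bounded_map T X1 Y1"
    and add: "\<And>a b. a \<in> fst X0 \<Longrightarrow> b \<in> fst X1 \<Longrightarrow> T (a + b) = T a + T b"
  shows "bounded_map T (real_interpolation_infty X0 X1 \<theta>) (real_interpolation_infty Y0 Y1 \<theta>)"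
proof -
  obtain c0 :: real where c0: "0 < c0" and Y0: "\<And>u. u \<in> fst X0 \<Longrightarrow> T u \<in> fst Y0"
    and le0: "\<And>u. u \<in> fst X0 \<Longrightarrow> snd Y0 (T u) \<le> ennreal c0 * snd X0 u"
    using T0 unfolding bounded_map_def by blast
  obtain c1 :: real where c1: "0 < c1" and Y1: "\<And>u. u \<in> fst X1 \<Longrightarrow> T u \<in> fst Y1"
    and le1: "\<And>u. u \<in> fst X1 \<Longrightarrow> snd Y1 (T u) \<le> ennreal c1 * snd X1 u"
    using T1 unfolding bounded_map_def by blast
  define c where "c = ennreal (max c0 c1)"
  have c: "c \<noteq> 0" "c \<noteq> top" "ennreal c0 \<le> c" "ennreal c1 \<le> c"
    using c0 by (auto simp: c_def ennreal_leI)
  have K: "K_functional Y0 Y1 t (T u) \<le> c * K_functional X0 X1 t u" for t u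
  proof -
    \<comment> \<open>With \<open>c\<close> moved to the left, the infimum on the right is treated
      one decomposition at a time; an element without any is included.\<close>
    have "K_functional Y0 Y1 t (T u) / c \<le> K_functional X0 X1 t u"
      unfolding K_functional_def[of X0]
    proof (rule INF_greatest, clarsimp)
      fix a b assume ab: "a \<in> fst X0" "b \<in> fst X1"
      have "K_functional Y0 Y1 t (T (a + b)) \<le> snd Y0 (T a) + ennreal t * snd Y1 (T b)"
        unfolding K_functional_def
        by (rule INF_lower2[of "(T a, T b)"]) (use ab Y0 Y1 add in auto)
      also have "\<dots> \<le> c * snd X0 a + ennreal t * (c * snd X1 b)"
        using order_trans[OF le0[OF ab(1)] mult_right_mono[OF c(3)]]
          order_trans[OF le1[OF ab(2)] mult_right_mono[OF c(4)]]
        by (intro add_mono mult_left_mono) auto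
      also have "\<dots> = c * (snd X0 a + ennreal t * snd X1 b)"
        by (simp add: distrib_left mult.left_commute)
      finally show "K_functional Y0 Y1 t (T (a + b)) / c \<le> snd X0 a + ennreal t * snd X1 b"
        using c by (intro divide_le_posI_ennreal) (auto simp: zero_less_iff_neq_zero)
    qed
    then have "c * (K_functional Y0 Y1 t (T u) / c) \<le> c * K_functional X0 X1 t u"
      by (rule mult_left_mono) simp
    moreover have "c * (K_functional Y0 Y1 t (T u) / c) = K_functional Y0 Y1 t (T u)"
      using mult_divide_eq_ennreal[OF c(1,2)] by (simp add: ennreal_times_divide mult.commute[of c])
    ultimately show ?thesis
      by simp
  qed
  have I: "interpolation_norm Y0 Y1 \<theta> (T u) \<le> c * interpolation_norm X0 X1 \<theta> u" for u
    unfolding interpolation_norm_def SUP_mult_left_ennreal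
    by (rule SUP_mono', subst mult.left_commute, rule mult_left_mono[OF K]) simp
  have "interpolation_norm Y0 Y1 \<theta> (T u) < \<infinity>" if "interpolation_norm X0 X1 \<theta> u < \<infinity>" for u
    by (rule le_less_trans[OF I]) (use that c in \<open>simp add: ennreal_mult_less_top less_top\<close>)
  then show ?thesis
    unfolding bounded_map_def real_interpolation_infty_def
    using I c0 by (auto simp: c_def intro!: exI[of _ "max c0 c1"])
qed

text \<open>
  All spaces of the scale lie in a common domain on which the operator is additive: an element of
  an interpolation space is a sum of two elements of spaces of integer order.
\<close>

lemma (in singular_bundle) bounded_map_aniso_space:
  assumes T: "\<And>k. bounded_map T (BC_space M W \<sigma> \<tau> r lam mu k J) (BC_space M W \<sigma> \<tau> r lam mu k J')"
    and J: "\<And>t. t \<in> J \<Longrightarrow> at t within J \<noteq> bot"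
    and D: "\<And>k. fst (BC_space M W \<sigma> \<tau> r lam mu k J) \<subseteq> D"
    and D_add: "\<And>u v. u \<in> D \<Longrightarrow> v \<in> D \<Longrightarrow> u + v \<in> D" and D_diff: "\<And>u v. u \<in> D \<Longrightarrow> v \<in> D \<Longrightarrow> u - v \<in> D"
    and add: "\<And>u v. u \<in> D \<Longrightarrow> v \<in> D \<Longrightarrow> T (u + v) = T u + T v"
  shows "fst (aniso_space \<B> M W \<sigma> \<tau> r lam mu s J) \<subseteq> D \<and>
    bounded_map T (aniso_space \<B> M W \<sigma> \<tau> r lam mu s J) (aniso_space \<B> M W \<sigma> \<tau> r lam mu s J')"
proof -
  have diff: "T (u - v) = T u - T v" if "u \<in> D" "v \<in> D" for u v
    using add[OF D_diff[OF that] that(2)] by (simp add: algebra_simps)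
  have infty: "T u \<in> BC_infty M W \<sigma> \<tau> r lam mu J'" if "u \<in> BC_infty M W \<sigma> \<tau> r lam mu J" for u
    using that T unfolding BC_infty_def bounded_map_def by blast
  have snd_BC: "snd (BC_space M W \<sigma> \<tau> r lam mu k J) = BC_norm M W \<sigma> \<tau> r lam mu k J" for k
    by (simp add: BC_space_def)
  have closure_D: "fst (closure_in A X) \<subseteq> fst X" for A and X :: "('a,'m,'k,'n) evol nspace"
    by (auto simp: closure_in_def)
  have bc: "bounded_map T (bc_space M W \<sigma> \<tau> r lam mu k J) (bc_space M W \<sigma> \<tau> r lam mu k J')" for k
    unfolding bc_space_def
  proof (rule bounded_map_closure[OF T infty])
    fix u v assume uv: "u \<in> fst (BC_space M W \<sigma> \<tau> r lam mu k J)" "v \<in> fst (BC_space M W \<sigma> \<tau> r lam mu k J)"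
    show "T (u - v) = T u - T v"
      using uv D by (intro diff) auto
    show "u - v \<in> fst (BC_space M W \<sigma> \<tau> r lam mu k J)" if "snd (BC_space M W \<sigma> \<tau> r lam mu k J) (u - v) < \<infinity>"
      by (rule BC_space_diff[OF uv J]) (use that snd_BC in auto)
  qed
  have bc_D: "fst (bc_space M W \<sigma> \<tau> r lam mu k J) \<subseteq> D" for k
    using D closure_D unfolding bc_space_def by blast
  have interp: "fst (real_interpolation_infty (bc_space M W \<sigma> \<tau> r lam mu k J) (bc_space M W \<sigma> \<tau> r lam mu l J) \<theta>) \<subseteq> D"
    "bounded_map T (real_interpolation_infty (bc_space M W \<sigma> \<tau> r lam mu k J) (bc_space M W \<sigma> \<tau> r lam mu l J) \<theta>)
      (real_interpolation_infty (bc_space M W \<sigma> \<tau> r lam mu k J') (bc_space M W \<sigma> \<tau> r lam mu l J') \<theta>)" for k l \<theta>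
  proof -
    show "fst (real_interpolation_infty (bc_space M W \<sigma> \<tau> r lam mu k J) (bc_space M W \<sigma> \<tau> r lam mu l J) \<theta>) \<subseteq> D"
    proof
      fix u assume "u \<in> fst (real_interpolation_infty (bc_space M W \<sigma> \<tau> r lam mu k J) (bc_space M W \<sigma> \<tau> r lam mu l J) \<theta>)"
      then have "interpolation_norm (bc_space M W \<sigma> \<tau> r lam mu k J) (bc_space M W \<sigma> \<tau> r lam mu l J) \<theta> u < \<infinity>"
        by (simp add: real_interpolation_infty_def)
      from interpolation_finite_decomposition[OF this] show "u \<in> D"
        using bc_D[of k] bc_D[of l] by (auto intro!: D_add)
    qed
    show "bounded_map T (real_interpolation_infty (bc_space M W \<sigma> \<tau> r lam mu k J) (bc_space M W \<sigma> \<tau> r lam mu l J) \<theta>)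
      (real_interpolation_infty (bc_space M W \<sigma> \<tau> r lam mu k J') (bc_space M W \<sigma> \<tau> r lam mu l J') \<theta>)"
      using bc_D by (intro bounded_map_interpolation bc add) auto
  qed
  have B: "fst (B_infty_space M W \<sigma> \<tau> r lam mu s J) \<subseteq> D"
    "bounded_map T (B_infty_space M W \<sigma> \<tau> r lam mu s J) (B_infty_space M W \<sigma> \<tau> r lam mu s J')"
    unfolding B_infty_space_def Let_def using interp by auto
  \<comment> \<open>Finiteness of the norm is the only condition for membership, so the hypothesis
    on differences in the closure lemma is immediate.\<close>
  have B_fst: "fst (B_infty_space M W \<sigma> \<tau> r lam mu s J) = {u. snd (B_infty_space M W \<sigma> \<tau> r lam mu s J) u < \<infinity>}"
    unfolding B_infty_space_def Let_def real_interpolation_infty_def by auto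
  have b: "bounded_map T (closure_in (BC_infty M W \<sigma> \<tau> r lam mu J) (B_infty_space M W \<sigma> \<tau> r lam mu s J))
      (closure_in (BC_infty M W \<sigma> \<tau> r lam mu J') (B_infty_space M W \<sigma> \<tau> r lam mu s J'))"
    by (rule bounded_map_closure[OF B(2) infty]) (use B(1) diff in \<open>auto simp: B_fst\<close>)
  show ?thesis
  proof (cases \<B>)
    case BC_kind
    then show ?thesis
      using D T by simp
  next
    case bc_kind
    then show ?thesis
      using bc_D bc by simp
  next
    case B_infty_kind
    then show ?thesis
      using B by simp
  next
    case b_infty_kind
    then show ?thesis
      using b subset_trans[OF closure_D B(1)] by simp
  qed
qed

section \<open>Linearity of the extension and the retraction theorem\<close>

lemma bounded_operatorsI:
  assumes "bounded_map T X Y" "fst X \<subseteq> D"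
    and "\<And>u v. u \<in> D \<Longrightarrow> v \<in> D \<Longrightarrow> T (u + v) = T u + T v"
    and "\<And>z u. u \<in> D \<Longrightarrow> T (evol_scale z u) = evol_scale z (T u)"
  shows "T \<in> bounded_operators X Y"
  using assms unfolding bounded_operators_def bounded_map_def by blast

lemma e_plus_add:
  assumes "extension_integrable h u" "extension_integrable h v"
  shows "e_plus h (u + v) = e_plus h u + e_plus h v"
proof -
  have "e_plus h (u + v) t p \<kappa> I L = e_plus h u t p \<kappa> I L + e_plus h v t p \<kappa> I L" for t p \<kappa> I L
    using assms by (simp add: e_plus_extend extend_def extension_integrable_def scaleR_add_right)
  then show ?thesis
    by (simp add: fun_eq_iff)
qed

lemma e_plus_scale:
  fixes u :: "('a,'m::finite,'k::{real_normed_field,euclidean_space},'n::finite) evol"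
  assumes "extension_integrable h u"
  shows "e_plus h (evol_scale z u) = evol_scale z (e_plus h u)"
proof -
  have "linear (\<lambda>x :: 'k^'n. z *s x)"
    by (rule linearI) (simp_all add: vector_add_ldistrib vec_eq_iff)
  then have bl: "bounded_linear (\<lambda>x :: 'k^'n. z *s x)"
    by (simp add: linear_conv_bounded_linear)
  have "e_plus h (evol_scale z u) t p \<kappa> I L = z *s e_plus h u t p \<kappa> I L" for t p \<kappa> I L
  proof (cases "0 \<le> t")
    case True
    then show ?thesis
      by (simp add: e_plus_extend extend_def evol_scale_def)
  next
    case False
    have "h s *\<^sub>R (z *s u (- s * t) p \<kappa> I L) = z *s (h s *\<^sub>R u (- s * t) p \<kappa> I L)" for s
      by (simp add: vec_eq_iff)
    moreover have "integrable half_line (\<lambda>s. h s *\<^sub>R u (- s * t) p \<kappa> I L)"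
      using assms False by (simp add: extension_integrable_def)
    ultimately show ?thesis
      using False integral_bounded_linear[OF bl, of half_line "\<lambda>s. h s *\<^sub>R u (- s * t) p \<kappa> I L"]
      by (simp add: e_plus_extend extend_def evol_scale_def)
  qed
  then show ?thesis
    by (simp add: fun_eq_iff evol_scale_def)
qed

theorem theorem17p2:
  fixes M :: "('a::{metric_space,second_countable_topology}, 'm::{finite,linorder}) sing_mf"
    and W :: "('w, 'a, 'm, 'k::{real_normed_field,euclidean_space}, 'n::finite) vbundle"
    and \<sigma> \<tau> r :: nat and lam mu s :: real
    and h :: "real \<Rightarrow> real" and \<B> :: space_kind
  assumes "singular_manifold M"
    and "fully_uniformly_regular M W"
    and "0 < r"
    and "extension_kernel h"
    and "(\<exists>k::nat. s = real r * real k) \<and> \<B> \<in> {BC_kind, bc_kind}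
         \<or> 0 < s \<and> \<B> \<in> {B_infty_kind, b_infty_kind}"
  shows "r_plus \<in> bounded_operators (aniso_space \<B> M W \<sigma> \<tau> r lam mu s UNIV)
                                    (aniso_space \<B> M W \<sigma> \<tau> r lam mu s {0..})
       \<and> e_plus h \<in> bounded_operators (aniso_space \<B> M W \<sigma> \<tau> r lam mu s {0..})
                                      (aniso_space \<B> M W \<sigma> \<tau> r lam mu s UNIV)
       \<and> (\<forall>v \<in> fst (aniso_space \<B> M W \<sigma> \<tau> r lam mu s {0..}). r_plus (e_plus h v) = v)"
proof -
  interpret singular_bundle M W
    using assms(1,2) by unfold_locales
  have r_add: "r_plus (u + v) = r_plus u + r_plus v" for u v :: "('a,'m,'k,'n) evol"
    by (simp add: r_plus_def fun_eq_iff)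
  have "r_plus (evol_scale z u) = evol_scale z (r_plus u)" for z and u :: "('a,'m,'k,'n) evol"
    by (simp add: r_plus_def evol_scale_def fun_eq_iff)
  then have r: "r_plus \<in> bounded_operators (aniso_space \<B> M W \<sigma> \<tau> r lam mu s UNIV) (aniso_space \<B> M W \<sigma> \<tau> r lam mu s {0..})"
    using bounded_map_aniso_space[OF r_plus_bounded, where D = UNIV and \<B> = \<B>] r_add
    by (intro bounded_operatorsI[where D = UNIV]) auto
  \<comment> \<open>Integrability makes \<open>e_plus h\<close> linear on this domain. Vanishing at
    negative times is what \<open>r_plus (e_plus h v) = v\<close> requires there; as part of the
    domain it carries over to the interpolation spaces.\<close>
  let ?D = "{u :: ('a,'m,'k,'n) evol. extension_integrable h u \<and> (\<forall>t<0. u t = 0)}"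
  have D: "fst (BC_space M W \<sigma> \<tau> r lam mu k {0..}) \<subseteq> ?D" for k
    using BC_space_extension_integrable[OF assms(4)] by (auto intro: BC_spaceD(1))
  have D_add: "u + v \<in> ?D" and D_diff: "u - v \<in> ?D" if "u \<in> ?D" "v \<in> ?D" for u v
    using that by (auto simp: extension_integrable_def scaleR_add_right scaleR_diff_right)
  have e_add: "e_plus h (u + v) = e_plus h u + e_plus h v" if "u \<in> ?D" "v \<in> ?D" for u v
    using that by (simp add: e_plus_add)
  have e: "fst (aniso_space \<B> M W \<sigma> \<tau> r lam mu s {0..}) \<subseteq> ?D \<and>
    bounded_map (e_plus h) (aniso_space \<B> M W \<sigma> \<tau> r lam mu s {0..}) (aniso_space \<B> M W \<sigma> \<tau> r lam mu s UNIV)"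
  proof (rule bounded_map_aniso_space[where D = ?D])
    show "bounded_map (e_plus h) (BC_space M W \<sigma> \<tau> r lam mu k {0..}) (BC_space M W \<sigma> \<tau> r lam mu k UNIV)" for k
      by (rule e_plus_bounded[OF assms(4,3)])
    show "at t within {0..} \<noteq> bot" if "t \<in> {0..}" for t :: real
      by (rule at_within_nonneg_neq_bot[OF that])
  qed (fact D D_add D_diff e_add)+
  then have "e_plus h \<in> bounded_operators (aniso_space \<B> M W \<sigma> \<tau> r lam mu s {0..}) (aniso_space \<B> M W \<sigma> \<tau> r lam mu s UNIV)"
    by (elim conjE, intro bounded_operatorsI[where D = ?D] e_add e_plus_scale) simp_all
  moreover have "r_plus (e_plus h v) = v" if "v \<in> fst (aniso_space \<B> M W \<sigma> \<tau> r lam mu s {0..})" for v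
    using that e by (auto simp: r_plus_def e_plus_def fun_eq_iff)
  ultimately show ?thesis
    using r by blast
qed

end
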